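(* Let $N\ge 1$ be an integer. For any integer $m\ge 1$ and any $n\in\mathbb{Z}$, there is a short exact sequence of vector bundles on $\mathbf{P}^N$ $$0\longrightarrow S^m\Omega_{\mathbf{P}^N}(m+n)\longrightarrow \mathbb{C}[Y]_m\otimes\mathcal{O}_{\mathbf{P}^N}(n)\overset{\delta}{\longrightarrow}\mathbb{C}[Y]_{m-1}\otimes\mathcal{O}_{\mathbf{P}^N}(n+1)\longrightarrow 0,$$ where $\delta=\sum_{i=0}^{N}X_i\frac{\partial}{\partial Y_i}$.
   Context: $\mathbf{P}^N$ is complex projective space with homogeneous coordinates $X_0,\dots,X_N\in H^0(\mathbf{P}^N,\mathcal{O}_{\mathbf{P}^N}(1))$. $Y=(Y_0,\dots,Y_N)$ are auxiliary variables, and $\mathbb{C}[Y]_m$ is the space of homogeneous polynomials of degree $m$ in $Y$. The map $\delta$ differentiates the polynomial in $Y$ and multiplies the local section of $\mathcal{O}_{\mathbf{P}^N}(n)$ by $X_i$. $\Omega_{\mathbf{P}^N}$ is the cotangent bundle, $S^m$ the $m$th symmetric power, and $(k)$ denotes the twist by $\mathcal{O}_{\mathbf{P}^N}(k)$. *)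

theory Defs
  imports
    "HOL-Analysis.Analysis"
    "HOL-Library.Function_Algebras"
    "HOL-Library.Poly_Mapping"
    "HOL-Library.Multiset"
begin

section \<open>Complex vector spaces\<close>

class complex_vector = ab_group_add +
  fixes scaleC :: "complex \<Rightarrow> 'a \<Rightarrow> 'a" (infixr \<open>*\<^sub>C\<close> 75)
  assumes scaleC_add_right: "c *\<^sub>C (x + y) = c *\<^sub>C x + c *\<^sub>C y"
    and scaleC_add_left: "(c + d) *\<^sub>C x = c *\<^sub>C x + d *\<^sub>C x"
    and scaleC_scaleC: "c *\<^sub>C d *\<^sub>C x = (c * d) *\<^sub>C x"
    and scaleC_one: "1 *\<^sub>C x = x"

global_interpretation complex_vector: vector_space "scaleC :: complex \<Rightarrow> 'a \<Rightarrow> 'a::complex_vector"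
  by unfold_locales (simp_all add: scaleC_add_right scaleC_add_left scaleC_scaleC scaleC_one)

instantiation complex :: complex_vector
begin
definition scaleC_complex :: "complex \<Rightarrow> complex \<Rightarrow> complex" where
  "c *\<^sub>C x = c * x"
instance by standard (simp_all add: scaleC_complex_def algebra_simps)
end

instantiation "fun" :: (type, complex_vector) complex_vector
begin
definition scaleC_fun :: "complex \<Rightarrow> ('a \<Rightarrow> 'b) \<Rightarrow> 'a \<Rightarrow> 'b" where
  "c *\<^sub>C f = (\<lambda>x. c *\<^sub>C f x)"
instance
  by standard
    (simp_all add: scaleC_fun_def fun_eq_iff scaleC_add_right scaleC_add_left scaleC_scaleC scaleC_one)
end

instantiation poly_mapping :: (type, complex_vector) complex_vector
begin
lift_definition scaleC_poly_mapping :: "complex \<Rightarrow> ('a \<Rightarrow>\<^sub>0 'b) \<Rightarrow> 'a \<Rightarrow>\<^sub>0 'b"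
  is "\<lambda>c f k. c *\<^sub>C f k"
  by (erule finite_subset[rotated]) (auto simp: complex_vector.scale_zero_right)
instance
  by standard
    (transfer; simp add: fun_eq_iff scaleC_add_right scaleC_add_left scaleC_scaleC scaleC_one)+
end


section \<open>Tensor products\<close>

text \<open>
  The tensor product of two complex vector spaces is the free vector space on the pairs
  \<open>(a, b)\<close> modulo the subspace spanned by the bilinearity relations.
\<close>

definition tensor_relations ::
    "(('a::complex_vector \<times> 'b::complex_vector) \<Rightarrow>\<^sub>0 complex) set" where
  "tensor_relations =
     {Poly_Mapping.single (a + a', b) 1 - Poly_Mapping.single (a, b) 1 - Poly_Mapping.single (a', b) 1
       | a a' b. True}
   \<union> {Poly_Mapping.single (a, b + b') 1 - Poly_Mapping.single (a, b) 1 - Poly_Mapping.single (a, b') 1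
       | a b b'. True}
   \<union> {Poly_Mapping.single (c *\<^sub>C a, b) 1 - c *\<^sub>C Poly_Mapping.single (a, b) 1 | c a b. True}
   \<union> {Poly_Mapping.single (a, c *\<^sub>C b) 1 - c *\<^sub>C Poly_Mapping.single (a, b) 1 | c a b. True}"

definition tensor_rel ::
    "('a::complex_vector \<times> 'b::complex_vector \<Rightarrow>\<^sub>0 complex) \<Rightarrow> ('a \<times> 'b \<Rightarrow>\<^sub>0 complex) \<Rightarrow> bool" where
  "tensor_rel s t \<longleftrightarrow> s - t \<in> complex_vector.span tensor_relations"

lemma equivp_mod_span:
  fixes R :: "'a::complex_vector set"
  shows "equivp (\<lambda>s t. s - t \<in> complex_vector.span R)"
proof (rule equivpI)
  show "reflp (\<lambda>s t. s - t \<in> complex_vector.span R)"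
    by (simp add: reflp_def complex_vector.span_zero)
  show "symp (\<lambda>s t. s - t \<in> complex_vector.span R)"
    by (metis (mono_tags, lifting) symp_def complex_vector.span_neg minus_diff_eq)
  show "transp (\<lambda>s t. s - t \<in> complex_vector.span R)"
  proof (rule transpI)
    fix x y z assume "x - y \<in> complex_vector.span R" "y - z \<in> complex_vector.span R"
    then have "(x - y) + (y - z) \<in> complex_vector.span R"
      by (rule complex_vector.span_add)
    then show "x - z \<in> complex_vector.span R" by simp
  qed
qed

lemma mod_span_compat:
  fixes R :: "'a::complex_vector set"
  assumes "s - s' \<in> complex_vector.span R"
  shows "t - t' \<in> complex_vector.span R \<Longrightarrow> (s + t) - (s' + t') \<in> complex_vector.span R"
    and "t - t' \<in> complex_vector.span R \<Longrightarrow> (s - t) - (s' - t') \<in> complex_vector.span R"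
    and "- s - - s' \<in> complex_vector.span R"
    and "c *\<^sub>C s - c *\<^sub>C s' \<in> complex_vector.span R"
proof -
  show "(s + t) - (s' + t') \<in> complex_vector.span R" if "t - t' \<in> complex_vector.span R"
    using complex_vector.span_add[OF assms that] by (simp add: algebra_simps)
  show "(s - t) - (s' - t') \<in> complex_vector.span R" if "t - t' \<in> complex_vector.span R"
    using complex_vector.span_diff[OF assms that] by (simp add: algebra_simps)
  show "- s - - s' \<in> complex_vector.span R"
    using complex_vector.span_neg[OF assms] by (simp add: algebra_simps)
  show "c *\<^sub>C s - c *\<^sub>C s' \<in> complex_vector.span R"
    using complex_vector.span_scale[OF assms, of c]
    by (simp add: complex_vector.scale_right_diff_distrib)
qed

quotient_type (overloaded) ('a, 'b) tensor =
    "('a::complex_vector \<times> 'b::complex_vector) \<Rightarrow>\<^sub>0 complex" / tensor_rel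
  using equivp_mod_span[of tensor_relations] by (simp add: tensor_rel_def[abs_def])

instantiation tensor :: (complex_vector, complex_vector) complex_vector
begin
lift_definition zero_tensor :: "('a, 'b) tensor" is 0 .
lift_definition plus_tensor :: "('a, 'b) tensor \<Rightarrow> ('a, 'b) tensor \<Rightarrow> ('a, 'b) tensor" is "(+)"
  by (simp add: tensor_rel_def mod_span_compat)
lift_definition minus_tensor :: "('a, 'b) tensor \<Rightarrow> ('a, 'b) tensor \<Rightarrow> ('a, 'b) tensor" is "(-)"
  by (simp add: tensor_rel_def mod_span_compat)
lift_definition uminus_tensor :: "('a, 'b) tensor \<Rightarrow> ('a, 'b) tensor" is uminus
  unfolding tensor_rel_def by (rule mod_span_compat(3))
lift_definition scaleC_tensor :: "complex \<Rightarrow> ('a, 'b) tensor \<Rightarrow> ('a, 'b) tensor" is scaleC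
  by (simp add: tensor_rel_def mod_span_compat)
instance
  by standard
    (transfer; simp add: tensor_rel_def algebra_simps complex_vector.span_zero
       scaleC_add_right scaleC_add_left scaleC_scaleC scaleC_one)+
end

lift_definition pure_tensor ::
    "'a::complex_vector \<Rightarrow> 'b::complex_vector \<Rightarrow> ('a, 'b) tensor" (infixr \<open>\<otimes>\<^sub>C\<close> 70)
  is "\<lambda>a b. Poly_Mapping.single (a, b) 1" .

definition free_extension :: "('k \<Rightarrow> 'w::complex_vector) \<Rightarrow> ('k \<Rightarrow>\<^sub>0 complex) \<Rightarrow> 'w" where
  "free_extension \<phi> a = (\<Sum>k\<in>Poly_Mapping.keys a. Poly_Mapping.lookup a k *\<^sub>C \<phi> k)"

lemma free_extension_superset:
  assumes "finite A" "Poly_Mapping.keys a \<subseteq> A"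
  shows "free_extension \<phi> a = (\<Sum>k\<in>A. Poly_Mapping.lookup a k *\<^sub>C \<phi> k)"
  unfolding free_extension_def
  by (rule sum.mono_neutral_left) (use assms in \<open>auto simp: in_keys_iff\<close>)

lemma free_extension_add: "free_extension \<phi> (a + b) = free_extension \<phi> a + free_extension \<phi> b"
proof -
  let ?A = "Poly_Mapping.keys a \<union> Poly_Mapping.keys b"
  have *: "finite ?A" "Poly_Mapping.keys (a + b) \<subseteq> ?A"
    using Poly_Mapping.keys_add[of a b] by auto
  show ?thesis
    by (simp add: free_extension_superset[OF *] free_extension_superset[of ?A]
        lookup_add scaleC_add_left sum.distrib)
qed

lemma lookup_scaleC [simp]: "Poly_Mapping.lookup (c *\<^sub>C a) k = c *\<^sub>C Poly_Mapping.lookup a k"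
  by transfer simp

lemma free_extension_scaleC: "free_extension \<phi> (c *\<^sub>C a) = c *\<^sub>C free_extension \<phi> a"
proof -
  have *: "finite (Poly_Mapping.keys a)" "Poly_Mapping.keys (c *\<^sub>C a) \<subseteq> Poly_Mapping.keys a"
    by (auto simp: in_keys_iff scaleC_complex_def)
  show ?thesis
    unfolding free_extension_superset[OF *]
    by (simp add: free_extension_def complex_vector.scale_sum_right scaleC_complex_def scaleC_scaleC)
qed

lemma free_extension_diff: "free_extension \<phi> (a - b) = free_extension \<phi> a - free_extension \<phi> b"
  using free_extension_add[of \<phi> "a - b" b] by (simp add: algebra_simps)

lemma free_extension_single [simp]: "free_extension \<phi> (Poly_Mapping.single k c) = c *\<^sub>C \<phi> k"
  by (cases "c = 0") (simp_all add: free_extension_def)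

lemma free_extension_vanishes:
  assumes "\<And>t. t \<in> R \<Longrightarrow> free_extension \<phi> t = 0" "t \<in> complex_vector.span R"
  shows "free_extension \<phi> t = 0"
  using assms(2)
proof (induction rule: complex_vector.span_induct_alt)
  case base
  show ?case by (simp add: free_extension_def)
next
  case (step c x y)
  then show ?case by (simp add: free_extension_add free_extension_scaleC assms(1))
qed

lemma pure_tensor_add_left: "(a + a') \<otimes>\<^sub>C b = a \<otimes>\<^sub>C b + a' \<otimes>\<^sub>C b"
proof (transfer, unfold tensor_rel_def)
  fix a a' :: 'a and b :: 'b
  have "Poly_Mapping.single (a + a', b) 1 - Poly_Mapping.single (a, b) 1 - Poly_Mapping.single (a', b) 1
      \<in> complex_vector.span tensor_relations"
    by (rule complex_vector.span_base) (unfold tensor_relations_def, blast)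
  then show "Poly_Mapping.single (a + a', b) 1 - (Poly_Mapping.single (a, b) 1 + Poly_Mapping.single (a', b) 1)
      \<in> complex_vector.span tensor_relations"
    by (simp add: algebra_simps)
qed

lemma pure_tensor_add_right: "a \<otimes>\<^sub>C (b + b') = a \<otimes>\<^sub>C b + a \<otimes>\<^sub>C b'"
proof (transfer, unfold tensor_rel_def)
  fix a :: 'a and b b' :: 'b
  have "Poly_Mapping.single (a, b + b') 1 - Poly_Mapping.single (a, b) 1 - Poly_Mapping.single (a, b') 1
      \<in> complex_vector.span tensor_relations"
    by (rule complex_vector.span_base) (unfold tensor_relations_def, blast)
  then show "Poly_Mapping.single (a, b + b') 1 - (Poly_Mapping.single (a, b) 1 + Poly_Mapping.single (a, b') 1)
      \<in> complex_vector.span tensor_relations"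
    by (simp add: algebra_simps)
qed

lemma pure_tensor_scaleC_left: "(c *\<^sub>C a) \<otimes>\<^sub>C b = c *\<^sub>C (a \<otimes>\<^sub>C b)"
  by (transfer, unfold tensor_rel_def, rule complex_vector.span_base)
    (unfold tensor_relations_def, blast)

lemma pure_tensor_scaleC_right: "a \<otimes>\<^sub>C (c *\<^sub>C b) = c *\<^sub>C (a \<otimes>\<^sub>C b)"
  by (transfer, unfold tensor_rel_def, rule complex_vector.span_base)
    (unfold tensor_relations_def, blast)

text \<open>
  The map \<open>f \<otimes> g\<close>, computed on a representative; for linear \<open>f\<close> and \<open>g\<close> the choice of
  representative is immaterial, as the lemmas below show.
\<close>

definition tensor_map ::
    "('a::complex_vector \<Rightarrow> 'c::complex_vector) \<Rightarrow> ('b::complex_vector \<Rightarrow> 'd::complex_vector) \<Rightarrow>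
     ('a, 'b) tensor \<Rightarrow> ('c, 'd) tensor" where
  "tensor_map f g t = free_extension (\<lambda>(a, b). f a \<otimes>\<^sub>C g b) (rep_tensor t)"

lemma tensor_map_abs:
  assumes f: "Vector_Spaces.linear scaleC scaleC f" and g: "Vector_Spaces.linear scaleC scaleC g"
  shows "tensor_map f g (abs_tensor u) = free_extension (\<lambda>(a, b). f a \<otimes>\<^sub>C g b) u"
proof -
  interpret f: Vector_Spaces.linear scaleC scaleC f by (fact f)
  interpret g: Vector_Spaces.linear scaleC scaleC g by (fact g)
  have "tensor_rel (rep_tensor (abs_tensor u)) u"
    using Quotient3_rep_abs[OF Quotient3_tensor] equivp_reflp[OF tensor_equivp] by metis
  then have "rep_tensor (abs_tensor u) - u \<in> complex_vector.span tensor_relations"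
    by (simp add: tensor_rel_def)
  moreover have "free_extension (\<lambda>(a, b). f a \<otimes>\<^sub>C g b) t = 0" if "t \<in> tensor_relations" for t
    using that unfolding tensor_relations_def
    by (auto simp: free_extension_diff free_extension_scaleC f.add g.add f.scale g.scale scaleC_one
        pure_tensor_add_left pure_tensor_add_right pure_tensor_scaleC_left pure_tensor_scaleC_right)
  ultimately have "free_extension (\<lambda>(a, b). f a \<otimes>\<^sub>C g b) (rep_tensor (abs_tensor u) - u) = 0"
    by (rule free_extension_vanishes[rotated])
  then show ?thesis by (simp add: tensor_map_def free_extension_diff)
qed

lemma tensor_map_pure:
  assumes "Vector_Spaces.linear scaleC scaleC f" "Vector_Spaces.linear scaleC scaleC g"
  shows "tensor_map f g (a \<otimes>\<^sub>C b) = f a \<otimes>\<^sub>C g b"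
  by (simp add: pure_tensor_def tensor_map_abs[OF assms] scaleC_one)

lemma tensor_map_linear:
  assumes "Vector_Spaces.linear scaleC scaleC f" "Vector_Spaces.linear scaleC scaleC g"
  shows "Vector_Spaces.linear scaleC scaleC (tensor_map f g)"
proof (unfold_locales)
  fix s t :: "('a, 'c) tensor" and c
  obtain u v where "s = abs_tensor u" "t = abs_tensor v"
    by (metis Quotient3_abs_rep[OF Quotient3_tensor])
  then show "tensor_map f g (s + t) = tensor_map f g s + tensor_map f g t"
    "tensor_map f g (c *\<^sub>C s) = c *\<^sub>C tensor_map f g s"
    by (simp_all add: plus_tensor.abs_eq scaleC_tensor.abs_eq tensor_map_abs[OF assms]
        free_extension_add free_extension_scaleC)
qed


section \<open>Symmetric powers\<close>

text \<open>
  The symmetric algebra of a complex vector space, as a graded vector space: the free vector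
  space on finite multisets of vectors (that is, on commutative monomials \<open>v\<^sub>1 \<cdots> v\<^sub>m\<close>) modulo
  multilinearity.  The \<open>m\<close>th symmetric power is the span of the products of \<open>m\<close> vectors.
\<close>

definition sym_relations :: "('a::complex_vector multiset \<Rightarrow>\<^sub>0 complex) set" where
  "sym_relations =
     {Poly_Mapping.single (add_mset (a + b) M) 1
        - Poly_Mapping.single (add_mset a M) 1 - Poly_Mapping.single (add_mset b M) 1 | a b M. True}
   \<union> {Poly_Mapping.single (add_mset (c *\<^sub>C a) M) 1
        - c *\<^sub>C Poly_Mapping.single (add_mset a M) 1 | c a M. True}"

definition sym_rel ::
    "('a::complex_vector multiset \<Rightarrow>\<^sub>0 complex) \<Rightarrow> ('a multiset \<Rightarrow>\<^sub>0 complex) \<Rightarrow> bool" where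
  "sym_rel s t \<longleftrightarrow> s - t \<in> complex_vector.span sym_relations"

quotient_type (overloaded) 'a sym = "'a::complex_vector multiset \<Rightarrow>\<^sub>0 complex" / sym_rel
  using equivp_mod_span[of sym_relations] by (simp add: sym_rel_def[abs_def])

instantiation sym :: (complex_vector) complex_vector
begin
lift_definition zero_sym :: "'a sym" is 0 .
lift_definition plus_sym :: "'a sym \<Rightarrow> 'a sym \<Rightarrow> 'a sym" is "(+)"
  by (simp add: sym_rel_def mod_span_compat)
lift_definition minus_sym :: "'a sym \<Rightarrow> 'a sym \<Rightarrow> 'a sym" is "(-)"
  by (simp add: sym_rel_def mod_span_compat)
lift_definition uminus_sym :: "'a sym \<Rightarrow> 'a sym" is uminus
  unfolding sym_rel_def by (rule mod_span_compat(3))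
lift_definition scaleC_sym :: "complex \<Rightarrow> 'a sym \<Rightarrow> 'a sym" is scaleC
  by (simp add: sym_rel_def mod_span_compat)
instance
  by standard
    (transfer; simp add: sym_rel_def algebra_simps complex_vector.span_zero
       scaleC_add_right scaleC_add_left scaleC_scaleC scaleC_one)+
end

lift_definition sym_prod :: "'a::complex_vector multiset \<Rightarrow> 'a sym"
  is "\<lambda>M. Poly_Mapping.single M 1" .


section \<open>Polynomials\<close>

type_synonym 'n mpoly = "('n \<Rightarrow>\<^sub>0 nat) \<Rightarrow>\<^sub>0 complex"

definition homogeneous :: "nat \<Rightarrow> ('n::finite) mpoly set" where
  "homogeneous d =
     {F. \<forall>a\<in>Poly_Mapping.keys F. (\<Sum>i\<in>UNIV. Poly_Mapping.lookup a i) = d}"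

definition peval :: "('n::finite) mpoly \<Rightarrow> complex ^ 'n \<Rightarrow> complex" where
  "peval F x =
     (\<Sum>a\<in>Poly_Mapping.keys F.
        Poly_Mapping.lookup F a * (\<Prod>i\<in>UNIV. (x $ i) ^ Poly_Mapping.lookup a i))"

definition partial_deriv :: "'n \<Rightarrow> ('n::finite) mpoly \<Rightarrow> 'n mpoly" where
  "partial_deriv i F =
     (\<Sum>a\<in>Poly_Mapping.keys F.
        Poly_Mapping.single (a - Poly_Mapping.single i 1)
          (of_nat (Poly_Mapping.lookup a i) * Poly_Mapping.lookup F a))"


section \<open>Projective space as an algebraic variety\<close>

text \<open>
  With \<open>N + 1\<close> the number of elements of \<open>'n\<close>, the type \<open>'n proj\<close> is the space of lines through
  the origin in \<open>\<complex>\<^bsup>N+1\<^esup>\<close>.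
\<close>

typedef (overloaded) ('n::finite) proj = "{vec.span {x} | x :: complex ^ 'n. x \<noteq> 0}"
  morphisms line Proj
  by (auto intro: exI[of _ "axis undefined 1"] simp: axis_eq_0_iff)

definition hcoords :: "('n::finite) proj \<Rightarrow> (complex ^ 'n) set" where
  "hcoords p = line p - {0}"

definition basic_open :: "('n::finite) mpoly \<Rightarrow> 'n proj set" where
  "basic_open F = {p. \<forall>x\<in>hcoords p. peval F x \<noteq> 0}"

definition zariski_open :: "('n::finite) proj set \<Rightarrow> bool" where
  "zariski_open U \<longleftrightarrow> (\<exists>S. S \<subseteq> (\<Union>d. homogeneous d) \<and> U = (\<Union>F\<in>S. basic_open F))"

definition regular_on :: "('n::finite) proj set \<Rightarrow> ('n proj \<Rightarrow> complex) \<Rightarrow> bool" where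
  "regular_on U f \<longleftrightarrow>
     (\<forall>p\<in>U. \<exists>V d. \<exists>F\<in>homogeneous d. \<exists>G\<in>homogeneous d.
        zariski_open V \<and> p \<in> V \<and> V \<subseteq> U \<and>
        (\<forall>q\<in>V. \<forall>x\<in>hcoords q. peval G x \<noteq> 0 \<and> f q = peval F x / peval G x))"

definition regular_at :: "('n::finite) proj \<Rightarrow> ('n proj \<Rightarrow> complex) \<Rightarrow> bool" where
  "regular_at p f \<longleftrightarrow> (\<exists>U. zariski_open U \<and> p \<in> U \<and> regular_on U f)"


section \<open>Vector bundles\<close>

text \<open>
  A vector bundle is given by its fibres, which are subspaces of an ambient vector space \<open>'v\<close>,
  and its regular sections over each open set.  A section over \<open>U\<close> is represented by a total
  function, whose values outside \<open>U\<close> are irrelevant.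
\<close>

record ('n, 'v) vbundle =
  fibre :: "'n proj \<Rightarrow> 'v set"
  sections :: "'n proj set \<Rightarrow> ('n proj \<Rightarrow> 'v) set"

definition local_frame ::
    "('n::finite, 'v::complex_vector) vbundle \<Rightarrow> 'n proj set \<Rightarrow> nat \<Rightarrow> (nat \<Rightarrow> 'n proj \<Rightarrow> 'v) \<Rightarrow> bool" where
  "local_frame E U r e \<longleftrightarrow>
     (\<forall>q\<in>U. bij_betw (\<lambda>c. \<Sum>i<r. c i *\<^sub>C e i q) ({..<r} \<rightarrow>\<^sub>E UNIV) (fibre E q)) \<and>
     (\<forall>V s. zariski_open V \<longrightarrow> V \<subseteq> U \<longrightarrow>
        (s \<in> sections E V \<longleftrightarrow>
          (\<exists>g. (\<forall>i<r. regular_on V (g i)) \<and> (\<forall>q\<in>V. s q = (\<Sum>i<r. g i q *\<^sub>C e i q)))))"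

definition vector_bundle :: "('n::finite, 'v::complex_vector) vbundle \<Rightarrow> bool" where
  "vector_bundle E \<longleftrightarrow>
     (\<forall>p. complex_vector.subspace (fibre E p)) \<and>
     (\<forall>U s. zariski_open U \<longrightarrow>
        (s \<in> sections E U \<longleftrightarrow>
          (\<forall>p\<in>U. \<exists>V. zariski_open V \<and> p \<in> V \<and> V \<subseteq> U \<and> s \<in> sections E V))) \<and>
     (\<forall>p. \<exists>U r e. zariski_open U \<and> p \<in> U \<and> local_frame E U r e)"

definition bundle_hom ::
    "('n::finite, 'v::complex_vector) vbundle \<Rightarrow> ('n, 'w::complex_vector) vbundle \<Rightarrow>
     ('n proj \<Rightarrow> 'v \<Rightarrow> 'w) \<Rightarrow> bool" where
  "bundle_hom E F \<phi> \<longleftrightarrow>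
     (\<forall>p. \<forall>v\<in>fibre E p. \<phi> p v \<in> fibre F p) \<and>
     (\<forall>p. \<forall>v\<in>fibre E p. \<forall>w\<in>fibre E p. \<phi> p (v + w) = \<phi> p v + \<phi> p w) \<and>
     (\<forall>p c. \<forall>v\<in>fibre E p. \<phi> p (c *\<^sub>C v) = c *\<^sub>C \<phi> p v) \<and>
     (\<forall>U s. zariski_open U \<longrightarrow> s \<in> sections E U \<longrightarrow> (\<lambda>p. \<phi> p (s p)) \<in> sections F U)"

text \<open>
  Exactness of a short sequence of vector bundles is exactness on every fibre; for bundles this is
  equivalent to exactness of the sequence of sheaves of sections.
\<close>

definition short_exact_sequence ::
    "('n::finite, 'u::complex_vector) vbundle \<Rightarrow> ('n proj \<Rightarrow> 'u \<Rightarrow> 'v) \<Rightarrow>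
     ('n, 'v::complex_vector) vbundle \<Rightarrow> ('n proj \<Rightarrow> 'v \<Rightarrow> 'w) \<Rightarrow>
     ('n, 'w::complex_vector) vbundle \<Rightarrow> bool" where
  "short_exact_sequence E \<iota> F \<delta> G \<longleftrightarrow>
     vector_bundle E \<and> vector_bundle F \<and> vector_bundle G \<and>
     bundle_hom E F \<iota> \<and> bundle_hom F G \<delta> \<and>
     (\<forall>p. inj_on (\<iota> p) (fibre E p) \<and>
          \<iota> p ` fibre E p = {v \<in> fibre F p. \<delta> p v = 0} \<and>
          \<delta> p ` fibre F p = fibre G p)"

definition trivial_bundle :: "'v::complex_vector set \<Rightarrow> ('n::finite, 'v) vbundle" where
  "trivial_bundle W =
     \<lparr>fibre = (\<lambda>p. W),
      sections = (\<lambda>U. {s. \<forall>p\<in>U. \<exists>V (r::nat) g w. zariski_open V \<and> p \<in> V \<and> V \<subseteq> U \<and>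
        (\<forall>i<r. regular_on V (g i) \<and> w i \<in> W) \<and>
        (\<forall>q\<in>V. s q = (\<Sum>i<r. g i q *\<^sub>C w i))})\<rparr>"

text \<open>
  For subspaces \<open>V\<close>, \<open>W\<close> of the ambient spaces, \<open>V \<otimes> W\<close> is identified with the span of its pure
  tensors in the ambient tensor product; over a field the canonical map is injective.  The same
  applies to symmetric powers.  Sections are the local sums of products of sections.
\<close>

definition tensor_bundle ::
    "('n::finite, 'v::complex_vector) vbundle \<Rightarrow> ('n, 'w::complex_vector) vbundle \<Rightarrow>
     ('n, ('v, 'w) tensor) vbundle" where
  "tensor_bundle E F =
     \<lparr>fibre = (\<lambda>p. complex_vector.span {v \<otimes>\<^sub>C w | v w. v \<in> fibre E p \<and> w \<in> fibre F p}),
      sections = (\<lambda>U. {s. \<forall>p\<in>U. \<exists>V (r::nat) a b. zariski_open V \<and> p \<in> V \<and> V \<subseteq> U \<and>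
        (\<forall>i<r. a i \<in> sections E V \<and> b i \<in> sections F V) \<and>
        (\<forall>q\<in>V. s q = (\<Sum>i<r. a i q \<otimes>\<^sub>C b i q))})\<rparr>"

definition sym_bundle ::
    "nat \<Rightarrow> ('n::finite, 'v::complex_vector) vbundle \<Rightarrow> ('n, 'v sym) vbundle" where
  "sym_bundle m E =
     \<lparr>fibre = (\<lambda>p. complex_vector.span
        {sym_prod M | M. size M = m \<and> set_mset M \<subseteq> fibre E p}),
      sections = (\<lambda>U. {s. \<forall>p\<in>U. \<exists>V (r::nat) g a. zariski_open V \<and> p \<in> V \<and> V \<subseteq> U \<and>
        (\<forall>i<r. regular_on V (g i) \<and> (\<forall>j<m. a i j \<in> sections E V)) \<and>
        (\<forall>q\<in>V. s q = (\<Sum>i<r. g i q *\<^sub>C sym_prod (image_mset (\<lambda>j. a i j q) (mset_set {..<m}))))})\<rparr>"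


section \<open>The line bundles of projective space\<close>

text \<open>
  The fibre of \<open>\<O>(k)\<close> at \<open>p\<close> consists of the functions on the punctured line \<open>p\<close> that are
  homogeneous of degree \<open>k\<close>, extended by zero; its local sections are the quotients \<open>F / G\<close> of
  homogeneous polynomials with \<open>deg F - deg G = k\<close>.
\<close>

definition O_fibre :: "int \<Rightarrow> ('n::finite) proj \<Rightarrow> (complex ^ 'n \<Rightarrow> complex) set" where
  "O_fibre k p =
     {f. (\<forall>x. x \<notin> hcoords p \<longrightarrow> f x = 0) \<and>
         (\<forall>x\<in>hcoords p. \<forall>c. c \<noteq> 0 \<longrightarrow> f (c *s x) = c powi k * f x)}"

definition O_bundle :: "int \<Rightarrow> ('n::finite, complex ^ 'n \<Rightarrow> complex) vbundle" where
  "O_bundle k =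
     \<lparr>fibre = O_fibre k,
      sections = (\<lambda>U. {s. \<forall>p\<in>U. s p \<in> O_fibre k p \<and>
        (\<exists>V d e. \<exists>F\<in>homogeneous d. \<exists>G\<in>homogeneous e.
           zariski_open V \<and> p \<in> V \<and> V \<subseteq> U \<and> int d - int e = k \<and>
           (\<forall>q\<in>V. \<forall>x\<in>hcoords q. peval G x \<noteq> 0 \<and> s q x = peval F x / peval G x))})\<rparr>"

definition twist ::
    "('n::finite, 'v::complex_vector) vbundle \<Rightarrow> int \<Rightarrow> ('n, ('v, complex ^ 'n \<Rightarrow> complex) tensor) vbundle"
  where "twist E k = tensor_bundle E (O_bundle k)"


section \<open>The cotangent bundle of projective space\<close>

text \<open>
  The tangent space at \<open>p\<close> is the space of derivations of the local ring at \<open>p\<close>; a germ is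
  represented by any function on projective space that is regular near \<open>p\<close>, and derivations
  are set to zero on the remaining functions.  The cotangent space is its dual (its elements being
  set to zero outside the tangent space), and the regular 1-forms are the local sums of \<open>g df\<close>.
\<close>

definition tangent_space :: "('n::finite) proj \<Rightarrow> (('n proj \<Rightarrow> complex) \<Rightarrow> complex) set" where
  "tangent_space p =
     {D. (\<forall>f. \<not> regular_at p f \<longrightarrow> D f = 0) \<and>
         (\<forall>U f g. zariski_open U \<longrightarrow> p \<in> U \<longrightarrow> regular_at p f \<longrightarrow> regular_at p g \<longrightarrow>
            (\<forall>q\<in>U. f q = g q) \<longrightarrow> D f = D g) \<and>
         (\<forall>f g. regular_at p f \<longrightarrow> regular_at p g \<longrightarrow> D (\<lambda>q. f q + g q) = D f + D g) \<and>
         (\<forall>c f. regular_at p f \<longrightarrow> D (\<lambda>q. c * f q) = c * D f) \<and>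
         (\<forall>f g. regular_at p f \<longrightarrow> regular_at p g \<longrightarrow>
            D (\<lambda>q. f q * g q) = f p * D g + g p * D f)}"

definition cotangent_space ::
    "('n::finite) proj \<Rightarrow> ((('n proj \<Rightarrow> complex) \<Rightarrow> complex) \<Rightarrow> complex) set" where
  "cotangent_space p =
     {\<omega>. (\<forall>D. D \<notin> tangent_space p \<longrightarrow> \<omega> D = 0) \<and>
         (\<forall>D\<in>tangent_space p. \<forall>D'\<in>tangent_space p. \<omega> (D + D') = \<omega> D + \<omega> D') \<and>
         (\<forall>c. \<forall>D\<in>tangent_space p. \<omega> (c *\<^sub>C D) = c * \<omega> D)}"

definition differential ::
    "('n::finite proj \<Rightarrow> complex) \<Rightarrow> 'n proj \<Rightarrow> (('n proj \<Rightarrow> complex) \<Rightarrow> complex) \<Rightarrow> complex" where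
  "differential f p = (\<lambda>D. if D \<in> tangent_space p then D f else 0)"

definition cotangent_bundle ::
    "('n::finite, (('n proj \<Rightarrow> complex) \<Rightarrow> complex) \<Rightarrow> complex) vbundle" where
  "cotangent_bundle =
     \<lparr>fibre = cotangent_space,
      sections = (\<lambda>U. {s. \<forall>p\<in>U. \<exists>V (r::nat) g f. zariski_open V \<and> p \<in> V \<and> V \<subseteq> U \<and>
        (\<forall>i<r. regular_on V (g i) \<and> regular_on V (f i)) \<and>
        (\<forall>q\<in>V. s q = (\<Sum>i<r. g i q *\<^sub>C differential (f i) q))})\<rparr>"


section \<open>The map \<open>\<delta>\<close>\<close>

definition delta ::
    "(('n::finite) mpoly, complex ^ 'n \<Rightarrow> complex) tensor \<Rightarrow> ('n mpoly, complex ^ 'n \<Rightarrow> complex) tensor"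
  where "delta t = (\<Sum>i\<in>UNIV. tensor_map (partial_deriv i) (\<lambda>s x. x $ i * s x) t)"

lemma partial_deriv_linear:
  "Vector_Spaces.linear scaleC scaleC (partial_deriv i :: ('n::finite) mpoly \<Rightarrow> _)"
proof -
  have *: "partial_deriv i =
      free_extension (\<lambda>a. Poly_Mapping.single (a - Poly_Mapping.single i 1)
        (of_nat (Poly_Mapping.lookup a i) :: complex))"
  proof
    fix F :: "'n mpoly"
    show "partial_deriv i F = free_extension (\<lambda>a. Poly_Mapping.single (a - Poly_Mapping.single i 1)
        (of_nat (Poly_Mapping.lookup a i) :: complex)) F"
      unfolding partial_deriv_def free_extension_def
      by (rule sum.cong[OF refl], rule poly_mapping_eqI)
        (simp add: lookup_single when_def scaleC_complex_def)
  qed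
  show ?thesis
    unfolding * by unfold_locales (simp_all add: free_extension_add free_extension_scaleC)
qed

lemma delta_pure:
  "delta (F \<otimes>\<^sub>C s) = (\<Sum>i\<in>UNIV. partial_deriv i F \<otimes>\<^sub>C (\<lambda>x. x $ i * s x))"
proof -
  have "Vector_Spaces.linear scaleC scaleC (\<lambda>(s :: complex ^ 'a \<Rightarrow> complex) x. x $ i * s x)" for i
    by unfold_locales (auto simp: fun_eq_iff scaleC_fun_def scaleC_complex_def algebra_simps)
  then show ?thesis by (simp add: delta_def tensor_map_pure partial_deriv_linear)
qed

end

theory Submission
  imports Defs
begin

text \<open>
  Exactness is tested on fibres, and on the fibre at a point \<open>p\<close> the sequence is a statement about
  polynomials.  Choose \<open>i\<close> with \<open>X\<^sub>i \<noteq> 0\<close> at \<open>p\<close> and let \<open>u\<close> be the vector on the line \<open>p\<close> with \<open>u\<^sub>i = 1\<close>.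
  Since \<open>X\<^sub>k = u\<^sub>k X\<^sub>i\<close> on that line, \<open>\<delta>\<close> sends \<open>F \<otimes> X\<^sub>i\<^sup>n\<close> to \<open>\<partial>\<^sub>u F \<otimes> X\<^sub>i\<^bsup>n+1\<^esup>\<close>, where \<open>\<partial>\<^sub>u = \<Sum>\<^sub>k u\<^sub>k \<partial>/\<partial>Y\<^sub>k\<close> is the
  derivative in the direction \<open>u\<close> (\<open>delta_frame\<close>).  The linear change of variables
  \<open>Y\<^sub>j \<mapsto> Z\<^sub>j = Y\<^sub>j - u\<^sub>j Y\<^sub>i\<close> for \<open>j \<noteq> i\<close> turns \<open>\<partial>/\<partial>Y\<^sub>i\<close> into \<open>\<partial>\<^sub>u\<close> (\<open>dir_deriv_shear\<close>).  Therefore \<open>\<partial>\<^sub>u\<close> is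
  surjective from forms of degree \<open>m\<close> to forms of degree \<open>m - 1\<close>, and its kernel has the monomials of
  degree \<open>m\<close> in the \<open>Z\<^sub>j\<close> as a basis (\<open>dir_deriv_surj\<close>, \<open>dir_deriv_kernel\<close>,
  \<open>shear_prod_independent\<close>).

  The linear forms vanishing at \<open>u\<close> are the cotangent space, by the Euler sequence: a covector \<open>\<omega>\<close> is sent
  to \<open>\<Sum>\<^sub>k \<omega>(\<partial>/\<partial>X\<^sub>k) Y\<^sub>k\<close>, where \<open>\<partial>/\<partial>X\<^sub>k\<close> differentiates the pull-back of a function to affine space at a
  vector \<open>x\<close> of the line.  The quotient rule shows that \<open>d(X\<^sub>j/X\<^sub>i)\<close> is sent to \<open>Z\<^sub>j/x\<^sub>i\<close>
  (\<open>cotangent_form_differential\<close>).  Multiplying \<open>m\<close> such forms gives the inclusion; the factor \<open>x\<^sub>i\<^sup>-\<^sup>m\<close>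
  accounts for the shift of the twist from \<open>m + n\<close> to \<open>n\<close>.  In the frame of monomials in the
  differentials \<open>d(X\<^sub>j/X\<^sub>i)\<close>, tensored with \<open>X\<^sub>i\<^bsup>m+n\<^esup>\<close>, the inclusion takes the simple form of
  \<open>sym_inclusion_frame\<close>: each monomial goes to the corresponding monomial in the \<open>Z\<^sub>j\<close>, tensored with \<open>X\<^sub>i\<^sup>n\<close>.

  What remains is to exhibit these frames over the charts \<open>X\<^sub>i \<noteq> 0\<close>.  The differentials of the affine
  coordinates are a frame of the cotangent bundle because a derivation of the local ring is determined
  by its values on the affine coordinates (\<open>tangent_zeroI\<close>), and because the partial derivatives of a
  regular function are regular (\<open>coord_deriv_regular\<close>).  Frames pass to symmetric powers (\<open>sym_frame\<close>)
  and to tensor products with line bundles (\<open>tensor_line_frame\<close>).  The three bundles are therefore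
  locally free, and a fibrewise linear map between them is a homomorphism of bundles once it takes the
  elements of frames to sections (\<open>bundle_homI\<close>).
\<close>

section \<open>Linear maps\<close>

abbreviation clinear :: "('a::complex_vector \<Rightarrow> 'b::complex_vector) \<Rightarrow> bool" where
  "clinear \<equiv> Vector_Spaces.linear scaleC scaleC"

lemma clinearI:
  assumes "\<And>x y. f (x + y) = f x + f y" "\<And>c x. f (c *\<^sub>C x) = c *\<^sub>C f x"
  shows "clinear f"
  by unfold_locales (use assms in auto)

lemma
  assumes "clinear f"
  shows clinear_add: "f (x + y) = f x + f y"
    and clinear_scaleC: "f (c *\<^sub>C x) = c *\<^sub>C f x"
    and clinear_zero: "f 0 = 0"
    and clinear_diff: "f (x - y) = f x - f y"
    and clinear_sum: "f (\<Sum>i\<in>I. h i) = (\<Sum>i\<in>I. f (h i))"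
proof -
  interpret Vector_Spaces.linear scaleC scaleC f by fact
  show "f (x + y) = f x + f y" "f (c *\<^sub>C x) = c *\<^sub>C f x" "f 0 = 0" "f (x - y) = f x - f y"
    "f (\<Sum>i\<in>I. h i) = (\<Sum>i\<in>I. f (h i))"
    by (rule add scale zero diff sum)+
qed

lemma clinear_comb:
  assumes "clinear f"
  shows "f (\<Sum>i\<in>I. c i *\<^sub>C e i) = (\<Sum>i\<in>I. c i *\<^sub>C f (e i))"
  by (simp add: clinear_sum[OF assms] clinear_scaleC[OF assms])

lemma clinear_compose: "clinear f \<Longrightarrow> clinear g \<Longrightarrow> clinear (\<lambda>x. g (f x))"
  by (rule clinearI) (simp_all add: clinear_add clinear_scaleC)

lemma clinear_sum_fun: "(\<And>i. i \<in> I \<Longrightarrow> clinear (f i)) \<Longrightarrow> clinear (\<lambda>x. \<Sum>i\<in>I. f i x)"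
  by (rule clinearI)
    (simp_all add: clinear_add clinear_scaleC sum.distrib complex_vector.scale_sum_right)

lemma clinear_scale_fun: "clinear f \<Longrightarrow> clinear (\<lambda>x. c *\<^sub>C f x)"
  by (rule clinearI)
    (simp_all add: clinear_add clinear_scaleC scaleC_add_right scaleC_scaleC mult.commute)

lemma clinear_ident: "clinear (\<lambda>x. x)"
  by (rule clinearI) simp_all

lemma clinear_free_extension: "clinear (free_extension \<phi>)"
  by (rule clinearI) (simp_all add: free_extension_add free_extension_scaleC)

lemma scaleC_complex_eq [simp]: "c *\<^sub>C (x::complex) = c * x"
  by (simp add: scaleC_complex_def)

lemma scaleC_fun_apply [simp]: "(c *\<^sub>C f) x = c *\<^sub>C f x"
  by (simp add: scaleC_fun_def)

lemma sum_fun_apply: "(\<Sum>i\<in>I. f i) x = (\<Sum>i\<in>I. f i x)" for f :: "'i \<Rightarrow> 'a \<Rightarrow> 'b::comm_monoid_add"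
  by (induction I rule: infinite_finite_induct) simp_all

section \<open>Polynomials\<close>

subsection \<open>Polynomials as an algebra\<close>

lemma scaleC_single: "c *\<^sub>C Poly_Mapping.single k (d::complex) = Poly_Mapping.single k (c * d)"
  by (rule poly_mapping_eqI) (simp add: lookup_single when_def)

lemma poly_eq_sum_single:
  fixes F :: "'k \<Rightarrow>\<^sub>0 complex"
  shows "F = (\<Sum>a\<in>Poly_Mapping.keys F. Poly_Mapping.lookup F a *\<^sub>C Poly_Mapping.single a 1)"
  by (rule poly_mapping_eqI)
    (simp add: lookup_sum lookup_single when_def scaleC_single sum.delta' in_keys_iff)

lemma linear_eq_on_single:
  fixes f g :: "('k \<Rightarrow>\<^sub>0 complex) \<Rightarrow> 'w::complex_vector"
  assumes "clinear f" "clinear g" "\<And>a. f (Poly_Mapping.single a 1) = g (Poly_Mapping.single a 1)"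
  shows "f F = g F"
  using arg_cong[OF poly_eq_sum_single[of F], of f] arg_cong[OF poly_eq_sum_single[of F], of g]
  by (simp only: clinear_comb[OF assms(1)] clinear_comb[OF assms(2)] assms(3))

lemma scaleC_eq_mult: "c *\<^sub>C F = Poly_Mapping.single 0 c * F" for F :: "'n mpoly"
proof (rule linear_eq_on_single[where f = "\<lambda>F. c *\<^sub>C F" and g = "\<lambda>F. Poly_Mapping.single 0 c * F"])
  show "clinear (\<lambda>F::'n mpoly. c *\<^sub>C F)"
    by (rule clinear_scale_fun[OF clinear_ident])
  show "clinear (\<lambda>F::'n mpoly. Poly_Mapping.single 0 c * F)"
  proof (rule clinearI)
    fix d and F :: "'n mpoly"
    show "Poly_Mapping.single 0 c * d *\<^sub>C F = d *\<^sub>C (Poly_Mapping.single 0 c * F)"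
      by (rule poly_mapping_eqI)
        (simp add: mult_map_scale_conv_mult[symmetric] map.rep_eq when_def)
  qed (simp add: algebra_simps)
qed (simp add: scaleC_single mult_single)

lemma scaleC_mult_left: "(c *\<^sub>C F) * G = c *\<^sub>C (F * G)" for F G :: "'n mpoly"
  by (simp add: scaleC_eq_mult mult.assoc)

lemma scaleC_mult_right: "F * (c *\<^sub>C G) = c *\<^sub>C (F * G)" for F G :: "'n mpoly"
  by (simp add: scaleC_eq_mult mult.left_commute)

lemma clinear_mult: "clinear (\<lambda>F. F * G)" for G :: "'n mpoly"
  by (rule clinearI) (rule distrib_right scaleC_mult_left)+

text \<open>
  Evaluation and substitution extend a map on monomials linearly.  If the map on monomials is
  multiplicative, so is the extension, because both sides are bilinear and agree on pairs of monomials.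
\<close>

lemma free_extension_mult:
  fixes \<phi> :: "('n \<Rightarrow>\<^sub>0 nat) \<Rightarrow> 'w::{complex_vector,comm_ring_1}"
  assumes \<phi>: "\<And>a b. \<phi> (a + b) = \<phi> a * \<phi> b"
    and assoc: "\<And>c (x::'w) y. (c *\<^sub>C x) * y = c *\<^sub>C (x * y)"
  shows "free_extension \<phi> (F * G) = free_extension \<phi> F * free_extension \<phi> G"
proof -
  have lin_left: "clinear (\<lambda>x. x * y)" for y :: 'w
    by (rule clinearI) (rule distrib_right assoc)+
  have lin_right: "clinear (\<lambda>x. y * x)" for y :: 'w
    using lin_left[of y] by (subst mult.commute)
  show ?thesis
  proof (rule linear_eq_on_single[where F = F])
    fix a
    show "free_extension \<phi> (Poly_Mapping.single a 1 * G) =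
        free_extension \<phi> (Poly_Mapping.single a 1) * free_extension \<phi> G"
    proof (rule linear_eq_on_single[where F = G])
      show "clinear (\<lambda>G. free_extension \<phi> (Poly_Mapping.single a 1 * G))"
        by (subst mult.commute) (rule clinear_compose[OF clinear_mult clinear_free_extension])
      show "clinear (\<lambda>G. free_extension \<phi> (Poly_Mapping.single a 1) * free_extension \<phi> G)"
        by (rule clinear_compose[OF clinear_free_extension lin_right])
    qed (simp add: mult_single \<phi> scaleC_one)
  qed (intro clinear_compose[OF clinear_mult clinear_free_extension]
      clinear_compose[OF clinear_free_extension lin_left])+
qed

abbreviation Var :: "'n \<Rightarrow> 'n mpoly" where
  "Var i \<equiv> Poly_Mapping.single (Poly_Mapping.single i 1) 1"

text \<open>
  Exponent vectors are encoded by multisets of variables.  A monomial of degree \<open>d\<close> is then the same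
  datum as a \<open>d\<close>-fold product in a symmetric power, so that one index set, \<^const>\<open>multisets_of_size\<close>,
  serves both for forms of degree \<open>d\<close> and for the frames of symmetric powers.
\<close>

definition expo :: "'n multiset \<Rightarrow> 'n \<Rightarrow>\<^sub>0 nat" where
  "expo K = (\<Sum>i\<in>#K. Poly_Mapping.single i 1)"

lemma lookup_expo [simp]: "Poly_Mapping.lookup (expo K) i = count K i"
  by (induction K) (auto simp: expo_def lookup_add lookup_single when_def)

lemma expo_surj: "\<exists>K. a = expo K"
proof -
  have "finite {i. 0 < Poly_Mapping.lookup a i}" by simp
  then have "count (Abs_multiset (Poly_Mapping.lookup a)) = Poly_Mapping.lookup a"
    by (rule count_Abs_multiset)
  then have "a = expo (Abs_multiset (Poly_Mapping.lookup a))"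
    by (intro poly_mapping_eqI) simp
  then show ?thesis ..
qed

lemma expo_inject [simp]: "expo K = expo L \<longleftrightarrow> K = L"
  by (auto simp: poly_mapping_eq_iff fun_eq_iff multiset_eq_iff)

abbreviation mon :: "'n multiset \<Rightarrow> 'n mpoly" where
  "mon K \<equiv> Poly_Mapping.single (expo K) 1"

lemma mon_empty [simp]: "mon {#} = 1"
  by (simp add: expo_def)

lemma mon_add_mset: "mon (add_mset i K) = Var i * mon K"
  by (simp add: expo_def mult_single)

lemma mon_eq_prod: "mon K = (\<Prod>i\<in>#K. Var i)"
proof (induction K)
  case (add i K)
  then show ?case by (subst mon_add_mset) simp
qed simp

text \<open>
  Ring homomorphisms and derivations of a polynomial ring are determined by the variables; this
  principle reduces identities between them to the variables.
\<close>

lemma mpoly_induct [case_names const var add mult]: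
  fixes F :: "'n mpoly"
  assumes const: "\<And>c. P (Poly_Mapping.single 0 c)" and var: "\<And>i. P (Var i)"
    and add: "\<And>F G. P F \<Longrightarrow> P G \<Longrightarrow> P (F + G)" and mult: "\<And>F G. P F \<Longrightarrow> P G \<Longrightarrow> P (F * G)"
  shows "P F"
proof -
  have mon: "P (mon K)" for K
  proof (induction K)
    case empty
    then show ?case using const[of 1] by simp
  next
    case (add i K)
    then show ?case by (subst mon_add_mset) (rule mult[OF var])
  qed
  have "P (\<Sum>a\<in>A. Poly_Mapping.lookup F a *\<^sub>C Poly_Mapping.single a 1)" if "finite A" for A
    using that
  proof induction
    case empty
    then show ?case using const[of 0] by simp
  next
    case (insert a A)
    have "P (Poly_Mapping.lookup F a *\<^sub>C Poly_Mapping.single a 1)"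
      unfolding scaleC_eq_mult using expo_surj[of a] by (auto intro!: mult const mon)
    with insert show ?case by (simp add: add)
  qed
  then show ?thesis using poly_eq_sum_single[of F] by (metis finite_keys)
qed

subsection \<open>Homogeneous polynomials\<close>

lemma sum_lookup_expo: "(\<Sum>i\<in>UNIV. Poly_Mapping.lookup (expo K) i) = size K"
  for K :: "'n::finite multiset"
proof -
  have "(\<Sum>i\<in>set_mset K. count K i) = (\<Sum>i\<in>UNIV. count K i)"
    by (rule sum.mono_neutral_left) (auto simp: count_eq_zero_iff)
  then show ?thesis by (simp add: size_multiset_overloaded_eq)
qed

lemma mon_homogeneous: "mon K \<in> homogeneous d \<longleftrightarrow> size K = d" for K :: "'n::finite multiset"
  by (simp add: homogeneous_def sum_lookup_expo del: lookup_expo)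

lemma homogeneous_subspace: "complex_vector.subspace (homogeneous d :: 'n::finite mpoly set)"
proof (rule complex_vector.subspaceI)
  show "0 \<in> homogeneous d" by (simp add: homogeneous_def)
next
  fix F G :: "'n mpoly"
  assume "F \<in> homogeneous d" "G \<in> homogeneous d"
  then show "F + G \<in> homogeneous d"
    using Poly_Mapping.keys_add[of F G] by (auto simp: homogeneous_def)
next
  fix c and F :: "'n mpoly"
  assume "F \<in> homogeneous d"
  then show "c *\<^sub>C F \<in> homogeneous d"
    by (auto simp: homogeneous_def in_keys_iff)
qed

lemma homogeneous_mult:
  "F \<in> homogeneous d \<Longrightarrow> G \<in> homogeneous e \<Longrightarrow> F * G \<in> homogeneous (d + e)"
  using Poly_Mapping.keys_mult[of F G] by (fastforce simp: homogeneous_def lookup_add sum.distrib)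

lemma one_homogeneous [simp]: "1 \<in> homogeneous 0"
  using mon_homogeneous[of "{#}" 0] by simp

lemma Var_homogeneous [simp]: "Var i \<in> homogeneous 1"
  using mon_homogeneous[of "{#i#}" 1] by (simp add: expo_def)

lemma homogeneous_power: "F \<in> homogeneous d \<Longrightarrow> F ^ k \<in> homogeneous (k * d)"
  by (induction k) (auto intro: homogeneous_mult)

lemma homogeneous_prod_mset:
  "(\<And>i. i \<in># K \<Longrightarrow> f i \<in> homogeneous 1) \<Longrightarrow> (\<Prod>i\<in>#K. f i) \<in> homogeneous (size K)"
proof (induction K)
  case (add i K)
  have "f i * (\<Prod>i\<in>#K. f i) \<in> homogeneous (1 + size K)"
    using add by (intro homogeneous_mult) auto
  then show ?case by simp
qed simp

lemma homogeneous_expand: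
  fixes F :: "'n::finite mpoly"
  assumes "F \<in> homogeneous d"
  shows "F = (\<Sum>K\<in>multisets_of_size UNIV d. Poly_Mapping.lookup F (expo K) *\<^sub>C mon K)"
proof (rule poly_mapping_eqI)
  fix a :: "'n \<Rightarrow>\<^sub>0 nat"
  obtain K where a: "a = expo K" using expo_surj by blast
  have "Poly_Mapping.lookup (\<Sum>K\<in>multisets_of_size UNIV d. Poly_Mapping.lookup F (expo K) *\<^sub>C mon K) a
      = (\<Sum>L\<in>multisets_of_size UNIV d. if L = K then Poly_Mapping.lookup F (expo L) else 0)"
    by (simp add: lookup_sum lookup_single when_def a scaleC_single if_distrib eq_commute cong: if_cong)
  also have "\<dots> = (if size K = d then Poly_Mapping.lookup F a else 0)"
    by (subst sum.delta[OF finite_multisets_of_size])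
      (auto simp: a multisets_of_size_def)
  also have "\<dots> = Poly_Mapping.lookup F a"
  proof -
    have "size K = d" if "Poly_Mapping.lookup F (expo K) \<noteq> 0"
      using assms that sum_lookup_expo[of K] in_keys_iff[of "expo K" F]
      unfolding homogeneous_def mem_Collect_eq by metis
    then show ?thesis by (auto simp: a)
  qed
  finally show "Poly_Mapping.lookup F a = Poly_Mapping.lookup
      (\<Sum>K\<in>multisets_of_size UNIV d. Poly_Mapping.lookup F (expo K) *\<^sub>C mon K) a" by simp
qed

lemma lookup_mon_comb:
  assumes "finite I" "K \<in> I"
  shows "Poly_Mapping.lookup (\<Sum>L\<in>I. c L *\<^sub>C mon L) (expo K) = c K"
proof -
  have "Poly_Mapping.lookup (\<Sum>L\<in>I. c L *\<^sub>C mon L) (expo K) = (\<Sum>L\<in>I. if L = K then c L else 0)"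
    by (simp add: lookup_sum lookup_single when_def scaleC_single if_distrib eq_commute cong: if_cong)
  with assms show ?thesis by simp
qed

lemma mon_independent:
  assumes "finite I" "(\<Sum>K\<in>I. c K *\<^sub>C mon K) = 0" "K \<in> I"
  shows "c K = 0"
  using lookup_mon_comb[OF assms(1,3), of c] assms(2) by simp

subsection \<open>Evaluation\<close>

text \<open>
  Evaluation of a monomial at elements of any commutative ring: complex numbers for the value of a
  polynomial at a point, polynomials for the substitution of new variables.
\<close>

definition expo_eval :: "('n::finite \<Rightarrow> 'w::comm_semiring_1) \<Rightarrow> ('n \<Rightarrow>\<^sub>0 nat) \<Rightarrow> 'w" where
  "expo_eval \<phi> a = (\<Prod>i\<in>UNIV. \<phi> i ^ Poly_Mapping.lookup a i)"

lemma expo_eval_add: "expo_eval \<phi> (a + b) = expo_eval \<phi> a * expo_eval \<phi> b"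
  by (simp add: expo_eval_def lookup_add power_add prod.distrib)

lemma expo_eval_zero [simp]: "expo_eval \<phi> 0 = 1"
  by (simp add: expo_eval_def)

lemma expo_eval_single [simp]: "expo_eval \<phi> (Poly_Mapping.single i 1) = \<phi> i"
proof -
  have "expo_eval \<phi> (Poly_Mapping.single i 1) = (\<Prod>j\<in>UNIV. if j = i then \<phi> j else 1)"
    unfolding expo_eval_def by (rule prod.cong) (auto simp: lookup_single when_def)
  then show ?thesis by simp
qed

lemma expo_eval_expo: "expo_eval \<phi> (expo K) = (\<Prod>i\<in>#K. \<phi> i)"
proof (induction K)
  case (add i K)
  have "expo (add_mset i K) = Poly_Mapping.single i 1 + expo K" by (simp add: expo_def)
  then show ?case by (simp only: expo_eval_add expo_eval_single add) simp
qed (simp add: expo_def)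

definition subst :: "('n::finite \<Rightarrow> 'k mpoly) \<Rightarrow> 'n mpoly \<Rightarrow> 'k mpoly" where
  "subst \<phi> = free_extension (expo_eval \<phi>)"

lemma clinear_subst: "clinear (subst \<phi>)"
  unfolding subst_def by (rule clinear_free_extension)

lemma subst_mult: "subst \<phi> (F * G) = subst \<phi> F * subst \<phi> G"
  unfolding subst_def by (rule free_extension_mult) (simp_all add: expo_eval_add scaleC_mult_left)

lemma subst_mon: "subst \<phi> (mon K) = (\<Prod>i\<in>#K. \<phi> i)"
  by (simp add: subst_def expo_eval_expo scaleC_one)

lemma subst_Var: "subst \<phi> (Var i) = \<phi> i"
  by (simp add: subst_def scaleC_one del: One_nat_def)

lemma subst_const: "subst \<phi> (Poly_Mapping.single 0 c) = Poly_Mapping.single 0 c"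
  by (simp add: subst_def scaleC_eq_mult)

lemma subst_inverse:
  assumes "\<And>i. subst \<psi> (\<phi> i) = Var i"
  shows "subst \<psi> (subst \<phi> F) = F"
  by (induction F rule: mpoly_induct)
    (simp_all add: subst_const subst_Var assms subst_mult clinear_add[OF clinear_subst] del: One_nat_def)

lemma subst_homogeneous:
  assumes "\<And>i. \<phi> i \<in> homogeneous 1" "F \<in> homogeneous d"
  shows "subst \<phi> F \<in> homogeneous d"
proof -
  have "subst \<phi> F = (\<Sum>K\<in>multisets_of_size UNIV d. Poly_Mapping.lookup F (expo K) *\<^sub>C (\<Prod>i\<in>#K. \<phi> i))"
    by (subst homogeneous_expand[OF assms(2)]) (simp only: clinear_comb[OF clinear_subst] subst_mon)
  moreover have "(\<Prod>i\<in>#K. \<phi> i) \<in> homogeneous d" if "K \<in> multisets_of_size UNIV d" for K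
    using homogeneous_prod_mset[of K \<phi>] assms(1) that by (auto simp: multisets_of_size_def)
  ultimately show ?thesis
    by (auto intro!: complex_vector.subspace_sum complex_vector.subspace_scale homogeneous_subspace)
qed

lemma peval_eq: "peval F x = free_extension (expo_eval (($) x)) F"
  by (simp add: peval_def free_extension_def expo_eval_def)

lemma clinear_peval: "clinear (\<lambda>F. peval F x)"
  unfolding peval_eq by (rule clinear_free_extension)

lemma peval_add: "peval (F + G) x = peval F x + peval G x"
  by (rule clinear_add[OF clinear_peval])

lemma peval_diff: "peval (F - G) x = peval F x - peval G x"
  by (rule clinear_diff[OF clinear_peval])

lemma peval_scaleC: "peval (c *\<^sub>C F) x = c * peval F x"
  by (simp add: clinear_scaleC[OF clinear_peval])

lemma peval_mult: "peval (F * G) x = peval F x * peval G x"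
  unfolding peval_eq by (rule free_extension_mult) (simp_all add: expo_eval_add)

lemma peval_const [simp]: "peval (Poly_Mapping.single 0 c) x = c"
  by (simp add: peval_eq)

lemma peval_one [simp]: "peval 1 x = 1"
  using peval_const[of 1 x] by simp

lemma peval_zero [simp]: "peval 0 x = 0"
  by (simp add: peval_def)

lemma peval_Var [simp]: "peval (Var i) x = x $ i"
  by (simp add: peval_eq del: One_nat_def)

lemma peval_power: "peval (F ^ k) x = peval F x ^ k"
  by (induction k) (simp_all add: peval_mult)

lemma peval_homogeneous:
  assumes "F \<in> homogeneous d"
  shows "peval F (c *s x) = c ^ d * peval F x"
proof -
  have "peval F (c *s x) = (\<Sum>a\<in>Poly_Mapping.keys F.
      c ^ (\<Sum>i\<in>UNIV. Poly_Mapping.lookup a i) * (Poly_Mapping.lookup F a * (\<Prod>i\<in>UNIV. (x $ i) ^ Poly_Mapping.lookup a i)))"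
    by (simp add: peval_def power_mult_distrib prod.distrib power_sum mult.left_commute)
  also have "\<dots> = c ^ d * peval F x"
    using assms by (simp add: homogeneous_def peval_def sum_distrib_left)
  finally show ?thesis .
qed

subsection \<open>Partial derivatives\<close>

lemma pderiv_add: "partial_deriv i (F + G) = partial_deriv i F + partial_deriv i G"
  by (rule clinear_add[OF partial_deriv_linear])

lemma pderiv_single:
  "partial_deriv i (Poly_Mapping.single a c) =
     Poly_Mapping.single (a - Poly_Mapping.single i 1) (of_nat (Poly_Mapping.lookup a i) * c)"
  by (cases "c = 0") (simp_all add: partial_deriv_def)

lemma pderiv_mult: "partial_deriv i (F * G) = partial_deriv i F * G + F * partial_deriv i G"
  for F G :: "'n::finite mpoly"
proof -
  have single: "partial_deriv i (Poly_Mapping.single a 1 * Poly_Mapping.single b 1 :: 'n mpoly) =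
      partial_deriv i (Poly_Mapping.single a 1) * Poly_Mapping.single b 1
      + Poly_Mapping.single a 1 * partial_deriv i (Poly_Mapping.single b 1)" for a b
  proof -
    let ?e = "Poly_Mapping.single i (1::nat)"
    have 1: "a - ?e + b = a + b - ?e" if "Poly_Mapping.lookup a i \<noteq> 0" for a b
      using that by (intro poly_mapping_eqI) (auto simp: lookup_add lookup_minus lookup_single when_def)
    show ?thesis
    proof (cases "Poly_Mapping.lookup a i = 0")
      case a: True
      show ?thesis
      proof (cases "Poly_Mapping.lookup b i = 0")
        case True
        with a show ?thesis by (simp add: pderiv_single mult_single lookup_add)
      next
        case False
        with a show ?thesis
          using 1[of b a] by (simp add: pderiv_single mult_single lookup_add add.commute)
      qed
    next
      case a: False
      show ?thesis
      proof (cases "Poly_Mapping.lookup b i = 0")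
        case True
        with a show ?thesis using 1[of a b] by (simp add: pderiv_single mult_single lookup_add)
      next
        case False
        with a show ?thesis
          using 1[of b a] 1[of a b]
          by (simp add: pderiv_single mult_single lookup_add add.commute single_add[symmetric] del: One_nat_def)
      qed
    qed
  qed
  note lin = partial_deriv_linear[of i] clinear_mult
  have lin': "clinear (\<lambda>G. F * G)" for F :: "'n mpoly"
    using clinear_mult[of F] by (simp add: mult.commute)
  have lin_sum: "clinear (\<lambda>x. f x + g x)" if "clinear f" "clinear g" for f g :: "'n mpoly \<Rightarrow> 'n mpoly"
    using that by (intro clinearI) (simp_all add: clinear_add clinear_scaleC scaleC_add_right)
  show ?thesis
  proof (rule linear_eq_on_single[where F = F])
    fix a
    show "partial_deriv i (Poly_Mapping.single a 1 * G) =
        partial_deriv i (Poly_Mapping.single a 1) * G + Poly_Mapping.single a 1 * partial_deriv i G"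
    proof (rule linear_eq_on_single[where F = G])
    qed (rule single
        | intro clinear_compose[OF lin' partial_deriv_linear] lin_sum lin'
          clinear_compose[OF partial_deriv_linear lin'])+
  qed (intro clinear_compose[OF clinear_mult partial_deriv_linear] lin_sum clinear_mult
        clinear_compose[OF partial_deriv_linear clinear_mult])+
qed

lemma pderiv_const [simp]: "partial_deriv i (Poly_Mapping.single 0 c) = 0"
  by (simp add: pderiv_single)

lemma pderiv_Var: "partial_deriv i (Var j) = (if i = j then 1 else 0)"
  by (simp add: pderiv_single lookup_single when_def)

lemma pderiv_homogeneous:
  assumes "F \<in> homogeneous (Suc d)"
  shows "partial_deriv i F \<in> homogeneous d"
proof -
  have mon: "partial_deriv i (mon K) \<in> homogeneous d" if "size K = Suc d" for K
  proof (cases "i \<in># K")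
    case True
    then obtain L where K: "K = add_mset i L" by (meson mset_add)
    have "expo K - Poly_Mapping.single i 1 = expo L"
      by (simp add: K expo_def)
    then have "partial_deriv i (mon K) = of_nat (count K i) *\<^sub>C mon L"
      by (simp add: pderiv_single scaleC_single del: One_nat_def)
    with that K show ?thesis
      by (simp add: complex_vector.subspace_scale homogeneous_subspace mon_homogeneous)
  next
    case False
    then show ?thesis
      by (simp add: pderiv_single complex_vector.subspace_0 homogeneous_subspace not_in_iff)
  qed
  have "partial_deriv i F = (\<Sum>K\<in>multisets_of_size UNIV (Suc d).
      Poly_Mapping.lookup F (expo K) *\<^sub>C partial_deriv i (mon K))"
    by (subst homogeneous_expand[OF assms]) (simp only: clinear_comb[OF partial_deriv_linear])
  with mon show ?thesis
    by (auto intro!: complex_vector.subspace_sum complex_vector.subspace_scale homogeneous_subspace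
        simp: multisets_of_size_def)
qed

lemma pderiv_homogeneous_0: "F \<in> homogeneous 0 \<Longrightarrow> partial_deriv i F = 0"
  by (subst homogeneous_expand, assumption)
    (simp add: multisets_of_size_0 clinear_scaleC[OF partial_deriv_linear] pderiv_single
      flip: single_one)

text \<open>
  Multiplying by a variable restores the degree.  This avoids the truncated degree \<open>d - 1\<close>, also when
  \<open>d = 0\<close> and the derivative vanishes.
\<close>

lemma Var_pderiv_homogeneous:
  assumes "F \<in> homogeneous d" shows "Var j * partial_deriv i F \<in> homogeneous d"
proof (cases d)
  case 0
  with assms show ?thesis
    by (simp add: pderiv_homogeneous_0 complex_vector.subspace_0 homogeneous_subspace)
next
  case (Suc e)
  then have "Var j * partial_deriv i F \<in> homogeneous (1 + e)"
    using assms by (intro homogeneous_mult pderiv_homogeneous Var_homogeneous) simp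
  with Suc show ?thesis by simp
qed

lemma lookup_pderiv:
  fixes F :: "'n::finite mpoly"
  shows
  "Poly_Mapping.lookup (partial_deriv i F) b =
     of_nat (Suc (Poly_Mapping.lookup b i)) * Poly_Mapping.lookup F (b + Poly_Mapping.single i 1)"
proof (rule linear_eq_on_single[where F = F])
  have lin: "clinear (\<lambda>F::'n mpoly. Poly_Mapping.lookup F b)" for b
    by (rule clinearI) (simp_all add: lookup_add)
  show "clinear (\<lambda>F::'n mpoly. Poly_Mapping.lookup (partial_deriv i F) b)"
    by (rule clinear_compose[OF partial_deriv_linear lin])
  show "clinear (\<lambda>F::'n mpoly. of_nat (Suc (Poly_Mapping.lookup b i)) * Poly_Mapping.lookup F (b + Poly_Mapping.single i 1))"
    using clinear_scale_fun[OF lin, of "of_nat (Suc (Poly_Mapping.lookup b i))" "b + Poly_Mapping.single i 1"]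
    by (simp only: scaleC_complex_eq)
next
  fix a
  have *: "a = b + Poly_Mapping.single i 1 \<longleftrightarrow> a - Poly_Mapping.single i 1 = b"
    if "Poly_Mapping.lookup a i \<noteq> 0"
  proof
    assume "a - Poly_Mapping.single i 1 = b"
    then have "Poly_Mapping.lookup a j - (1 when i = j) = Poly_Mapping.lookup b j" for j
      by (metis lookup_minus lookup_single)
    note this[symmetric]
    with that show "a = b + Poly_Mapping.single i 1"
      by (intro poly_mapping_eqI) (auto simp: lookup_add lookup_single when_def)
  qed simp
  show "Poly_Mapping.lookup (partial_deriv i (Poly_Mapping.single a 1)) b =
      of_nat (Suc (Poly_Mapping.lookup b i)) *
      Poly_Mapping.lookup (Poly_Mapping.single a 1) (b + Poly_Mapping.single i 1)"
  proof (cases "Poly_Mapping.lookup a i = 0")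
    case True
    then have "a \<noteq> b + Poly_Mapping.single i 1" by (metis add_is_0 lookup_add lookup_single_eq one_neq_zero)
    with True show ?thesis by (simp add: pderiv_single lookup_single)
  next
    case False
    show ?thesis
    proof (cases "a = b + Poly_Mapping.single i 1")
      case True
      then show ?thesis by (simp add: pderiv_single lookup_add)
    next
      case neq: False
      with * False show ?thesis by (simp add: pderiv_single lookup_single)
    qed
  qed
qed

text \<open>
  In characteristic zero a monomial can be integrated with respect to a variable.
\<close>

lemma pderiv_surj:
  assumes "G \<in> homogeneous d"
  shows "\<exists>F\<in>homogeneous (Suc d). partial_deriv i F = G"
proof -
  define F where "F = (\<Sum>K\<in>multisets_of_size UNIV d.
      (Poly_Mapping.lookup G (expo K) / of_nat (Suc (count K i))) *\<^sub>C mon (add_mset i K))"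
  have "F \<in> homogeneous (Suc d)"
    unfolding F_def
    by (intro complex_vector.subspace_sum complex_vector.subspace_scale homogeneous_subspace)
      (simp add: mon_homogeneous multisets_of_size_def)
  moreover have "partial_deriv i (mon (add_mset i K)) = of_nat (Suc (count K i)) *\<^sub>C mon K" for K
  proof -
    have "expo (add_mset i K) - Poly_Mapping.single i 1 = expo K" by (simp add: expo_def)
    then show ?thesis by (simp add: pderiv_single scaleC_single del: One_nat_def)
  qed
  then have "partial_deriv i F = (\<Sum>K\<in>multisets_of_size UNIV d. Poly_Mapping.lookup G (expo K) *\<^sub>C mon K)"
    unfolding F_def clinear_comb[OF partial_deriv_linear] by (simp add: scaleC_scaleC del: of_nat_Suc)
  then have "partial_deriv i F = G"
    using homogeneous_expand[OF assms] by simp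
  ultimately show ?thesis by blast
qed

section \<open>The kernel of a directional derivative\<close>

text \<open>
  At a point with coordinate vector \<open>u\<close> the map \<open>\<delta>\<close> is the derivative \<open>\<Sum>\<^sub>k u\<^sub>k \<partial>/\<partial>Y\<^sub>k\<close> in the direction \<open>u\<close>.
\<close>

definition dir_deriv :: "complex ^ 'n \<Rightarrow> 'n::finite mpoly \<Rightarrow> 'n mpoly" where
  "dir_deriv u F = (\<Sum>k\<in>UNIV. u $ k *\<^sub>C partial_deriv k F)"

text \<open>
  The linear change of variables that fixes \<open>Y\<^sub>i\<close> and sends the other \<open>Y\<^sub>j\<close> to \<open>Z\<^sub>j = Y\<^sub>j - u\<^sub>j Y\<^sub>i\<close>.  When \<open>u\<^sub>i = 1\<close>, the
  \<open>Z\<^sub>j\<close> with \<open>j \<noteq> i\<close> are a basis of the linear forms that vanish at \<open>u\<close>.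
\<close>

definition shear :: "'n \<Rightarrow> complex ^ 'n \<Rightarrow> 'n::finite \<Rightarrow> 'n mpoly" where
  "shear i u j = (if j = i then Var i else Var j - u $ j *\<^sub>C Var i)"

lemma clinear_dir_deriv: "clinear (dir_deriv u)"
  unfolding dir_deriv_def
  by (intro clinear_sum_fun clinear_scale_fun partial_deriv_linear)

lemma dir_deriv_mult: "dir_deriv u (F * G) = dir_deriv u F * G + F * dir_deriv u G"
  by (simp add: dir_deriv_def pderiv_mult scaleC_add_right sum.distrib sum_distrib_left
      sum_distrib_right scaleC_mult_left scaleC_mult_right)

lemma dir_deriv_const: "dir_deriv u (Poly_Mapping.single 0 c) = 0"
  by (simp add: dir_deriv_def)

lemma dir_deriv_Var: "dir_deriv u (Var j) = u $ j *\<^sub>C 1"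
proof -
  have "dir_deriv u (Var j) = (\<Sum>k\<in>UNIV. if k = j then u $ k *\<^sub>C 1 else 0)"
    unfolding dir_deriv_def by (intro sum.cong) (auto simp: pderiv_Var simp del: One_nat_def)
  then show ?thesis by simp
qed

lemma dir_deriv_homogeneous: "F \<in> homogeneous (Suc d) \<Longrightarrow> dir_deriv u F \<in> homogeneous d"
  unfolding dir_deriv_def
  by (intro complex_vector.subspace_sum complex_vector.subspace_scale homogeneous_subspace
      pderiv_homogeneous)

lemma shear_homogeneous: "shear i u j \<in> homogeneous 1"
  unfolding shear_def
  by (auto intro!: complex_vector.subspace_diff complex_vector.subspace_scale homogeneous_subspace
      Var_homogeneous simp del: One_nat_def)

lemma subst_shear_inverse: "subst (shear i (- u)) (subst (shear i u) F) = F"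
  by (rule subst_inverse)
    (simp add: shear_def subst_Var clinear_diff[OF clinear_subst] clinear_scaleC[OF clinear_subst]
      del: One_nat_def)

text \<open>
  The shear straightens the direction \<open>u\<close>: it carries \<open>\<partial>/\<partial>Y\<^sub>i\<close> to the derivative along \<open>u\<close>.  Both sides
  are derivations over the shear, so it suffices to compare them on the variables, where
  \<open>\<partial>\<^sub>u Z\<^sub>j = u\<^sub>j - u\<^sub>j u\<^sub>i = 0\<close>.
\<close>

lemma dir_deriv_shear:
  assumes "u $ i = 1"
  shows "dir_deriv u (subst (shear i u) F) = subst (shear i u) (partial_deriv i F)"
proof (induction F rule: mpoly_induct)
  case (const c)
  then show ?case by (simp add: subst_const dir_deriv_const clinear_zero[OF clinear_subst])
next
  case (var j)
  have "subst \<phi> 1 = 1" for \<phi> :: "'a \<Rightarrow> 'a mpoly" using subst_const[of \<phi> 1] by simp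
  then show ?case
    using assms
    by (auto simp: subst_Var shear_def dir_deriv_Var pderiv_Var clinear_zero[OF clinear_subst]
        clinear_diff[OF clinear_dir_deriv] clinear_scaleC[OF clinear_dir_deriv] scaleC_one
        simp del: One_nat_def)
next
  case (add F G)
  then show ?case
    by (simp add: clinear_add[OF clinear_subst] clinear_add[OF clinear_dir_deriv] pderiv_add)
next
  case (mult F G)
  then show ?case
    by (simp add: subst_mult dir_deriv_mult pderiv_mult clinear_add[OF clinear_subst])
qed

lemma dir_deriv_surj:
  assumes "u $ i = 1" "G \<in> homogeneous d"
  shows "\<exists>F\<in>homogeneous (Suc d). dir_deriv u F = G"
proof -
  have "subst (shear i (- u)) G \<in> homogeneous d"
    by (rule subst_homogeneous[OF shear_homogeneous assms(2)])
  then obtain F where F: "F \<in> homogeneous (Suc d)" "partial_deriv i F = subst (shear i (- u)) G"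
    using pderiv_surj by blast
  have "dir_deriv u (subst (shear i u) F) = G"
    using dir_deriv_shear[OF assms(1)] F(2) subst_shear_inverse[of i "- u" G] by simp
  then show ?thesis
    using subst_homogeneous[of "shear i u", OF shear_homogeneous F(1)] by blast
qed

lemma dir_deriv_shear_prod:
  assumes "u $ i = 1" "i \<notin># K"
  shows "dir_deriv u (\<Prod>j\<in>#K. shear i u j) = 0"
proof -
  have "partial_deriv i (mon K) = 0"
    using assms(2) by (simp add: pderiv_single not_in_iff)
  then show ?thesis
    using dir_deriv_shear[OF assms(1), of "mon K"] by (simp add: subst_mon clinear_zero[OF clinear_subst])
qed

lemma shear_prod_independent:
  assumes "finite I" "(\<Sum>K\<in>I. c K *\<^sub>C (\<Prod>j\<in>#K. shear i u j)) = 0" "K \<in> I"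
  shows "c K = 0"
proof -
  have "subst (shear i u) (\<Sum>K\<in>I. c K *\<^sub>C mon K) = 0"
    using assms(2) by (simp add: clinear_comb[OF clinear_subst] subst_mon)
  then have "(\<Sum>K\<in>I. c K *\<^sub>C mon K) = 0"
    using subst_shear_inverse[of i u "\<Sum>K\<in>I. c K *\<^sub>C mon K"] by (simp add: clinear_zero[OF clinear_subst])
  then show ?thesis using mon_independent assms(1,3) by blast
qed

text \<open>
  After the shear the kernel is that of \<open>\<partial>/\<partial>Y\<^sub>i\<close>, which in characteristic zero consists of the
  polynomials that do not involve \<open>Y\<^sub>i\<close>.  Hence the kernel of \<open>\<partial>\<^sub>u\<close> in degree \<open>d\<close> is the \<open>d\<close>th symmetric power
  of the space of linear forms vanishing at \<open>u\<close>.
\<close>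

lemma dir_deriv_kernel:
  assumes u: "u $ i = 1" and F: "F \<in> homogeneous d" "dir_deriv u F = 0"
  shows "\<exists>c. F = (\<Sum>K\<in>multisets_of_size (- {i}) d. c K *\<^sub>C (\<Prod>j\<in>#K. shear i u j))"
proof -
  \<comment> \<open>\<open>F\<close> written in the variables \<open>Z\<^sub>j\<close> and \<open>Y\<^sub>i\<close>\<close>
  define G where "G = subst (shear i (- u)) F"
  have G: "G \<in> homogeneous d" and FG: "F = subst (shear i u) G"
    using subst_homogeneous[OF shear_homogeneous F(1)] subst_shear_inverse[of i "- u" F]
    by (simp_all add: G_def)
  have "subst (shear i u) (partial_deriv i G) = 0"
    using dir_deriv_shear[OF u] F(2) FG by simp
  then have pd: "partial_deriv i G = 0"
    using subst_shear_inverse[of i u "partial_deriv i G"] by (simp add: clinear_zero[OF clinear_subst])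
  have 0: "Poly_Mapping.lookup G (expo K) = 0" if K: "i \<in># K" for K
  proof -
    obtain L where "K = add_mset i L" using multi_member_split[OF K] by blast
    then have "expo K = expo L + Poly_Mapping.single i 1" by (simp add: expo_def add.commute)
    then show ?thesis using lookup_pderiv[of i G "expo L"] pd by (simp del: of_nat_Suc One_nat_def)
  qed
  have "G = (\<Sum>K\<in>multisets_of_size UNIV d. Poly_Mapping.lookup G (expo K) *\<^sub>C mon K)"
    by (rule homogeneous_expand[OF G])
  also have "\<dots> = (\<Sum>K\<in>multisets_of_size (- {i}) d. Poly_Mapping.lookup G (expo K) *\<^sub>C mon K)"
    by (rule sum.mono_neutral_right[OF finite_multisets_of_size])
      (auto simp: multisets_of_size_def 0)
  finally have "subst (shear i u) G = subst (shear i u)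
      (\<Sum>K\<in>multisets_of_size (- {i}) d. Poly_Mapping.lookup G (expo K) *\<^sub>C mon K)" by simp
  then have "F = (\<Sum>K\<in>multisets_of_size (- {i}) d.
      Poly_Mapping.lookup G (expo K) *\<^sub>C (\<Prod>j\<in>#K. shear i u j))"
    using FG by (simp only: clinear_comb[OF clinear_subst] subst_mon)
  then show ?thesis by (rule exI[where x = "\<lambda>K. Poly_Mapping.lookup G (expo K)"])
qed

section \<open>Zariski open sets and regular functions\<close>

lemma hcoords_nonempty: "\<exists>x. x \<in> hcoords p"
proof -
  obtain x where "line p = vec.span {x}" "x \<noteq> 0" using line[of p] by auto
  then have "x \<in> hcoords p" by (simp add: hcoords_def vec.span_base)
  then show ?thesis ..
qed

lemma hcoords_nz: "x \<in> hcoords p \<Longrightarrow> x \<noteq> 0"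
  by (simp add: hcoords_def)

lemma hcoords_line:
  assumes "x \<in> hcoords p" shows "line p = vec.span {x}"
proof -
  obtain y where y: "line p = vec.span {y}" using line[of p] by auto
  with assms obtain c where x: "x = c *s y" "x \<noteq> 0" by (auto simp: hcoords_def vec.span_singleton)
  then have c: "c \<noteq> 0" by auto
  then have "k *s y = (k * inverse c) *s x" "k *s x = (k * c) *s y" for k
    using x(1) by simp_all
  then show ?thesis unfolding y vec.span_singleton by (metis (no_types, lifting) rangeE rangeI subsetI subset_antisym)
qed

lemma hcoords_scale:
  assumes "x \<in> hcoords p" "y \<in> hcoords p"
  obtains c where "c \<noteq> 0" "y = c *s x"
  using assms(2) hcoords_line[OF assms(1)] that
  by (auto simp: hcoords_def vec.span_singleton)

lemma hcoords_scaleI: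
  assumes "x \<in> hcoords p" "c \<noteq> 0" shows "c *s x \<in> hcoords p"
proof -
  have "c *s x \<in> vec.span {x}" by (intro vec.span_scale vec.span_base) simp
  then have "c *s x \<in> line p" by (simp only: hcoords_line[OF assms(1)])
  moreover have "c *s x \<noteq> 0" using hcoords_nz[OF assms(1)] assms(2) by (metis vec.scale_eq_0_iff)
  ultimately show ?thesis unfolding hcoords_def by blast
qed

definition proj_of :: "complex ^ 'n \<Rightarrow> 'n::finite proj" where
  "proj_of x = Proj (vec.span {x})"

lemma line_proj_of: "x \<noteq> 0 \<Longrightarrow> line (proj_of x) = vec.span {x}"
  unfolding proj_of_def by (rule Proj_inverse) blast

lemma hcoords_proj_of: "x \<noteq> 0 \<Longrightarrow> x \<in> hcoords (proj_of x)"
  by (simp add: hcoords_def line_proj_of vec.span_base)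

lemma proj_of_hcoords: "x \<in> hcoords p \<Longrightarrow> proj_of x = p"
  by (metis hcoords_line hcoords_nz line_inject line_proj_of)

lemma basic_open_iff:
  assumes "F \<in> homogeneous d" "x \<in> hcoords p"
  shows "p \<in> basic_open F \<longleftrightarrow> peval F x \<noteq> 0"
proof -
  have "peval F y \<noteq> 0 \<longleftrightarrow> peval F x \<noteq> 0" if "y \<in> hcoords p" for y
    using hcoords_scale[OF assms(2) that] by (metis assms(1) mult_eq_0_iff peval_homogeneous power_not_zero)
  then show ?thesis using assms(2) unfolding basic_open_def by blast
qed

lemma basic_open_mult: "basic_open (F * G) = basic_open F \<inter> basic_open G"
  by (auto simp: basic_open_def peval_mult)

lemma zariski_open_basic: "F \<in> homogeneous d \<Longrightarrow> zariski_open (basic_open F)"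
  unfolding zariski_open_def by (rule exI[of _ "{F}"]) auto

lemma zariski_open_Int:
  assumes "zariski_open U" "zariski_open V" shows "zariski_open (U \<inter> V)"
proof -
  obtain S T where S: "S \<subseteq> (\<Union>d. homogeneous d)" "U = (\<Union>F\<in>S. basic_open F)"
    and T: "T \<subseteq> (\<Union>d. homogeneous d)" "V = (\<Union>F\<in>T. basic_open F)"
    using assms by (auto simp: zariski_open_def)
  have "(\<lambda>(F, G). F * G) ` (S \<times> T) \<subseteq> (\<Union>d. homogeneous d)"
    using S(1) T(1) homogeneous_mult by fastforce
  moreover have "U \<inter> V = (\<Union>F\<in>(\<lambda>(F, G). F * G) ` (S \<times> T). basic_open F)"
    by (auto simp: S(2) T(2) basic_open_mult)
  ultimately show ?thesis unfolding zariski_open_def by blast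
qed

lemma zariski_open_basis:
  assumes "zariski_open U" "p \<in> U"
  obtains d H where "H \<in> homogeneous d" "p \<in> basic_open H" "basic_open H \<subseteq> U"
  using assms unfolding zariski_open_def by blast

definition chart :: "'n \<Rightarrow> 'n::finite proj set" where
  "chart i = basic_open (Var i)"

lemma zariski_open_chart: "zariski_open (chart i)"
  unfolding chart_def by (rule zariski_open_basic[OF Var_homogeneous])

lemma chart_iff: "x \<in> hcoords p \<Longrightarrow> p \<in> chart i \<longleftrightarrow> x $ i \<noteq> 0"
  unfolding chart_def by (subst basic_open_iff[OF Var_homogeneous]) (simp_all del: One_nat_def)

lemma chart_cover: "\<exists>i. p \<in> chart i"
proof -
  obtain x where x: "x \<in> hcoords p" using hcoords_nonempty by blast
  then obtain i where "x $ i \<noteq> 0" using hcoords_nz by (fastforce simp: vec_eq_iff)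
  with x show ?thesis using chart_iff by blast
qed

lemma chart_normalize:
  assumes "p \<in> chart i"
  shows "\<exists>x\<in>hcoords p. x $ i = 1"
proof -
  obtain x where x: "x \<in> hcoords p" using hcoords_nonempty by blast
  then have "x $ i \<noteq> 0" using assms chart_iff by blast
  then show ?thesis
    using hcoords_scaleI[OF x, of "inverse (x $ i)"] by (intro bexI[of _ "inverse (x $ i) *s x"]) auto
qed

subsection \<open>Regular functions\<close>

lemma regular_onI:
  assumes "zariski_open U" "F \<in> homogeneous d" "G \<in> homogeneous d"
    "\<And>q x. q \<in> U \<Longrightarrow> x \<in> hcoords q \<Longrightarrow> peval G x \<noteq> 0 \<and> f q = peval F x / peval G x"
  shows "regular_on U f"
  unfolding regular_on_def using assms by blast

lemma regular_on_local:
  assumes "\<And>p. p \<in> U \<Longrightarrow> \<exists>V. zariski_open V \<and> p \<in> V \<and> V \<subseteq> U \<and> regular_on V f"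
  shows "regular_on U f"
  unfolding regular_on_def
proof
  fix p
  assume "p \<in> U"
  then obtain V where V: "zariski_open V" "p \<in> V" "V \<subseteq> U" "regular_on V f" using assms by blast
  from V(4,2) show "\<exists>W d. \<exists>F\<in>homogeneous d. \<exists>G\<in>homogeneous d.
      zariski_open W \<and> p \<in> W \<and> W \<subseteq> U \<and>
      (\<forall>q\<in>W. \<forall>x\<in>hcoords q. peval G x \<noteq> 0 \<and> f q = peval F x / peval G x)"
    unfolding regular_on_def using V(3) by (meson subset_trans)
qed

lemma regular_onE:
  assumes "regular_on U f" "p \<in> U"
  obtains V d F G where "zariski_open V" "p \<in> V" "V \<subseteq> U" "F \<in> homogeneous d" "G \<in> homogeneous d"
    "\<And>q x. q \<in> V \<Longrightarrow> x \<in> hcoords q \<Longrightarrow> peval G x \<noteq> 0"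
    "\<And>q x. q \<in> V \<Longrightarrow> x \<in> hcoords q \<Longrightarrow> f q = peval F x / peval G x"
  using assms unfolding regular_on_def by metis

lemma regular_on_subset:
  assumes "regular_on U f" "zariski_open V" "V \<subseteq> U"
  shows "regular_on V f"
proof (rule regular_on_local)
  fix p
  assume p: "p \<in> V"
  with assms(3) have "p \<in> U" by blast
  with assms(1) obtain W d F G where W: "zariski_open W" "p \<in> W" "W \<subseteq> U"
    "F \<in> homogeneous d" "G \<in> homogeneous d"
    "\<And>q x. q \<in> W \<Longrightarrow> x \<in> hcoords q \<Longrightarrow> peval G x \<noteq> 0"
    "\<And>q x. q \<in> W \<Longrightarrow> x \<in> hcoords q \<Longrightarrow> f q = peval F x / peval G x"
    by (rule regular_onE) blast
  have "regular_on (W \<inter> V) f"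
    using W by (intro regular_onI[OF zariski_open_Int[OF W(1) assms(2)] W(4,5)]) auto
  then show "\<exists>W. zariski_open W \<and> p \<in> W \<and> W \<subseteq> V \<and> regular_on W f"
    using p W(1,2) assms(2) zariski_open_Int by blast
qed

lemma regular_on_cong:
  assumes "regular_on U f" "\<And>q. q \<in> U \<Longrightarrow> f q = g q"
  shows "regular_on U g"
  using assms unfolding regular_on_def by (smt (verit) subsetD)

text \<open>
  Sums and products of regular functions are treated together: near a point both functions are
  quotients of forms, and it remains to write \<open>h (F/G) (F'/G')\<close> over the common denominator \<open>G G'\<close>.
\<close>

lemma regular_on_combine:
  fixes U :: "'n::finite proj set"
  assumes f: "regular_on U f" and g: "regular_on U g"
    and comb: "\<And>d e F G F' (G' :: 'n mpoly). F \<in> homogeneous d \<Longrightarrow> G \<in> homogeneous d \<Longrightarrow>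
      F' \<in> homogeneous e \<Longrightarrow> G' \<in> homogeneous e \<Longrightarrow>
      \<exists>H\<in>homogeneous (d + e). \<forall>x. peval G x \<noteq> 0 \<longrightarrow> peval G' x \<noteq> 0 \<longrightarrow>
        h (peval F x / peval G x) (peval F' x / peval G' x) = peval H x / peval (G * G') x"
  shows "regular_on U (\<lambda>p. h (f p) (g p))"
proof (rule regular_on_local)
  fix p
  assume p: "p \<in> U"
  obtain V d F G where V: "zariski_open V" "p \<in> V" "V \<subseteq> U" "F \<in> homogeneous d" "G \<in> homogeneous d"
    "\<And>q x. q \<in> V \<Longrightarrow> x \<in> hcoords q \<Longrightarrow> peval G x \<noteq> 0"
    "\<And>q x. q \<in> V \<Longrightarrow> x \<in> hcoords q \<Longrightarrow> f q = peval F x / peval G x"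
    using regular_onE[OF f p] by metis
  obtain V' d' F' G' where V': "zariski_open V'" "p \<in> V'" "V' \<subseteq> U" "F' \<in> homogeneous d'" "G' \<in> homogeneous d'"
    "\<And>q x. q \<in> V' \<Longrightarrow> x \<in> hcoords q \<Longrightarrow> peval G' x \<noteq> 0"
    "\<And>q x. q \<in> V' \<Longrightarrow> x \<in> hcoords q \<Longrightarrow> g q = peval F' x / peval G' x"
    using regular_onE[OF g p] by metis
  obtain H where H: "H \<in> homogeneous (d + d')"
    "\<And>x. peval G x \<noteq> 0 \<Longrightarrow> peval G' x \<noteq> 0 \<Longrightarrow>
      h (peval F x / peval G x) (peval F' x / peval G' x) = peval H x / peval (G * G') x"
    using comb[OF V(4,5) V'(4,5)] by blast
  have "regular_on (V \<inter> V') (\<lambda>p. h (f p) (g p))"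
  proof (rule regular_onI[OF zariski_open_Int[OF V(1) V'(1)] H(1) homogeneous_mult[OF V(5) V'(5)]])
    fix q x
    assume q: "q \<in> V \<inter> V'" "x \<in> hcoords q"
    then have "peval G x \<noteq> 0" "peval G' x \<noteq> 0" using V(6) V'(6) by auto
    moreover have "f q = peval F x / peval G x" "g q = peval F' x / peval G' x"
      using q V(7) V'(7) by auto
    ultimately show "peval (G * G') x \<noteq> 0 \<and> h (f q) (g q) = peval H x / peval (G * G') x"
      using H(2) by (auto simp: peval_mult)
  qed
  then show "\<exists>W. zariski_open W \<and> p \<in> W \<and> W \<subseteq> U \<and> regular_on W (\<lambda>p. h (f p) (g p))"
    using V(1-3) V'(1,2) zariski_open_Int by blast
qed

lemma regular_on_add:
  assumes "regular_on U f" "regular_on U g"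
  shows "regular_on U (\<lambda>p. f p + g p)"
proof (rule regular_on_combine[OF assms])
  fix d e and F G F' G' :: "'a mpoly"
  assume h: "F \<in> homogeneous d" "G \<in> homogeneous d" "F' \<in> homogeneous e" "G' \<in> homogeneous e"
  show "\<exists>H\<in>homogeneous (d + e). \<forall>x. peval G x \<noteq> 0 \<longrightarrow> peval G' x \<noteq> 0 \<longrightarrow>
        peval F x / peval G x + peval F' x / peval G' x = peval H x / peval (G * G') x"
  proof (rule bexI)
    show "F * G' + G * F' \<in> homogeneous (d + e)"
      by (intro complex_vector.subspace_add homogeneous_subspace homogeneous_mult h)
  qed (auto simp: peval_add peval_mult field_simps)
qed

lemma regular_on_mult:
  assumes "regular_on U f" "regular_on U g"
  shows "regular_on U (\<lambda>p. f p * g p)"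
proof (rule regular_on_combine[OF assms])
  fix d e and F G F' G' :: "'a mpoly"
  assume h: "F \<in> homogeneous d" "G \<in> homogeneous d" "F' \<in> homogeneous e" "G' \<in> homogeneous e"
  show "\<exists>H\<in>homogeneous (d + e). \<forall>x. peval G x \<noteq> 0 \<longrightarrow> peval G' x \<noteq> 0 \<longrightarrow>
        peval F x / peval G x * (peval F' x / peval G' x) = peval H x / peval (G * G') x"
    by (rule bexI[of _ "F * F'"]) (auto simp: peval_mult intro: homogeneous_mult h)
qed

lemma regular_on_const: "zariski_open U \<Longrightarrow> regular_on U (\<lambda>p. c)"
  by (rule regular_onI[where F = "c *\<^sub>C 1" and G = 1 and d = 0])
    (simp_all add: peval_scaleC complex_vector.subspace_scale homogeneous_subspace)

text \<open>
  The coordinate \<open>X\<^sub>j/X\<^sub>i\<close> of the chart \<open>X\<^sub>i \<noteq> 0\<close>, as a total function: at points outside the chart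
  division by zero makes it \<open>0\<close>.
\<close>

definition affine_coord :: "'n \<Rightarrow> 'n \<Rightarrow> 'n::finite proj \<Rightarrow> complex" where
  "affine_coord i j p = (let x = (SOME x. x \<in> hcoords p) in x $ j / x $ i)"

lemma affine_coord_eq:
  assumes "x \<in> hcoords p" shows "affine_coord i j p = x $ j / x $ i"
proof -
  define y where "y = (SOME x. x \<in> hcoords p)"
  have "y \<in> hcoords p" unfolding y_def using hcoords_nonempty by (rule someI_ex)
  then obtain c where "c \<noteq> 0" "y = c *s x" using hcoords_scale[OF assms] by blast
  then show ?thesis by (simp add: affine_coord_def Let_def flip: y_def)
qed

lemma affine_coord_regular: "regular_on (chart i) (affine_coord i j)"
  by (rule regular_onI[OF zariski_open_chart, where F = "Var j" and G = "Var i" and d = 1])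
    (auto simp: affine_coord_eq chart_iff simp del: One_nat_def)

section \<open>Local frames\<close>

text \<open>
  Sections that are combinations of the \<open>e i\<close> with regular coefficients.  This set is closed under sums
  and under multiplication by regular functions, which is how membership is established below.
\<close>

definition reg_comb ::
    "'n::finite proj set \<Rightarrow> 'i set \<Rightarrow> ('i \<Rightarrow> 'n proj \<Rightarrow> 'v::complex_vector) \<Rightarrow> ('n proj \<Rightarrow> 'v) \<Rightarrow> bool" where
  "reg_comb V I e s \<longleftrightarrow>
     (\<exists>g. (\<forall>i\<in>I. regular_on V (g i)) \<and> (\<forall>q\<in>V. s q = (\<Sum>i\<in>I. g i q *\<^sub>C e i q)))"

lemma reg_combE:
  assumes "reg_comb V I e s"
  obtains g where "\<And>i. i \<in> I \<Longrightarrow> regular_on V (g i)" "\<And>q. q \<in> V \<Longrightarrow> s q = (\<Sum>i\<in>I. g i q *\<^sub>C e i q)"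
  using assms unfolding reg_comb_def by blast

lemma reg_comb_cong: "reg_comb V I e s \<Longrightarrow> (\<And>q. q \<in> V \<Longrightarrow> s' q = s q) \<Longrightarrow> reg_comb V I e s'"
  unfolding reg_comb_def by metis

lemma reg_comb_subset: "reg_comb U I e s \<Longrightarrow> zariski_open V \<Longrightarrow> V \<subseteq> U \<Longrightarrow> reg_comb V I e s"
  unfolding reg_comb_def by (meson regular_on_subset subsetD)

lemma reg_comb_add:
  assumes "reg_comb V I e s" "reg_comb V I e t"
  shows "reg_comb V I e (\<lambda>q. s q + t q)"
proof -
  obtain g h where "\<forall>i\<in>I. regular_on V (g i)" "\<forall>q\<in>V. s q = (\<Sum>i\<in>I. g i q *\<^sub>C e i q)"
    "\<forall>i\<in>I. regular_on V (h i)" "\<forall>q\<in>V. t q = (\<Sum>i\<in>I. h i q *\<^sub>C e i q)"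
    using assms unfolding reg_comb_def by blast
  then show ?thesis
    unfolding reg_comb_def
    by (intro exI[of _ "\<lambda>i q. g i q + h i q"])
      (auto intro: regular_on_add simp: scaleC_add_left sum.distrib)
qed

lemma reg_comb_scale:
  assumes "regular_on V f" "reg_comb V I e s"
  shows "reg_comb V I e (\<lambda>q. f q *\<^sub>C s q)"
proof -
  obtain g where "\<forall>i\<in>I. regular_on V (g i)" "\<forall>q\<in>V. s q = (\<Sum>i\<in>I. g i q *\<^sub>C e i q)"
    using assms unfolding reg_comb_def by blast
  with assms(1) show ?thesis
    unfolding reg_comb_def
    by (intro exI[of _ "\<lambda>i q. f q * g i q"])
      (auto intro: regular_on_mult simp: scaleC_scaleC complex_vector.scale_sum_right)
qed

lemma reg_comb_zero: "zariski_open V \<Longrightarrow> reg_comb V I e (\<lambda>q. 0)"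
  unfolding reg_comb_def by (intro exI[of _ "\<lambda>i q. 0"]) (auto intro: regular_on_const)

lemma reg_comb_sum:
  assumes "zariski_open V" "\<And>j. j \<in> J \<Longrightarrow> reg_comb V I e (s j)"
  shows "reg_comb V I e (\<lambda>q. \<Sum>j\<in>J. s j q)"
  using assms(2)
  by (induction J rule: infinite_finite_induct) (auto intro: reg_comb_add reg_comb_zero assms(1))

lemma reg_comb_base:
  assumes "zariski_open V" "finite I" "i \<in> I"
  shows "reg_comb V I e (e i)"
  unfolding reg_comb_def
  by (rule exI[of _ "\<lambda>j q. if j = i then 1 else 0"])
    (use assms in \<open>auto intro: regular_on_const simp: if_distrib[of "\<lambda>c. c *\<^sub>C _"] scaleC_one cong: if_cong\<close>)

definition indep_family :: "'i set \<Rightarrow> ('i \<Rightarrow> 'v::complex_vector) \<Rightarrow> bool" where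
  "indep_family I v \<longleftrightarrow> (\<forall>c. (\<Sum>i\<in>I. c i *\<^sub>C v i) = 0 \<longrightarrow> (\<forall>i\<in>I. c i = 0))"

lemma indep_family_eq:
  assumes "indep_family I v" "(\<Sum>i\<in>I. c i *\<^sub>C v i) = (\<Sum>i\<in>I. d i *\<^sub>C v i)" "i \<in> I"
  shows "c i = d i"
proof -
  have "(\<Sum>i\<in>I. (c i - d i) *\<^sub>C v i) = 0"
    using assms(2) by (simp add: complex_vector.scale_left_diff_distrib sum_subtractf)
  then have "c i - d i = 0"
    using assms(1,3) spec[where x = "\<lambda>i. c i - d i"] unfolding indep_family_def by blast
  then show ?thesis by simp
qed

text \<open>
  At each point the coefficients are unique, so local choices of coefficients agree on overlaps, and
  regularity is a local property.
\<close>

lemma reg_comb_glue: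
  assumes ind: "\<And>q. q \<in> U \<Longrightarrow> indep_family I (\<lambda>i. e i q)"
    and loc: "\<And>p. p \<in> U \<Longrightarrow> \<exists>V. zariski_open V \<and> p \<in> V \<and> V \<subseteq> U \<and> reg_comb V I e s"
  shows "reg_comb U I e s"
proof -
  define c where "c = (\<lambda>q. SOME c. s q = (\<Sum>i\<in>I. c i *\<^sub>C e i q))"
  have c: "s q = (\<Sum>i\<in>I. c q i *\<^sub>C e i q)" if "q \<in> U" for q
  proof -
    obtain V where V: "q \<in> V" "reg_comb V I e s" using loc[OF \<open>q \<in> U\<close>] by blast
    obtain g where g: "\<And>i. i \<in> I \<Longrightarrow> regular_on V (g i)"
      "\<And>q. q \<in> V \<Longrightarrow> s q = (\<Sum>i\<in>I. g i q *\<^sub>C e i q)"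
      by (rule reg_combE[OF V(2)]) (rule that)
    from g(2)[OF V(1)] show ?thesis
      unfolding c_def by (rule someI[where P = "\<lambda>c. s q = (\<Sum>i\<in>I. c i *\<^sub>C e i q)"])
  qed
  have "regular_on U (\<lambda>q. c q i)" if i: "i \<in> I" for i
  proof (rule regular_on_local)
    fix p
    assume "p \<in> U"
    then obtain V where V: "zariski_open V" "p \<in> V" "V \<subseteq> U" "reg_comb V I e s"
      using loc by blast
    obtain g where g: "\<And>i. i \<in> I \<Longrightarrow> regular_on V (g i)"
      "\<And>q. q \<in> V \<Longrightarrow> s q = (\<Sum>i\<in>I. g i q *\<^sub>C e i q)"
      by (rule reg_combE[OF V(4)]) (rule that)
    have "g i q = c q i" if q: "q \<in> V" for q
    proof -
      have qU: "q \<in> U" using q V(3) by blast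
      show ?thesis
        by (rule indep_family_eq[OF ind[OF qU] _ i, where c = "\<lambda>i. g i q" and d = "c q"])
          (simp flip: c[OF qU] g(2)[OF q])
    qed
    then have "regular_on V (\<lambda>q. c q i)"
      using regular_on_cong[OF g(1)[OF i], of "\<lambda>q. c q i"] by blast
    with V(1-3) show "\<exists>V. zariski_open V \<and> p \<in> V \<and> V \<subseteq> U \<and> regular_on V (\<lambda>q. c q i)" by blast
  qed
  with c show ?thesis unfolding reg_comb_def by (intro exI[of _ "\<lambda>i q. c q i"]) blast
qed

text \<open>
  A local frame indexed by an arbitrary finite set.  The index sets that occur naturally here are sets
  of multisets; the enumeration required by \<^const>\<open>local_frame\<close> is chosen once and for all in
  \<open>frame_local_frame\<close>.
\<close>

definition frame ::
    "('n::finite, 'v::complex_vector) vbundle \<Rightarrow> 'n proj set \<Rightarrow> 'i set \<Rightarrow> ('i \<Rightarrow> 'n proj \<Rightarrow> 'v) \<Rightarrow> bool" where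
  "frame E U I e \<longleftrightarrow> finite I \<and> zariski_open U \<and>
     (\<forall>q\<in>U. indep_family I (\<lambda>i. e i q) \<and> fibre E q = {\<Sum>i\<in>I. c i *\<^sub>C e i q | c. True}) \<and>
     (\<forall>V s. zariski_open V \<longrightarrow> V \<subseteq> U \<longrightarrow> (s \<in> sections E V \<longleftrightarrow> reg_comb V I e s))"

text \<open>
  It suffices to find the coefficients of a section locally, since they glue.
\<close>

lemma frameI:
  assumes "finite I" "zariski_open U"
    and ind: "\<And>q. q \<in> U \<Longrightarrow> indep_family I (\<lambda>i. e i q)"
    and fib: "\<And>q. q \<in> U \<Longrightarrow> fibre E q = {\<Sum>i\<in>I. c i *\<^sub>C e i q | c. True}"
    and sec: "\<And>V s. zariski_open V \<Longrightarrow> V \<subseteq> U \<Longrightarrow> reg_comb V I e s \<Longrightarrow> s \<in> sections E V"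
    and loc: "\<And>V s p. zariski_open V \<Longrightarrow> V \<subseteq> U \<Longrightarrow> s \<in> sections E V \<Longrightarrow> p \<in> V \<Longrightarrow>
      \<exists>W. zariski_open W \<and> p \<in> W \<and> W \<subseteq> V \<and> reg_comb W I e s"
  shows "frame E U I e"
  unfolding frame_def
proof (intro conjI ballI allI impI iffI)
  fix V s
  assume "zariski_open V" "V \<subseteq> U" "s \<in> sections E V"
  then show "reg_comb V I e s"
    by (intro reg_comb_glue[where I = I] ind loc) blast+
qed (fact assms(1) | fact assms(2) | erule ind | erule fib | rule sec, assumption+)+

lemma
  assumes "frame E U I e"
  shows frame_finite: "finite I"
    and frame_open: "zariski_open U"
    and frame_indep: "q \<in> U \<Longrightarrow> indep_family I (\<lambda>i. e i q)"
    and frame_fibre: "q \<in> U \<Longrightarrow> fibre E q = {\<Sum>i\<in>I. c i *\<^sub>C e i q | c. True}"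
    and frame_sections: "zariski_open V \<Longrightarrow> V \<subseteq> U \<Longrightarrow> s \<in> sections E V \<longleftrightarrow> reg_comb V I e s"
  using assms unfolding frame_def by blast+

lemma frame_base_section:
  assumes "frame E U I e" "zariski_open V" "V \<subseteq> U" "i \<in> I"
  shows "e i \<in> sections E V"
  unfolding frame_sections[OF assms(1-3)]
  by (rule reg_comb_base[OF assms(2) frame_finite[OF assms(1)] assms(4)])

lemma frame_base_fibre:
  assumes "frame E U I e" "q \<in> U" "i \<in> I"
  shows "e i q \<in> fibre E q"
proof -
  have "e i q = (\<Sum>j\<in>I. (if j = i then 1 else 0) *\<^sub>C e j q)"
    using assms(3) frame_finite[OF assms(1)]
    by (simp add: if_distrib[of "\<lambda>c. c *\<^sub>C _"] scaleC_one cong: if_cong)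
  then show ?thesis
    unfolding frame_fibre[OF assms(1,2)]
    by (intro CollectI exI[of _ "\<lambda>j. if j = i then 1 else 0"]) simp
qed

lemma comb_subspace: "complex_vector.subspace {\<Sum>i\<in>I. c i *\<^sub>C w i | c. True}"
proof (rule complex_vector.subspaceI)
  show "0 \<in> {\<Sum>i\<in>I. c i *\<^sub>C w i | c. True}"
    by (intro CollectI exI[of _ "\<lambda>i. 0"]) simp
next
  fix u v
  assume "u \<in> {\<Sum>i\<in>I. c i *\<^sub>C w i | c. True}" "v \<in> {\<Sum>i\<in>I. c i *\<^sub>C w i | c. True}"
  then obtain a b where "u = (\<Sum>i\<in>I. a i *\<^sub>C w i)" "v = (\<Sum>i\<in>I. b i *\<^sub>C w i)" by blast
  then show "u + v \<in> {\<Sum>i\<in>I. c i *\<^sub>C w i | c. True}"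
    by (intro CollectI exI[of _ "\<lambda>i. a i + b i"]) (simp add: scaleC_add_left sum.distrib)
next
  fix k v
  assume "v \<in> {\<Sum>i\<in>I. c i *\<^sub>C w i | c. True}"
  then obtain a where "v = (\<Sum>i\<in>I. a i *\<^sub>C w i)" by blast
  then show "k *\<^sub>C v \<in> {\<Sum>i\<in>I. c i *\<^sub>C w i | c. True}"
    by (intro CollectI exI[of _ "\<lambda>i. k * a i"]) (simp add: scaleC_scaleC complex_vector.scale_sum_right)
qed

lemma frame_fibre_subspace:
  assumes "frame E U I e" "q \<in> U"
  shows "complex_vector.subspace (fibre E q)"
  unfolding frame_fibre[OF assms] by (rule comb_subspace)

text \<open>
  Keep the coefficients constant.  Thus statements about fibres follow from statements about
  sections.
\<close>

lemma frame_extend: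
  assumes "frame E U I e" "q \<in> U" "v \<in> fibre E q"
  shows "\<exists>s\<in>sections E U. s q = v"
proof -
  obtain c where "v = (\<Sum>i\<in>I. c i *\<^sub>C e i q)" using assms(3) frame_fibre[OF assms(1,2)] by blast
  moreover have "reg_comb U I e (\<lambda>q. \<Sum>i\<in>I. c i *\<^sub>C e i q)"
    unfolding reg_comb_def
    by (intro exI[of _ "\<lambda>i q. c i"]) (auto intro: regular_on_const frame_open[OF assms(1)])
  then have "(\<lambda>q. \<Sum>i\<in>I. c i *\<^sub>C e i q) \<in> sections E U"
    unfolding frame_sections[OF assms(1) frame_open[OF assms(1)] subset_refl] .
  ultimately show ?thesis by (intro bexI) auto
qed

lemma frame_local_frame:
  assumes "frame E U I e"
  shows "\<exists>r e'. local_frame E U r e'"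
proof -
  obtain h where h: "bij_betw h {..<card I} I"
    using frame_finite[OF assms] by (metis bij_betw_from_nat_into_finite)
  have sum: "(\<Sum>l<card I. f (h l)) = sum f I" for f :: "_ \<Rightarrow> 'b"
    by (rule sum.reindex_bij_betw[OF h])
  let ?k = "inv_into {..<card I} h"
  have k: "?k (h l) = l" if "l < card I" for l
    using that h by (simp add: bij_betw_inv_into_left)
  have hk: "h (?k i) = i" "?k i < card I" if "i \<in> I" for i
    using that h bij_betw_inv_into_right[OF h] bij_betw_inv_into[OF h] by (auto simp: bij_betw_def)
  have hI: "h l \<in> I" if "l < card I" for l using that h by (auto simp: bij_betw_def)
  have "local_frame E U (card I) (\<lambda>l. e (h l))"
    unfolding local_frame_def
  proof (intro conjI ballI allI impI)
    fix q
    assume q: "q \<in> U"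
    have resum: "(\<Sum>l<card I. c l *\<^sub>C e (h l) q) = (\<Sum>i\<in>I. c (?k i) *\<^sub>C e i q)" for c
      by (subst sum[symmetric]) (simp add: k)
    show "bij_betw (\<lambda>c. \<Sum>l<card I. c l *\<^sub>C e (h l) q) ({..<card I} \<rightarrow>\<^sub>E UNIV) (fibre E q)"
      unfolding bij_betw_def
    proof
      show "inj_on (\<lambda>c. \<Sum>l<card I. c l *\<^sub>C e (h l) q) ({..<card I} \<rightarrow>\<^sub>E UNIV)"
      proof (rule inj_onI)
        fix c d :: "nat \<Rightarrow> complex"
        assume c: "c \<in> {..<card I} \<rightarrow>\<^sub>E UNIV" and d: "d \<in> {..<card I} \<rightarrow>\<^sub>E UNIV"
          and "(\<Sum>l<card I. c l *\<^sub>C e (h l) q) = (\<Sum>l<card I. d l *\<^sub>C e (h l) q)"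
        then have "c (?k i) = d (?k i)" if "i \<in> I" for i
          unfolding resum using indep_family_eq[OF frame_indep[OF assms q]] that by meson
        then have "c l = d l" if "l < card I" for l
          using hI[OF that] k[OF that] by metis
        then show "c = d" using c d by (intro PiE_ext) auto
      qed
      show "(\<lambda>c. \<Sum>l<card I. c l *\<^sub>C e (h l) q) ` ({..<card I} \<rightarrow>\<^sub>E UNIV) = fibre E q"
        unfolding frame_fibre[OF assms q] resum
      proof (intro set_eqI iffI)
        fix v
        assume "v \<in> {\<Sum>i\<in>I. c i *\<^sub>C e i q | c. True}"
        then obtain c where "v = (\<Sum>i\<in>I. c i *\<^sub>C e i q)" by blast
        then have "v = (\<Sum>i\<in>I. restrict (\<lambda>l. c (h l)) {..<card I} (?k i) *\<^sub>C e i q)"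
          using hk by simp
        then show "v \<in> (\<lambda>c. \<Sum>i\<in>I. c (?k i) *\<^sub>C e i q) ` ({..<card I} \<rightarrow>\<^sub>E UNIV)"
          by (intro image_eqI[where x = "restrict (\<lambda>l. c (h l)) {..<card I}"]) auto
      next
        fix v
        assume "v \<in> (\<lambda>c. \<Sum>i\<in>I. c (?k i) *\<^sub>C e i q) ` ({..<card I} \<rightarrow>\<^sub>E UNIV)"
        then obtain c where "v = (\<Sum>i\<in>I. c (?k i) *\<^sub>C e i q)" by (rule imageE)
        then show "v \<in> {\<Sum>i\<in>I. c i *\<^sub>C e i q | c. True}"
          by (intro CollectI exI[of _ "\<lambda>i. c (?k i)"]) simp
      qed
    qed
  next
    fix V s
    assume V: "zariski_open V" "V \<subseteq> U"
    show "s \<in> sections E V \<longleftrightarrow> (\<exists>g. (\<forall>l<card I. regular_on V (g l)) \<and>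
        (\<forall>q\<in>V. s q = (\<Sum>l<card I. g l q *\<^sub>C e (h l) q)))" (is "_ \<longleftrightarrow> ?R")
    proof
      assume "s \<in> sections E V"
      then obtain g where "\<forall>i\<in>I. regular_on V (g i)" "\<forall>q\<in>V. s q = (\<Sum>i\<in>I. g i q *\<^sub>C e i q)"
        using frame_sections[OF assms V] unfolding reg_comb_def by blast
      then show ?R
        by (intro exI[of _ "\<lambda>l. g (h l)"]) (use hI in \<open>auto simp: sum[of "\<lambda>i. g i _ *\<^sub>C e i _"]\<close>)
    next
      assume ?R
      then obtain g where g: "\<forall>l<card I. regular_on V (g l)"
        "\<forall>q\<in>V. s q = (\<Sum>l<card I. g l q *\<^sub>C e (h l) q)" by blast
      have "(\<Sum>l<card I. g l q *\<^sub>C e (h l) q) = (\<Sum>i\<in>I. g (?k i) q *\<^sub>C e i q)" for q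
        by (subst sum[symmetric]) (simp add: k)
      with g have "reg_comb V I e s"
        unfolding reg_comb_def by (intro exI[of _ "\<lambda>i. g (?k i)"]) (auto simp: hk)
      then show "s \<in> sections E V" using frame_sections[OF assms V] by blast
    qed
  qed
  then show ?thesis by blast
qed

text \<open>
  Restriction of sections to smaller open sets is not part of \<^const>\<open>vector_bundle\<close>; it is needed to
  bring a section over an arbitrary open set into a chart, where a frame is available.
\<close>

definition restricts :: "('n::finite, 'v) vbundle \<Rightarrow> bool" where
  "restricts E \<longleftrightarrow> (\<forall>U V s. s \<in> sections E U \<longrightarrow> zariski_open V \<longrightarrow> V \<subseteq> U \<longrightarrow> s \<in> sections E V)"

lemma restrictsD: "restricts E \<Longrightarrow> s \<in> sections E U \<Longrightarrow> zariski_open V \<Longrightarrow> V \<subseteq> U \<Longrightarrow> s \<in> sections E V"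
  unfolding restricts_def by blast

text \<open>
  All the bundles except \<open>\<O>(k)\<close> define their sections by the local existence of some presentation \<open>P\<close>;
  they inherit restriction from \<open>P\<close>.
\<close>

lemma restrictsI:
  assumes sec: "\<And>U. sections E U = {s. \<forall>p\<in>U. \<exists>V. zariski_open V \<and> p \<in> V \<and> V \<subseteq> U \<and> P V s}"
    and P: "\<And>V W s. zariski_open W \<Longrightarrow> W \<subseteq> V \<Longrightarrow> P V s \<Longrightarrow> P W s"
  shows "restricts E"
  unfolding restricts_def sec
proof (intro allI impI; clarify)
  fix U V s p
  assume "\<forall>p\<in>U. \<exists>V. zariski_open V \<and> p \<in> V \<and> V \<subseteq> U \<and> P V s" "zariski_open V" "V \<subseteq> U" "p \<in> V"
  then obtain W where "zariski_open W" "p \<in> W" "P W s" by blast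
  then show "\<exists>W. zariski_open W \<and> p \<in> W \<and> W \<subseteq> V \<and> P W s"
    using P[of "W \<inter> V" W s] zariski_open_Int \<open>zariski_open V\<close> \<open>p \<in> V\<close> by blast
qed

text \<open>
  For sections defined by a local condition the sheaf axiom holds by construction, so that frames over
  the standard charts are all that is needed.
\<close>

lemma vector_bundleI:
  fixes E :: "('n::finite, 'v::complex_vector) vbundle"
  assumes sec: "\<And>U. sections E U = {s. \<forall>p\<in>U. \<exists>V. zariski_open V \<and> p \<in> V \<and> V \<subseteq> U \<and> P V s}"
    and frames: "\<And>i. frame E (chart i) (I i) (e i)"
  shows "vector_bundle E"
  unfolding vector_bundle_def
proof (intro conjI allI impI)
  fix p :: "'n proj"
  obtain i where "p \<in> chart i" using chart_cover by blast
  then show "complex_vector.subspace (fibre E p)"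
    "\<exists>U r e. zariski_open U \<and> p \<in> U \<and> local_frame E U r e"
    using frame_fibre_subspace[OF frames] frame_local_frame[OF frames] zariski_open_chart by blast+
next
  fix U :: "'n proj set" and s
  assume "zariski_open U"
  show "s \<in> sections E U \<longleftrightarrow> (\<forall>p\<in>U. \<exists>V. zariski_open V \<and> p \<in> V \<and> V \<subseteq> U \<and> s \<in> sections E V)"
  proof
    assume s: "s \<in> sections E U"
    show "\<forall>p\<in>U. \<exists>V. zariski_open V \<and> p \<in> V \<and> V \<subseteq> U \<and> s \<in> sections E V"
    proof
      fix p
      assume "p \<in> U"
      with s obtain V where "zariski_open V" "p \<in> V" "V \<subseteq> U" "P V s" unfolding sec by blast
      then show "\<exists>V. zariski_open V \<and> p \<in> V \<and> V \<subseteq> U \<and> s \<in> sections E V" unfolding sec by blast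
    qed
  next
    assume "\<forall>p\<in>U. \<exists>V. zariski_open V \<and> p \<in> V \<and> V \<subseteq> U \<and> s \<in> sections E V"
    then show "s \<in> sections E U" unfolding sec by (smt (verit) mem_Collect_eq subset_trans)
  qed
qed

text \<open>
  Sections are locally regular combinations of frame elements, so that a fibrewise linear map has to be
  tested on the latter only.
\<close>

lemma bundle_homI:
  fixes E :: "('n::finite, 'v::complex_vector) vbundle" and F :: "('n, 'w::complex_vector) vbundle"
  assumes F: "vector_bundle F"
    and E: "restricts E"
    and fE: "\<And>i. frame E (chart i) (I i) (e i)" and fF: "\<And>i. frame F (chart i) (J i) (f i)"
    and lin: "\<And>p. clinear (\<phi> p)"
    and img: "\<And>i a. a \<in> I i \<Longrightarrow> reg_comb (chart i) (J i) (f i) (\<lambda>q. \<phi> q (e i a q))"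
  shows "bundle_hom E F \<phi>"
  unfolding bundle_hom_def
proof (intro conjI allI ballI impI)
  fix p :: "'n proj" and v
  assume v: "v \<in> fibre E p"
  obtain i where p: "p \<in> chart i" using chart_cover by blast
  obtain c where c: "v = (\<Sum>a\<in>I i. c a *\<^sub>C e i a p)" using v frame_fibre[OF fE p] by blast
  have "\<phi> p (e i a p) \<in> fibre F p" if a: "a \<in> I i" for a
  proof -
    obtain g where "\<forall>q\<in>chart i. \<phi> q (e i a q) = (\<Sum>b\<in>J i. g b q *\<^sub>C f i b q)"
      using img[OF a] unfolding reg_comb_def by blast
    then have "\<phi> p (e i a p) = (\<Sum>b\<in>J i. g b p *\<^sub>C f i b p)" using p by blast
    then show ?thesis
      unfolding frame_fibre[OF fF p] by (intro CollectI exI[of _ "\<lambda>b. g b p"]) simp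
  qed
  then show "\<phi> p v \<in> fibre F p"
    unfolding c clinear_comb[OF lin]
    by (intro complex_vector.subspace_sum complex_vector.subspace_scale frame_fibre_subspace[OF fF p])
next
  fix U :: "'n proj set" and s
  assume U: "zariski_open U" and s: "s \<in> sections E U"
  have "\<exists>V. zariski_open V \<and> p \<in> V \<and> V \<subseteq> U \<and> (\<lambda>q. \<phi> q (s q)) \<in> sections F V" if "p \<in> U" for p
  proof -
    obtain i where p: "p \<in> chart i" using chart_cover by blast
    let ?V = "U \<inter> chart i"
    have V: "zariski_open ?V" "?V \<subseteq> U" "?V \<subseteq> chart i"
      using U zariski_open_chart zariski_open_Int by auto
    have "s \<in> sections E ?V" using restrictsD[OF E s V(1,2)] .
    then have "reg_comb ?V (I i) (e i) s" using frame_sections[OF fE V(1,3)] by simp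
    then obtain g where g: "\<forall>a\<in>I i. regular_on ?V (g a)" "\<forall>q\<in>?V. s q = (\<Sum>a\<in>I i. g a q *\<^sub>C e i a q)"
      unfolding reg_comb_def by blast
    have "reg_comb ?V (J i) (f i) (\<lambda>q. \<Sum>a\<in>I i. g a q *\<^sub>C \<phi> q (e i a q))"
      by (intro reg_comb_sum V reg_comb_scale) (use g(1) reg_comb_subset[OF img V(1,3)] in auto)
    then have "reg_comb ?V (J i) (f i) (\<lambda>q. \<phi> q (s q))"
      by (rule reg_comb_cong) (use g(2) in \<open>simp add: clinear_comb[OF lin]\<close>)
    then show ?thesis using frame_sections[OF fF V(1,3)] V p that by blast
  qed
  then show "(\<lambda>q. \<phi> q (s q)) \<in> sections F U"
    using F U unfolding vector_bundle_def by blast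
qed (simp_all add: clinear_add[OF lin] clinear_scaleC[OF lin])

section \<open>Tensor products with line bundles\<close>

text \<open>
  The universal property of the tensor product: the linear map induced by a bilinear map \<open>\<beta>\<close>, computed
  on a representative.  Contraction with a functional, an instance, detects nonzero pure tensors.
\<close>

definition tensor_lift ::
    "('a::complex_vector \<Rightarrow> 'b::complex_vector \<Rightarrow> 'c::complex_vector) \<Rightarrow> ('a, 'b) tensor \<Rightarrow> 'c" where
  "tensor_lift \<beta> t = free_extension (\<lambda>(a, b). \<beta> a b) (rep_tensor t)"

lemma tensor_lift_abs:
  assumes left: "\<And>b. clinear (\<lambda>a. \<beta> a b)" and right: "\<And>a. clinear (\<beta> a)"
  shows "tensor_lift \<beta> (abs_tensor u) = free_extension (\<lambda>(a, b). \<beta> a b) u"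
proof -
  have "tensor_rel (rep_tensor (abs_tensor u)) u"
    using Quotient3_rep_abs[OF Quotient3_tensor] equivp_reflp[OF tensor_equivp] by metis
  then have "rep_tensor (abs_tensor u) - u \<in> complex_vector.span tensor_relations"
    by (simp add: tensor_rel_def)
  moreover have "free_extension (\<lambda>(a, b). \<beta> a b) t = 0" if "t \<in> tensor_relations" for t
    using that unfolding tensor_relations_def
    by (auto simp: free_extension_diff free_extension_scaleC scaleC_one
        clinear_add[OF left] clinear_add[OF right] clinear_scaleC[OF left] clinear_scaleC[OF right])
  ultimately have "free_extension (\<lambda>(a, b). \<beta> a b) (rep_tensor (abs_tensor u) - u) = 0"
    by (rule free_extension_vanishes[rotated])
  then show ?thesis by (simp add: tensor_lift_def free_extension_diff)
qed

lemma
  fixes \<beta> :: "'a::complex_vector \<Rightarrow> 'b::complex_vector \<Rightarrow> 'c::complex_vector"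
  assumes "\<And>b. clinear (\<lambda>a. \<beta> a b)" "\<And>a. clinear (\<beta> a)"
  shows tensor_lift_pure: "tensor_lift \<beta> (a \<otimes>\<^sub>C b) = \<beta> a b"
    and clinear_tensor_lift: "clinear (tensor_lift \<beta>)"
proof -
  show "tensor_lift \<beta> (a \<otimes>\<^sub>C b) = \<beta> a b"
    unfolding pure_tensor_def by (simp add: tensor_lift_abs assms scaleC_one)
  show "clinear (tensor_lift \<beta>)"
  proof (rule clinearI)
    fix s t :: "('a, 'b) tensor" and c
    obtain u v where "s = abs_tensor u" "t = abs_tensor v"
      by (metis Quotient3_abs_rep[OF Quotient3_tensor])
    then show "tensor_lift \<beta> (s + t) = tensor_lift \<beta> s + tensor_lift \<beta> t"
      "tensor_lift \<beta> (c *\<^sub>C s) = c *\<^sub>C tensor_lift \<beta> s"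
      by (simp_all add: plus_tensor.abs_eq scaleC_tensor.abs_eq tensor_lift_abs assms
          free_extension_add free_extension_scaleC)
  qed
qed

lemma clinear_pure_left: "clinear (\<lambda>a. a \<otimes>\<^sub>C b)"
  by (rule clinearI) (rule pure_tensor_add_left pure_tensor_scaleC_left)+

text \<open>
  Contracting the second factor with the functional \<open>f\<close> recovers \<open>a\<close>.
\<close>

lemma pure_tensor_eq_0D:
  assumes "a \<otimes>\<^sub>C w = 0" "clinear f" "f w = (1::complex)"
  shows "a = 0"
proof -
  let ?\<beta> = "\<lambda>(a::'a) b. f b *\<^sub>C a"
  have \<beta>: "clinear (\<lambda>a. ?\<beta> a b)" "clinear (?\<beta> a)" for a b
    by (rule clinear_scale_fun[OF clinear_ident])
      (rule clinearI, simp_all add: clinear_add[OF assms(2)] clinear_scaleC[OF assms(2)]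
        scaleC_add_left scaleC_scaleC)
  have "a = tensor_lift ?\<beta> (a \<otimes>\<^sub>C w)"
    by (subst tensor_lift_pure[OF \<beta>]) (simp add: assms(3) scaleC_one)
  then show ?thesis by (simp add: assms(1) clinear_zero[OF clinear_tensor_lift[OF \<beta>]])
qed

lemma span_eq_comb:
  assumes "\<And>i. i \<in> I \<Longrightarrow> w i \<in> complex_vector.span S"
    and "\<And>v. v \<in> S \<Longrightarrow> \<exists>c. v = (\<Sum>i\<in>I. c i *\<^sub>C w i)"
  shows "complex_vector.span S = {\<Sum>i\<in>I. c i *\<^sub>C w i | c. True}"
proof
  show "complex_vector.span S \<subseteq> {\<Sum>i\<in>I. c i *\<^sub>C w i | c. True}"
    by (rule complex_vector.span_minimal[OF _ comb_subspace]) (use assms(2) in blast)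
  show "{\<Sum>i\<in>I. c i *\<^sub>C w i | c. True} \<subseteq> complex_vector.span S"
    using assms(1) by (auto intro!: complex_vector.span_sum complex_vector.span_scale)
qed

lemma sum_enumerate:
  assumes "finite I"
  obtains h where "\<And>l. l < card I \<Longrightarrow> h l \<in> I"
    "\<And>f :: 'i \<Rightarrow> 'v::comm_monoid_add. (\<Sum>l<card I. f (h l)) = (\<Sum>i\<in>I. f i)"
proof -
  obtain h where h: "bij_betw h {..<card I} I"
    using assms by (metis bij_betw_from_nat_into_finite)
  show thesis
  proof (rule that)
    show "h l \<in> I" if "l < card I" for l using h that by (auto simp: bij_betw_def)
    show "(\<Sum>l<card I. f (h l)) = (\<Sum>i\<in>I. f i)" for f :: "'i \<Rightarrow> 'v"
      by (rule sum.reindex_bij_betw[OF h])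
  qed
qed

definition tensor_local where
  "tensor_local E F V s \<longleftrightarrow> (\<exists>(r::nat) a b. (\<forall>i<r. a i \<in> sections E V \<and> b i \<in> sections F V) \<and>
        (\<forall>q\<in>V. s q = (\<Sum>i<r. a i q \<otimes>\<^sub>C b i q)))"

lemma tensor_sections:
  "sections (tensor_bundle E F) U =
     {s. \<forall>p\<in>U. \<exists>V. zariski_open V \<and> p \<in> V \<and> V \<subseteq> U \<and> tensor_local E F V s}"
  unfolding tensor_bundle_def tensor_local_def by (simp; blast)

lemma tensor_restricts:
  assumes "restricts E" "restricts F"
  shows "restricts (tensor_bundle E F)"
proof (rule restrictsI[OF tensor_sections])
  fix V W s
  assume W: "zariski_open W" "W \<subseteq> V" and "tensor_local E F V s"
  then obtain r :: nat and a b where ab: "\<And>i. i < r \<Longrightarrow> a i \<in> sections E V" "\<And>i. i < r \<Longrightarrow> b i \<in> sections F V"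
    "\<And>q. q \<in> V \<Longrightarrow> s q = (\<Sum>i<r. a i q \<otimes>\<^sub>C b i q)" unfolding tensor_local_def by blast
  show "tensor_local E F W s"
    unfolding tensor_local_def
  proof (intro exI conjI allI ballI impI)
    show "a i \<in> sections E W" "b i \<in> sections F W" if "i < r" for i
      using restrictsD[OF assms(1) ab(1)] restrictsD[OF assms(2) ab(2)] that W by auto
    show "s q = (\<Sum>i<r. a i q \<otimes>\<^sub>C b i q)" if "q \<in> W" for q using ab(3) that W by auto
  qed
qed

lemma reg_comb_pure:
  assumes "reg_comb V I e s"
  shows "reg_comb V I (\<lambda>i q. e i q \<otimes>\<^sub>C l q) (\<lambda>q. s q \<otimes>\<^sub>C l q)"
proof -
  obtain g where g: "\<And>i. i \<in> I \<Longrightarrow> regular_on V (g i)" "\<And>q. q \<in> V \<Longrightarrow> s q = (\<Sum>i\<in>I. g i q *\<^sub>C e i q)"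
    by (rule reg_combE[OF assms]) (rule that)
  show ?thesis
    unfolding reg_comb_def
    by (intro exI[of _ g]) (simp add: g clinear_comb[OF clinear_pure_left])
qed

text \<open>
  The fibres of the line bundle \<open>L\<close> sit in an ambient vector space, and the functional in the hypothesis, which is \<open>1\<close> on \<open>l q\<close>, is what keeps the products
  \<open>e i q \<otimes> l q\<close> independent in the ambient tensor product.
\<close>

lemma tensor_line_frame:
  fixes E :: "('n::finite, 'v::complex_vector) vbundle" and L :: "('n, 'w::complex_vector) vbundle"
  assumes fE: "frame E U I e" and fL: "frame L U {()} (\<lambda>_. l)"
    and functional: "\<And>q. q \<in> U \<Longrightarrow> \<exists>f. clinear f \<and> f (l q) = (1::complex)"
  shows "frame (tensor_bundle E L) U I (\<lambda>i q. e i q \<otimes>\<^sub>C l q)"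
proof (rule frameI)
  show "finite I" "zariski_open U" using fE frame_finite frame_open by blast+
next
  fix q
  assume q: "q \<in> U"
  show "indep_family I (\<lambda>i. e i q \<otimes>\<^sub>C l q)"
    unfolding indep_family_def
  proof (intro allI impI)
    fix c
    assume "(\<Sum>i\<in>I. c i *\<^sub>C (e i q \<otimes>\<^sub>C l q)) = 0"
    then have "(\<Sum>i\<in>I. c i *\<^sub>C e i q) \<otimes>\<^sub>C l q = 0"
      by (simp add: clinear_comb[OF clinear_pure_left])
    then have "(\<Sum>i\<in>I. c i *\<^sub>C e i q) = 0" using functional[OF q] pure_tensor_eq_0D by blast
    then show "\<forall>i\<in>I. c i = 0" using frame_indep[OF fE q] unfolding indep_family_def by blast
  qed
  show "fibre (tensor_bundle E L) q = {\<Sum>i\<in>I. c i *\<^sub>C (e i q \<otimes>\<^sub>C l q) | c. True}"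
    unfolding tensor_bundle_def vbundle.simps
  proof (rule span_eq_comb)
    show "e i q \<otimes>\<^sub>C l q \<in> complex_vector.span {v \<otimes>\<^sub>C w | v w. v \<in> fibre E q \<and> w \<in> fibre L q}"
      if "i \<in> I" for i
      using frame_base_fibre[OF fE q that] frame_base_fibre[OF fL q]
      by (intro complex_vector.span_base) blast
  next
    fix t
    assume "t \<in> {v \<otimes>\<^sub>C w | v w. v \<in> fibre E q \<and> w \<in> fibre L q}"
    then obtain v w where t: "t = v \<otimes>\<^sub>C w" "v \<in> fibre E q" "w \<in> fibre L q" by blast
    obtain a where a: "v = (\<Sum>i\<in>I. a i *\<^sub>C e i q)" using t(2) frame_fibre[OF fE q] by blast
    obtain b where b: "w = b () *\<^sub>C l q" using t(3) frame_fibre[OF fL q] by auto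
    have "t = (\<Sum>i\<in>I. (b () * a i) *\<^sub>C (e i q \<otimes>\<^sub>C l q))"
      by (simp add: t(1) a b clinear_comb[OF clinear_pure_left] pure_tensor_scaleC_right
          scaleC_scaleC complex_vector.scale_sum_right mult.commute)
    then show "\<exists>c. t = (\<Sum>i\<in>I. c i *\<^sub>C (e i q \<otimes>\<^sub>C l q))"
      by (intro exI[of _ "\<lambda>i. b () * a i"])
  qed
next
  fix V s
  assume V: "zariski_open V" "V \<subseteq> U" and "reg_comb V I (\<lambda>i q. e i q \<otimes>\<^sub>C l q) s"
  then obtain g where g: "\<And>i. i \<in> I \<Longrightarrow> regular_on V (g i)"
    "\<And>q. q \<in> V \<Longrightarrow> s q = (\<Sum>i\<in>I. g i q *\<^sub>C (e i q \<otimes>\<^sub>C l q))"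
    unfolding reg_comb_def by blast
  obtain h where h: "\<And>l. l < card I \<Longrightarrow> h l \<in> I"
    "\<And>f :: _ \<Rightarrow> ('v, 'w) tensor. (\<Sum>l<card I. f (h l)) = (\<Sum>i\<in>I. f i)"
    by (rule sum_enumerate[OF frame_finite[OF fE]]) (rule that)
  have "tensor_local E L V s"
    unfolding tensor_local_def
  proof (intro exI conjI allI ballI impI)
    fix j
    assume j: "j < card I"
    show "(\<lambda>q. g (h j) q *\<^sub>C e (h j) q) \<in> sections E V"
      unfolding frame_sections[OF fE V]
      by (intro reg_comb_scale g h j reg_comb_base V frame_finite[OF fE])
    show "l \<in> sections L V" using frame_base_section[OF fL V] by blast
  next
    fix q
    assume "q \<in> V"
    then show "s q = (\<Sum>j<card I. (g (h j) q *\<^sub>C e (h j) q) \<otimes>\<^sub>C l q)"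
      by (simp add: g(2) h(2)[of "\<lambda>i. g i q *\<^sub>C (e i q \<otimes>\<^sub>C l q)"] pure_tensor_scaleC_left)
  qed
  then show "s \<in> sections (tensor_bundle E L) V"
    unfolding tensor_sections using V by blast
next
  fix V s p
  assume V: "zariski_open V" "V \<subseteq> U" and s: "s \<in> sections (tensor_bundle E L) V" and p: "p \<in> V"
  obtain W where W: "zariski_open W" "p \<in> W" "W \<subseteq> V" "tensor_local E L W s"
    using s p unfolding tensor_sections by blast
  then have WU: "W \<subseteq> U" using V by blast
  obtain r :: nat and a b where a: "\<And>j. j < r \<Longrightarrow> a j \<in> sections E W"
    and b: "\<And>j. j < r \<Longrightarrow> b j \<in> sections L W"
    and s: "\<And>q. q \<in> W \<Longrightarrow> s q = (\<Sum>j<r. a j q \<otimes>\<^sub>C b j q)"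
    using W(4) unfolding tensor_local_def by blast
  have "reg_comb W I (\<lambda>i q. e i q \<otimes>\<^sub>C l q) (\<lambda>q. a j q \<otimes>\<^sub>C b j q)" if j: "j < r" for j
  proof -
    have "reg_comb W {()} (\<lambda>_. l) (b j)" using b[OF j] unfolding frame_sections[OF fL W(1) WU] .
    then obtain k where k: "\<And>i. i \<in> {()} \<Longrightarrow> regular_on W (k i)"
      "\<And>q. q \<in> W \<Longrightarrow> b j q = (\<Sum>i\<in>{()}. k i q *\<^sub>C l q)"
      unfolding reg_comb_def by blast
    have "reg_comb W I e (a j)" using a[OF j] unfolding frame_sections[OF fE W(1) WU] .
    then have "reg_comb W I (\<lambda>i q. e i q \<otimes>\<^sub>C l q) (\<lambda>q. k () q *\<^sub>C (a j q \<otimes>\<^sub>C l q))"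
      by (intro reg_comb_scale reg_comb_pure k) simp_all
    then show ?thesis by (rule reg_comb_cong) (simp add: k(2) pure_tensor_scaleC_right)
  qed
  then have "reg_comb W I (\<lambda>i q. e i q \<otimes>\<^sub>C l q) (\<lambda>q. \<Sum>j<r. a j q \<otimes>\<^sub>C b j q)"
    by (intro reg_comb_sum W) simp_all
  then have "reg_comb W I (\<lambda>i q. e i q \<otimes>\<^sub>C l q) s" by (rule reg_comb_cong) (rule s)
  with W show "\<exists>W. zariski_open W \<and> p \<in> W \<and> W \<subseteq> V \<and> reg_comb W I (\<lambda>i q. e i q \<otimes>\<^sub>C l q) s" by blast
qed

subsection \<open>The line bundles\<close>

text \<open>
  The section \<open>X\<^sub>i\<^sup>k\<close> of \<open>\<O>(k)\<close>, which generates it over the chart \<open>X\<^sub>i \<noteq> 0\<close>.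
\<close>

definition O_gen :: "int \<Rightarrow> 'n \<Rightarrow> 'n::finite proj \<Rightarrow> complex ^ 'n \<Rightarrow> complex" where
  "O_gen k i q = (\<lambda>x. if x \<in> hcoords q then (x $ i) powi k else 0)"

lemma hcoords_scale_iff: "c \<noteq> 0 \<Longrightarrow> c *s x \<in> hcoords q \<longleftrightarrow> x \<in> hcoords q"
  using hcoords_scaleI[of "c *s x" q "inverse c"] hcoords_scaleI[of x q c] by auto

lemma O_gen_fibre: "O_gen k i q \<in> O_fibre k q"
  by (auto simp: O_fibre_def O_gen_def hcoords_scale_iff power_int_mult_distrib)

text \<open>
  A homogeneous function on a line is determined by its value at one point of the line; the point with
  \<open>x\<^sub>i = 1\<close> is the one where \<open>X\<^sub>i\<^sup>k\<close> is \<open>1\<close>.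
\<close>

lemma O_fibre_eq:
  assumes f: "f \<in> O_fibre k q" and x: "x \<in> hcoords q" "x $ i = 1"
  shows "f = f x *\<^sub>C O_gen k i q"
proof
  fix y
  show "f y = (f x *\<^sub>C O_gen k i q) y"
  proof (cases "y \<in> hcoords q")
    case True
    then obtain c where "c \<noteq> 0" "y = c *s x" using hcoords_scale[OF x(1)] by blast
    then show ?thesis using f x True by (auto simp: O_fibre_def O_gen_def)
  next
    case False
    then show ?thesis using f by (simp add: O_fibre_def O_gen_def)
  qed
qed

text \<open>
  Evaluation at the point of the line with \<open>x\<^sub>i = 1\<close>.
\<close>

lemma O_functional:
  assumes "q \<in> chart i"
  shows "\<exists>f. clinear f \<and> f (O_gen k i q) = (1::complex)"
proof -
  obtain x where x: "x \<in> hcoords q" "x $ i = 1" using chart_normalize[OF assms] by blast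
  have "clinear (\<lambda>s :: complex ^ _ \<Rightarrow> complex. s x)" by (rule clinearI) simp_all
  moreover have "O_gen k i q x = 1" using x by (simp add: O_gen_def)
  ultimately show ?thesis by blast
qed

lemma O_fibre_comb:
  assumes "q \<in> chart i"
  shows "O_fibre k q = {\<Sum>j\<in>{()}. c j *\<^sub>C O_gen k i q | c. True}"
proof (intro set_eqI iffI)
  fix f
  assume f: "f \<in> O_fibre k q"
  obtain x where x: "x \<in> hcoords q" "x $ i = 1" using chart_normalize[OF assms] by blast
  have "f = (\<Sum>j\<in>{()}. f x *\<^sub>C O_gen k i q)" using O_fibre_eq[OF f x] by simp
  then show "f \<in> {\<Sum>j\<in>{()}. c j *\<^sub>C O_gen k i q | c. True}"
    by (intro CollectI exI[of _ "\<lambda>_. f x"]) simp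
next
  fix f
  assume "f \<in> {\<Sum>j\<in>{()}. c j *\<^sub>C O_gen k i q | c. True}"
  then obtain c where "f = c *\<^sub>C O_gen k i q" by auto
  then show "f \<in> O_fibre k q"
    using O_gen_fibre[of k i q] by (auto simp: O_fibre_def)
qed

text \<open>
  A regular function is a quotient of forms of equal degree, and a section of \<open>\<O>(k)\<close> one of forms whose
  degrees differ by \<open>k\<close>.  Multiplication by \<open>X\<^sub>i\<^sup>k\<close> passes from one to the other; for negative \<open>k\<close> the power of
  \<open>X\<^sub>i\<close> goes into the denominator, hence the exponents \<open>nat k\<close> and \<open>nat (- k)\<close>, one of which is \<open>0\<close>.
\<close>

lemma O_frame: "frame (O_bundle k) (chart i) {()} (\<lambda>_. O_gen k i)"
proof (rule frameI)
  fix q :: "'a proj"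
  assume q: "q \<in> chart i"
  show "indep_family {()} (\<lambda>_. O_gen k i q)"
  proof -
    obtain f where f: "clinear f" "f (O_gen k i q) = (1::complex)" using O_functional[OF q] by blast
    then show ?thesis
      unfolding indep_family_def
      by (auto dest!: arg_cong[of _ _ f] simp: clinear_scaleC clinear_zero)
  qed
  show "fibre (O_bundle k) q = {\<Sum>j\<in>{()}. c j *\<^sub>C O_gen k i q | c. True}"
    unfolding O_bundle_def vbundle.simps by (rule O_fibre_comb[OF q])
next
  fix V and s :: "'a proj \<Rightarrow> complex ^ 'a \<Rightarrow> complex"
  assume V: "zariski_open V" "V \<subseteq> chart i" and "reg_comb V {()} (\<lambda>_. O_gen k i) s"
  then obtain g where g: "regular_on V (g ())" "\<And>q. q \<in> V \<Longrightarrow> s q = g () q *\<^sub>C O_gen k i q"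
    unfolding reg_comb_def by auto
  show "s \<in> sections (O_bundle k) V"
    unfolding O_bundle_def vbundle.simps mem_Collect_eq
  proof (intro ballI conjI)
    fix p
    assume p: "p \<in> V"
    then have "s p \<in> {\<Sum>j\<in>{()}. c j *\<^sub>C O_gen k i p | c. True}"
      unfolding g(2)[OF p] by (intro CollectI exI[of _ "\<lambda>_. g () p"]) simp
    then show "s p \<in> O_fibre k p" using O_fibre_comb V(2) p by blast
    obtain W d F G where W: "zariski_open W" "p \<in> W" "W \<subseteq> V" "F \<in> homogeneous d" "G \<in> homogeneous d"
      "\<And>q x. q \<in> W \<Longrightarrow> x \<in> hcoords q \<Longrightarrow> peval G x \<noteq> 0"
      "\<And>q x. q \<in> W \<Longrightarrow> x \<in> hcoords q \<Longrightarrow> g () q = peval F x / peval G x"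
      by (rule regular_onE[OF g(1) p]) (rule that)
    have x: "x $ i \<noteq> 0" if "q \<in> W" "x \<in> hcoords q" for q x
      using that W(3) V(2) chart_iff by blast
    let ?F = "F * Var i ^ nat k" and ?G = "G * Var i ^ nat (- k)"
    have "?F \<in> homogeneous (d + nat k * 1)" "?G \<in> homogeneous (d + nat (- k) * 1)"
      by (intro homogeneous_mult homogeneous_power W Var_homogeneous)+
    moreover have "peval ?G x \<noteq> 0 \<and> s q x = peval ?F x / peval ?G x" if q: "q \<in> W" "x \<in> hcoords q" for q x
    proof -
      have "(x $ i) powi k = (x $ i) ^ nat k / (x $ i) ^ nat (- k)"
        by (cases "k \<ge> 0") (simp_all add: power_int_def divide_inverse power_inverse)
      moreover have "s q x = g () q * (x $ i) powi k"
        using g(2)[of q] q W(3) by (auto simp: O_gen_def)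
      ultimately show ?thesis
        using x[OF q] W(6,7)[OF q] by (simp add: peval_mult peval_power del: One_nat_def)
    qed
    moreover have "int (d + nat k * 1) - int (d + nat (- k) * 1) = k" by simp
    ultimately show "\<exists>W d e. \<exists>F\<in>homogeneous d. \<exists>G\<in>homogeneous e.
           zariski_open W \<and> p \<in> W \<and> W \<subseteq> V \<and> int d - int e = k \<and>
           (\<forall>q\<in>W. \<forall>x\<in>hcoords q. peval G x \<noteq> 0 \<and> s q x = peval F x / peval G x)"
      using W(1-3) by blast
  qed
next
  fix V p and s :: "'a proj \<Rightarrow> complex ^ 'a \<Rightarrow> complex"
  assume V: "zariski_open V" "V \<subseteq> chart i" and s: "s \<in> sections (O_bundle k) V" and p: "p \<in> V"
  have fib: "s q \<in> O_fibre k q" if "q \<in> V" for q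
    using s that unfolding O_bundle_def vbundle.simps by blast
  obtain W d e F G where W: "zariski_open W" "p \<in> W" "W \<subseteq> V" "F \<in> homogeneous d" "G \<in> homogeneous e"
      "int d - int e = k" "\<And>q x. q \<in> W \<Longrightarrow> x \<in> hcoords q \<Longrightarrow> peval G x \<noteq> 0"
      "\<And>q x. q \<in> W \<Longrightarrow> x \<in> hcoords q \<Longrightarrow> s q x = peval F x / peval G x"
    using s p unfolding O_bundle_def vbundle.simps by blast
  have ch: "x $ i \<noteq> 0" if "q \<in> W" "x \<in> hcoords q" for q x
    using that W(3) V(2) chart_iff by blast
  let ?F = "F * Var i ^ nat (- k)" and ?G = "G * Var i ^ nat k"
  have deg: "e + nat k * 1 = d + nat (- k) * 1" using W(6) by auto
  have "?G \<in> homogeneous (e + nat k * 1)"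
    by (intro homogeneous_mult homogeneous_power W Var_homogeneous)
  then have "?G \<in> homogeneous (d + nat (- k) * 1)" by (simp only: deg)
  moreover have "?F \<in> homogeneous (d + nat (- k) * 1)"
    by (intro homogeneous_mult homogeneous_power W Var_homogeneous)
  ultimately have hom: "?F \<in> homogeneous (d + nat (- k) * 1)" "?G \<in> homogeneous (d + nat (- k) * 1)"
    by blast+
  define g where "g q = (let x = (SOME x. x \<in> hcoords q \<and> x $ i = 1) in s q x)" for q
  have g: "s q = g q *\<^sub>C O_gen k i q \<and> g q = peval ?F x / peval ?G x \<and> peval ?G x \<noteq> 0"
    if q: "q \<in> W" "x \<in> hcoords q" for q x
  proof -
    define y where "y = (SOME x. x \<in> hcoords q \<and> x $ i = 1)"
    have "q \<in> chart i" "q \<in> V" using q W(3) V(2) by auto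
    then have y: "y \<in> hcoords q" "y $ i = 1"
      unfolding y_def using chart_normalize[of q i] someI_ex[of "\<lambda>x. x \<in> hcoords q \<and> x $ i = 1"] by blast+
    have gy: "g q = s q y" by (simp add: g_def y_def Let_def)
    have s: "s q = g q *\<^sub>C O_gen k i q" unfolding gy using O_fibre_eq[OF fib y] \<open>q \<in> V\<close> by blast
    have "peval F x / peval G x = g q * (x $ i) powi k"
      using W(8)[OF q] fun_cong[OF s, of x] q by (simp add: O_gen_def)
    moreover have "(x $ i) powi k = (x $ i) ^ nat k / (x $ i) ^ nat (- k)"
      by (cases "k \<ge> 0") (simp_all add: power_int_def divide_inverse power_inverse)
    ultimately have "g q = peval ?F x / peval ?G x"
      using ch[OF q] W(7)[OF q] by (simp add: peval_mult peval_power field_simps del: One_nat_def)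
    then show ?thesis using s ch[OF q] W(7)[OF q] by (simp add: peval_mult peval_power del: One_nat_def)
  qed
  have "regular_on W g"
    by (rule regular_onI[OF W(1) hom]) (use g in blast)
  moreover have "s q = g q *\<^sub>C O_gen k i q" if "q \<in> W" for q
    using g[OF that] hcoords_nonempty[of q] by blast
  ultimately have "reg_comb W {()} (\<lambda>_. O_gen k i) s"
    unfolding reg_comb_def by (intro exI[of _ "\<lambda>_. g"]) simp
  with W show "\<exists>W. zariski_open W \<and> p \<in> W \<and> W \<subseteq> V \<and> reg_comb W {()} (\<lambda>_. O_gen k i) s" by blast
qed (simp_all add: zariski_open_chart)

lemma O_restricts: "restricts (O_bundle k)"
  unfolding restricts_def
proof (intro allI impI)
  fix U V :: "'a proj set" and s :: "'a proj \<Rightarrow> complex ^ 'a \<Rightarrow> complex"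
  assume s: "s \<in> sections (O_bundle k) U" and V: "zariski_open V" "V \<subseteq> U"
  show "s \<in> sections (O_bundle k) V"
    unfolding O_bundle_def vbundle.simps mem_Collect_eq
  proof (intro ballI conjI)
    fix p
    assume p: "p \<in> V"
    with V s show "s p \<in> O_fibre k p" unfolding O_bundle_def by auto
    have "p \<in> U" using p V by blast
    then obtain W d e F G where W: "zariski_open W" "p \<in> W" "W \<subseteq> U" "F \<in> homogeneous d" "G \<in> homogeneous e"
      "int d - int e = k"
      "\<forall>q\<in>W. \<forall>x\<in>hcoords q. peval G x \<noteq> 0 \<and> s q x = peval F x / peval G x"
      using s unfolding O_bundle_def vbundle.simps by blast
    have "zariski_open (W \<inter> V)" "p \<in> W \<inter> V" "W \<inter> V \<subseteq> V"
      using W V p zariski_open_Int by auto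
    with W(4-7) show "\<exists>W d e. \<exists>F\<in>homogeneous d. \<exists>G\<in>homogeneous e.
           zariski_open W \<and> p \<in> W \<and> W \<subseteq> V \<and> int d - int e = k \<and>
           (\<forall>q\<in>W. \<forall>x\<in>hcoords q. peval G x \<noteq> 0 \<and> s q x = peval F x / peval G x)"
      by (metis IntD1)
  qed
qed

lemma tensor_O_frame:
  assumes "frame E (chart i) I e"
  shows "frame (tensor_bundle E (O_bundle k)) (chart i) I (\<lambda>a q. e a q \<otimes>\<^sub>C O_gen k i q)"
  by (rule tensor_line_frame[OF assms O_frame O_functional])

section \<open>The trivial bundle of forms of a given degree\<close>

definition trivial_local where
  "trivial_local W V s \<longleftrightarrow> (\<exists>(r::nat) g w. (\<forall>i<r. regular_on V (g i) \<and> w i \<in> W) \<and>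
        (\<forall>q\<in>V. s q = (\<Sum>i<r. g i q *\<^sub>C w i)))"

lemma trivial_sections:
  "sections (trivial_bundle W) U =
     {s. \<forall>p\<in>U. \<exists>V. zariski_open V \<and> p \<in> V \<and> V \<subseteq> U \<and> trivial_local W V s}"
  unfolding trivial_bundle_def trivial_local_def by (simp; blast)

lemma trivial_restricts: "restricts (trivial_bundle W)"
proof (rule restrictsI[OF trivial_sections])
  fix V V' :: "'a proj set" and s :: "'a proj \<Rightarrow> 'b"
  assume V': "zariski_open V'" "V' \<subseteq> V" and "trivial_local W V s"
  then obtain r :: nat and g w where g: "\<And>i. i < r \<Longrightarrow> regular_on V (g i)" "\<And>i. i < r \<Longrightarrow> w i \<in> W"
    "\<And>q. q \<in> V \<Longrightarrow> s q = (\<Sum>i<r. g i q *\<^sub>C w i)" unfolding trivial_local_def by blast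
  show "trivial_local W V' s"
    unfolding trivial_local_def
  proof (intro exI conjI allI ballI impI)
    show "regular_on V' (g i)" "w i \<in> W" if "i < r" for i
      using regular_on_subset[OF g(1) V'] g(2) that by auto
    show "s q = (\<Sum>i<r. g i q *\<^sub>C w i)" if "q \<in> V'" for q using g(3) that V' by auto
  qed
qed

lemma trivial_frame:
  fixes U :: "'n::finite proj set"
  assumes U: "zariski_open U"
  shows "frame (trivial_bundle (homogeneous d :: 'n mpoly set)) U (multisets_of_size UNIV d) (\<lambda>K q. mon K)"
proof (rule frameI)
  show fin: "finite (multisets_of_size (UNIV :: 'n set) d)" by (rule finite_multisets_of_size) simp
next
  note fin = finite_multisets_of_size[of "UNIV :: 'n set" d, OF finite]
  show "indep_family (multisets_of_size UNIV d) (mon :: 'n multiset \<Rightarrow> _)"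
    unfolding indep_family_def using mon_independent[OF fin] by blast
  show "fibre (trivial_bundle (homogeneous d :: 'n mpoly set)) q =
      {\<Sum>K\<in>multisets_of_size UNIV d. c K *\<^sub>C mon K | c. True}" for q :: "'n proj"
    unfolding trivial_bundle_def vbundle.simps
  proof (intro set_eqI iffI)
    fix F :: "'n mpoly"
    assume "F \<in> homogeneous d"
    then show "F \<in> {\<Sum>K\<in>multisets_of_size UNIV d. c K *\<^sub>C mon K | c. True}"
      by (intro CollectI exI[of _ "\<lambda>K. Poly_Mapping.lookup F (expo K)"]) (simp add: homogeneous_expand[symmetric])
  next
    fix F :: "'n mpoly"
    assume "F \<in> {\<Sum>K\<in>multisets_of_size UNIV d. c K *\<^sub>C mon K | c. True}"
    then obtain c where "F = (\<Sum>K\<in>multisets_of_size UNIV d. c K *\<^sub>C mon K)" by blast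
    then show "F \<in> homogeneous d"
      by (auto intro!: complex_vector.subspace_sum complex_vector.subspace_scale homogeneous_subspace
          simp: mon_homogeneous multisets_of_size_def)
  qed
next
  fix V and s :: "'n proj \<Rightarrow> 'n mpoly"
  assume V: "zariski_open V" "V \<subseteq> U" and "reg_comb V (multisets_of_size UNIV d) (\<lambda>K q. mon K) s"
  then obtain g where g: "\<And>K. K \<in> multisets_of_size UNIV d \<Longrightarrow> regular_on V (g K)"
    "\<And>q. q \<in> V \<Longrightarrow> s q = (\<Sum>K\<in>multisets_of_size UNIV d. g K q *\<^sub>C mon K)"
    unfolding reg_comb_def by blast
  obtain h where h: "\<And>l. l < card (multisets_of_size (UNIV::'n set) d) \<Longrightarrow> h l \<in> multisets_of_size (UNIV::'n set) d"
    "\<And>f :: _ \<Rightarrow> 'n mpoly. (\<Sum>l<card (multisets_of_size (UNIV::'n set) d). f (h l)) = (\<Sum>K\<in>multisets_of_size UNIV d. f K)"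
    by (rule sum_enumerate[OF finite_multisets_of_size[of "UNIV :: 'n set" d]]) (simp, rule that)
  have "trivial_local (homogeneous d) V s"
    unfolding trivial_local_def
  proof (intro exI conjI allI ballI impI)
    fix l
    assume l: "l < card (multisets_of_size (UNIV :: 'n set) d)"
    show "regular_on V (g (h l))" by (rule g(1)[OF h(1)[OF l]])
    show "mon (h l) \<in> homogeneous d" using h(1)[OF l] by (simp add: mon_homogeneous multisets_of_size_def)
  next
    fix q
    assume "q \<in> V"
    then show "s q = (\<Sum>l<card (multisets_of_size (UNIV :: 'n set) d). g (h l) q *\<^sub>C mon (h l))"
      by (simp add: g(2) h(2)[of "\<lambda>K. g K q *\<^sub>C mon K"])
  qed
  then show "s \<in> sections (trivial_bundle (homogeneous d)) V"
    unfolding trivial_sections using V by blast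
next
  fix V p and s :: "'n proj \<Rightarrow> 'n mpoly"
  assume V: "zariski_open V" "V \<subseteq> U" and s: "s \<in> sections (trivial_bundle (homogeneous d)) V" and p: "p \<in> V"
  obtain W where W: "zariski_open W" "p \<in> W" "W \<subseteq> V" "trivial_local (homogeneous d) W s"
    using s p unfolding trivial_sections by blast
  obtain r :: nat and g w where g: "\<And>i. i < r \<Longrightarrow> regular_on W (g i)" "\<And>i. i < r \<Longrightarrow> w i \<in> homogeneous d"
    "\<And>q. q \<in> W \<Longrightarrow> s q = (\<Sum>i<r. g i q *\<^sub>C w i)" using W(4) unfolding trivial_local_def by blast
  have "reg_comb W (multisets_of_size UNIV d) (\<lambda>K q. mon K) (\<lambda>q. w l)" if "l < r" for l
    unfolding reg_comb_def
    by (intro exI[of _ "\<lambda>K q. Poly_Mapping.lookup (w l) (expo K)"])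
      (use homogeneous_expand[OF g(2)[OF that]] regular_on_const[OF W(1)] in auto)
  then have "reg_comb W (multisets_of_size UNIV d) (\<lambda>K q. mon K) (\<lambda>q. \<Sum>l<r. g l q *\<^sub>C w l)"
    by (intro reg_comb_sum reg_comb_scale W g) auto
  then have "reg_comb W (multisets_of_size UNIV d) (\<lambda>K q. mon K) s"
    by (rule reg_comb_cong) (rule g(3))
  with W show "\<exists>W. zariski_open W \<and> p \<in> W \<and> W \<subseteq> V \<and>
      reg_comb W (multisets_of_size UNIV d) (\<lambda>K q. mon K) s" by blast
qed (rule U)


section \<open>Symmetric powers\<close>

text \<open>
  The universal property of the symmetric algebra, for linear maps into a polynomial ring.
\<close>

definition sym_lift :: "('a::complex_vector \<Rightarrow> 'k mpoly) \<Rightarrow> 'a sym \<Rightarrow> 'k mpoly" where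
  "sym_lift f t = free_extension (\<lambda>M. \<Prod>v\<in>#M. f v) (rep_sym t)"

lemma sym_lift_abs:
  assumes f: "clinear f"
  shows "sym_lift f (abs_sym u) = free_extension (\<lambda>M. \<Prod>v\<in>#M. f v) u"
proof -
  have "sym_rel (rep_sym (abs_sym u)) u"
    using Quotient3_rep_abs[OF Quotient3_sym] equivp_reflp[OF sym_equivp] by metis
  then have "rep_sym (abs_sym u) - u \<in> complex_vector.span sym_relations"
    by (simp add: sym_rel_def)
  moreover have "free_extension (\<lambda>M. \<Prod>v\<in>#M. f v) t = 0" if "t \<in> sym_relations" for t
    using that unfolding sym_relations_def
    by (auto simp: free_extension_diff free_extension_scaleC scaleC_one
        clinear_add[OF f] clinear_scaleC[OF f] scaleC_mult_left distrib_right)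
  ultimately have "free_extension (\<lambda>M. \<Prod>v\<in>#M. f v) (rep_sym (abs_sym u) - u) = 0"
    by (rule free_extension_vanishes[rotated])
  then show ?thesis by (simp add: sym_lift_def free_extension_diff)
qed

lemma
  fixes f :: "'a::complex_vector \<Rightarrow> 'k mpoly"
  assumes "clinear f"
  shows sym_lift_prod: "sym_lift f (sym_prod M) = (\<Prod>v\<in>#M. f v)"
    and clinear_sym_lift: "clinear (sym_lift f)"
proof -
  show "sym_lift f (sym_prod M) = (\<Prod>v\<in>#M. f v)"
    unfolding sym_prod_def by (simp add: sym_lift_abs assms scaleC_one)
  show "clinear (sym_lift f)"
  proof (rule clinearI)
    fix s t :: "'a sym" and c
    obtain u v where "s = abs_sym u" "t = abs_sym v"
      by (metis Quotient3_abs_rep[OF Quotient3_sym])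
    then show "sym_lift f (s + t) = sym_lift f s + sym_lift f t"
      "sym_lift f (c *\<^sub>C s) = c *\<^sub>C sym_lift f s"
      by (simp_all add: plus_sym.abs_eq scaleC_sym.abs_eq sym_lift_abs assms
          free_extension_add free_extension_scaleC)
  qed
qed

lemma clinear_sym_prod: "clinear (\<lambda>v. sym_prod (add_mset v M))"
proof (rule clinearI)
  show "sym_prod (add_mset (x + y) M) = sym_prod (add_mset x M) + sym_prod (add_mset y M)" for x y
  proof (transfer, unfold sym_rel_def)
    fix x y :: 'a and M
    have "Poly_Mapping.single (add_mset (x + y) M) 1 - Poly_Mapping.single (add_mset x M) 1
        - Poly_Mapping.single (add_mset y M) 1 \<in> complex_vector.span sym_relations"
      by (rule complex_vector.span_base) (unfold sym_relations_def, blast)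
    then show "Poly_Mapping.single (add_mset (x + y) M) 1 - (Poly_Mapping.single (add_mset x M) 1
        + Poly_Mapping.single (add_mset y M) 1) \<in> complex_vector.span sym_relations"
      by (simp add: algebra_simps)
  qed
  show "sym_prod (add_mset (c *\<^sub>C x) M) = c *\<^sub>C sym_prod (add_mset x M)" for c x
    by (transfer, unfold sym_rel_def, rule complex_vector.span_base)
      (unfold sym_relations_def, blast)
qed

definition sym_local where
  "sym_local m E V s \<longleftrightarrow> (\<exists>(r::nat) g a. (\<forall>i<r. regular_on V (g i) \<and> (\<forall>j<m. a i j \<in> sections E V)) \<and>
        (\<forall>q\<in>V. s q = (\<Sum>i<r. g i q *\<^sub>C sym_prod (image_mset (\<lambda>j. a i j q) (mset_set {..<m})))))"

lemma sym_sections: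
  "sections (sym_bundle m E) U =
     {s. \<forall>p\<in>U. \<exists>V. zariski_open V \<and> p \<in> V \<and> V \<subseteq> U \<and> sym_local m E V s}"
  unfolding sym_bundle_def sym_local_def by (simp; blast)

lemma sym_restricts:
  assumes "restricts E"
  shows "restricts (sym_bundle m E)"
proof (rule restrictsI[OF sym_sections])
  fix V W s
  assume W: "zariski_open W" "W \<subseteq> V" and "sym_local m E V s"
  then obtain r :: nat and g a where a: "\<And>i. i < r \<Longrightarrow> regular_on V (g i)"
    "\<And>i j. i < r \<Longrightarrow> j < m \<Longrightarrow> a i j \<in> sections E V"
    "\<And>q. q \<in> V \<Longrightarrow> s q = (\<Sum>i<r. g i q *\<^sub>C sym_prod (image_mset (\<lambda>j. a i j q) (mset_set {..<m})))"
    unfolding sym_local_def by blast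
  show "sym_local m E W s"
    unfolding sym_local_def
  proof (intro exI conjI allI ballI impI)
    show "regular_on W (g i)" if "i < r" for i using regular_on_subset[OF a(1) W] that by blast
    show "a i j \<in> sections E W" if "i < r" "j < m" for i j
      using restrictsD[OF assms a(2) W] that by blast
    show "s q = (\<Sum>i<r. g i q *\<^sub>C sym_prod (image_mset (\<lambda>j. a i j q) (mset_set {..<m})))" if "q \<in> W" for q
      using a(3) that W by auto
  qed
qed

text \<open>
  The factors are expanded in the frame one at a time.  In the induction the first \<open>k\<close> factors are
  still arbitrary sections, while the others have been replaced by frame elements, recorded by the
  multiset \<open>N\<close>.
\<close>

lemma reg_comb_sym_prod:
  assumes V: "zariski_open V" and J: "finite J" and a: "\<And>k. k < m \<Longrightarrow> reg_comb V J e (a k)"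
  shows "reg_comb V (multisets_of_size J m) (\<lambda>K q. sym_prod (image_mset (\<lambda>j. e j q) K))
     (\<lambda>q. sym_prod (image_mset (\<lambda>k. a k q) (mset_set {..<m})))"
proof -
  let ?E = "\<lambda>K q. sym_prod (image_mset (\<lambda>j. e j q) K)"
  have "reg_comb V (multisets_of_size J m) ?E
      (\<lambda>q. sym_prod (image_mset (\<lambda>k. a k q) (mset_set {..<k}) + image_mset (\<lambda>j. e j q) N))"
    if "k \<le> m" "set_mset N \<subseteq> J" "size N + k = m" for k N
    using that
  proof (induction k arbitrary: N)
    case 0
    then have "N \<in> multisets_of_size J m" by (simp add: multisets_of_size_def)
    then show ?case
      using reg_comb_base[OF V finite_multisets_of_size[OF J], of N m ?E] by simp
  next
    case (Suc k)
    let ?M = "\<lambda>q. image_mset (\<lambda>k. a k q) (mset_set {..<k}) + image_mset (\<lambda>j. e j q) N"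
    have "k < m" using Suc.prems by simp
    then obtain g where g: "\<And>j. j \<in> J \<Longrightarrow> regular_on V (g j)"
      "\<And>q. q \<in> V \<Longrightarrow> a k q = (\<Sum>j\<in>J. g j q *\<^sub>C e j q)"
      using a unfolding reg_comb_def by blast
    have "reg_comb V (multisets_of_size J m) ?E (\<lambda>q. sym_prod (add_mset (e j q) (?M q)))" if j: "j \<in> J" for j
      using Suc.IH[of "add_mset j N"] Suc.prems j by simp
    then have "reg_comb V (multisets_of_size J m) ?E
        (\<lambda>q. \<Sum>j\<in>J. g j q *\<^sub>C sym_prod (add_mset (e j q) (?M q)))"
      by (intro reg_comb_sum reg_comb_scale V g)
    then show ?case
    proof (rule reg_comb_cong)
      fix q
      assume "q \<in> V"
      have "{..<Suc k} = insert k {..<k}" by auto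
      then have "image_mset (\<lambda>k. a k q) (mset_set {..<Suc k}) + image_mset (\<lambda>j. e j q) N
          = add_mset (a k q) (?M q)" by simp
      then show "sym_prod (image_mset (\<lambda>k. a k q) (mset_set {..<Suc k}) + image_mset (\<lambda>j. e j q) N)
          = (\<Sum>j\<in>J. g j q *\<^sub>C sym_prod (add_mset (e j q) (?M q)))"
        using g(2)[OF \<open>q \<in> V\<close>] clinear_comb[OF clinear_sym_prod[of "?M q"], of "\<lambda>j. g j q" "\<lambda>j. e j q" J]
        by simp
    qed
  qed
  from this[of m "{#}"] show ?thesis by simp
qed

text \<open>
  The independence of the monomials in a frame comes from the polynomial ring: the functionals dual to
  the frame are assembled into a linear map with
  \<open>e\<^sub>j \<mapsto> Y\<^sub>j\<close>; the induced map on the symmetric algebra sends the monomials in the \<open>e\<^sub>j\<close> to the monomials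
  in the \<open>Y\<^sub>j\<close>.
\<close>

lemma sym_frame:
  assumes fE: "frame E U J e"
    and dual: "\<And>q. q \<in> U \<Longrightarrow> \<exists>f. (\<forall>j\<in>J. clinear (f j)) \<and>
      (\<forall>j\<in>J. \<forall>k\<in>J. f j (e k q) = (if j = k then 1 else 0 :: complex))"
  shows "frame (sym_bundle m E) U (multisets_of_size J m) (\<lambda>K q. sym_prod (image_mset (\<lambda>j. e j q) K))"
proof (rule frameI)
  note J = frame_finite[OF fE]
  show fin: "finite (multisets_of_size J m)" by (rule finite_multisets_of_size[OF J])
  show "zariski_open U" by (rule frame_open[OF fE])
next
  note J = frame_finite[OF fE]
  note fin = finite_multisets_of_size[OF J, of m]
  fix q
  assume q: "q \<in> U"
  obtain f where f: "\<And>j. j \<in> J \<Longrightarrow> clinear (f j)"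
    "\<And>j k. j \<in> J \<Longrightarrow> k \<in> J \<Longrightarrow> f j (e k q) = (if j = k then 1 else 0 :: complex)"
    using dual[OF q] by blast
  define \<Lambda> where "\<Lambda> v = (\<Sum>j\<in>J. f j v *\<^sub>C Var j)" for v
  have \<Lambda>: "clinear \<Lambda>"
    unfolding \<Lambda>_def
    by (rule clinear_sum_fun, rule clinearI)
      (simp_all add: clinear_add[OF f(1)] clinear_scaleC[OF f(1)] scaleC_add_left scaleC_scaleC)
  have \<Lambda>_e: "\<Lambda> (e k q) = Var k" if "k \<in> J" for k
  proof -
    have "\<Lambda> (e k q) = (\<Sum>j\<in>J. if j = k then Var j else 0)"
      unfolding \<Lambda>_def by (rule sum.cong) (simp_all add: f(2) that scaleC_one del: One_nat_def)
    then show ?thesis using that J by simp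
  qed
  have lift: "sym_lift \<Lambda> (sym_prod (image_mset (\<lambda>j. e j q) K)) = mon K" if "set_mset K \<subseteq> J" for K
  proof -
    have "sym_lift \<Lambda> (sym_prod (image_mset (\<lambda>j. e j q) K)) = (\<Prod>j\<in>#K. \<Lambda> (e j q))"
      by (simp add: sym_lift_prod[OF \<Lambda>] multiset.map_comp comp_def)
    also have "\<dots> = (\<Prod>j\<in>#K. Var j)"
      using that by (intro arg_cong[where f = prod_mset] image_mset_cong \<Lambda>_e) auto
    finally show ?thesis by (simp only: mon_eq_prod)
  qed
  show "indep_family (multisets_of_size J m) (\<lambda>K. sym_prod (image_mset (\<lambda>j. e j q) K))"
    unfolding indep_family_def
  proof (intro allI impI ballI)
    fix c K
    assume 0: "(\<Sum>K\<in>multisets_of_size J m. c K *\<^sub>C sym_prod (image_mset (\<lambda>j. e j q) K)) = 0"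
      and K: "K \<in> multisets_of_size J m"
    have "(\<Sum>K\<in>multisets_of_size J m. c K *\<^sub>C mon K)
        = sym_lift \<Lambda> (\<Sum>K\<in>multisets_of_size J m. c K *\<^sub>C sym_prod (image_mset (\<lambda>j. e j q) K))"
      unfolding clinear_comb[OF clinear_sym_lift[OF \<Lambda>]]
      by (rule sum.cong) (simp_all add: lift multisets_of_size_def)
    then show "c K = 0"
      using mon_independent[OF fin _ K] by (simp add: 0 clinear_zero[OF clinear_sym_lift[OF \<Lambda>]])
  qed
  show "fibre (sym_bundle m E) q =
      {\<Sum>K\<in>multisets_of_size J m. c K *\<^sub>C sym_prod (image_mset (\<lambda>j. e j q) K) | c. True}"
    unfolding sym_bundle_def vbundle.simps
  proof (rule span_eq_comb)
    fix K
    assume K: "K \<in> multisets_of_size J m"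
    have "set_mset (image_mset (\<lambda>j. e j q) K) \<subseteq> fibre E q"
      using K frame_base_fibre[OF fE q] by (auto simp: multisets_of_size_def)
    moreover have "size (image_mset (\<lambda>j. e j q) K) = m" using K by (simp add: multisets_of_size_def)
    ultimately show "sym_prod (image_mset (\<lambda>j. e j q) K) \<in>
        complex_vector.span {sym_prod M | M. size M = m \<and> set_mset M \<subseteq> fibre E q}"
      by (intro complex_vector.span_base) blast
  next
    fix t
    assume "t \<in> {sym_prod M | M. size M = m \<and> set_mset M \<subseteq> fibre E q}"
    then obtain M where M: "t = sym_prod M" "size M = m" "set_mset M \<subseteq> fibre E q" by blast
    obtain xs where xs: "mset xs = M" using ex_mset by blast
    have len: "length xs = m" using M(2) xs by auto
    have "\<exists>s\<in>sections E U. s q = xs ! k" if "k < m" for k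
    proof (rule frame_extend[OF fE q])
      have "xs ! k \<in># M" using that len xs by (metis nth_mem_mset)
      then show "xs ! k \<in> fibre E q" using M(3) by blast
    qed
    then obtain a where a: "\<And>k. k < m \<Longrightarrow> a k \<in> sections E U" "\<And>k. k < m \<Longrightarrow> a k q = xs ! k" by metis
    have "reg_comb U J e (a k)" if "k < m" for k
      using a(1)[OF that] frame_sections[OF fE frame_open[OF fE] subset_refl] by blast
    then have "reg_comb U (multisets_of_size J m) (\<lambda>K q. sym_prod (image_mset (\<lambda>j. e j q) K))
        (\<lambda>q. sym_prod (image_mset (\<lambda>k. a k q) (mset_set {..<m})))"
      by (rule reg_comb_sym_prod[OF frame_open[OF fE] J])
    then obtain g where "\<And>K. K \<in> multisets_of_size J m \<Longrightarrow> regular_on U (g K)"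
      and g: "\<And>q. q \<in> U \<Longrightarrow> sym_prod (image_mset (\<lambda>k. a k q) (mset_set {..<m})) =
        (\<Sum>K\<in>multisets_of_size J m. g K q *\<^sub>C sym_prod (image_mset (\<lambda>j. e j q) K))"
      by (rule reg_combE) (rule that)
    have "image_mset (\<lambda>k. a k q) (mset_set {..<m}) = image_mset ((!) xs) (mset_set {..<m})"
      by (rule image_mset_cong) (simp add: a(2))
    also have "\<dots> = M"
      using xs len by (metis atLeast0LessThan map_nth mset_map mset_upt)
    finally show "\<exists>c. t = (\<Sum>K\<in>multisets_of_size J m. c K *\<^sub>C sym_prod (image_mset (\<lambda>j. e j q) K))"
      using g[OF q] M(1) by (intro exI[of _ "\<lambda>K. g K q"]) simp
  qed
next
  note J = frame_finite[OF fE]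
  fix V s
  assume V: "zariski_open V" "V \<subseteq> U"
    and "reg_comb V (multisets_of_size J m) (\<lambda>K q. sym_prod (image_mset (\<lambda>j. e j q) K)) s"
  then obtain g where g: "\<And>K. K \<in> multisets_of_size J m \<Longrightarrow> regular_on V (g K)"
    "\<And>q. q \<in> V \<Longrightarrow> s q = (\<Sum>K\<in>multisets_of_size J m. g K q *\<^sub>C sym_prod (image_mset (\<lambda>j. e j q) K))"
    unfolding reg_comb_def by blast
  obtain h where h: "\<And>l. l < card (multisets_of_size J m) \<Longrightarrow> h l \<in> multisets_of_size J m"
    "\<And>f :: _ \<Rightarrow> 'b sym. (\<Sum>l<card (multisets_of_size J m). f (h l)) = (\<Sum>K\<in>multisets_of_size J m. f K)"
    by (rule sum_enumerate[OF finite_multisets_of_size[OF J, of m]]) (rule that)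
  \<comment> \<open>The sections of a symmetric power are given by products of \<open>m\<close> sections indexed by \<open>{..<m}\<close>, so the\<close>
  \<comment> \<open>elements of each multiset are listed in some order.\<close>
  define ks where "ks K = (SOME xs. mset xs = K)" for K :: "'c multiset"
  have ks: "mset (ks K) = K" for K unfolding ks_def using ex_mset by (rule someI_ex)
  have len: "length (ks K) = size K" for K by (metis ks size_mset)
  have img: "image_mset (\<lambda>j. e (ks K ! j) q) (mset_set {..<m}) = image_mset (\<lambda>j. e j q) K"
    if "size K = m" for K q
  proof -
    have "image_mset (\<lambda>j. e (ks K ! j) q) (mset_set {..<m})
        = image_mset (\<lambda>j. e j q) (image_mset ((!) (ks K)) (mset_set {..<m}))"
      by (simp add: multiset.map_comp comp_def)
    also have "image_mset ((!) (ks K)) (mset_set {..<m}) = K"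
      using ks[of K] len[of K] that by (metis atLeast0LessThan map_nth mset_map mset_upt)
    finally show ?thesis .
  qed
  have "sym_local m E V s"
    unfolding sym_local_def
  proof (intro exI conjI allI ballI impI)
    fix l
    assume l: "l < card (multisets_of_size J m)"
    show "regular_on V (g (h l))" by (rule g(1)[OF h(1)[OF l]])
    fix j
    assume "j < m"
    then have "ks (h l) ! j \<in># h l"
      using h(1)[OF l] ks[of "h l"] len[of "h l"] by (metis multisets_of_size_size nth_mem_mset)
    then have "ks (h l) ! j \<in> J" using h(1)[OF l] multisets_of_size_subset by blast
    then show "e (ks (h l) ! j) \<in> sections E V" by (rule frame_base_section[OF fE V])
  next
    fix q
    assume "q \<in> V"
    have "(\<Sum>l<card (multisets_of_size J m).
        g (h l) q *\<^sub>C sym_prod (image_mset (\<lambda>j. e (ks (h l) ! j) q) (mset_set {..<m})))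
      = (\<Sum>K\<in>multisets_of_size J m.
        g K q *\<^sub>C sym_prod (image_mset (\<lambda>j. e (ks K ! j) q) (mset_set {..<m})))"
      by (rule h(2))
    also have "\<dots> = s q"
      unfolding g(2)[OF \<open>q \<in> V\<close>] by (rule sum.cong) (simp_all add: img multisets_of_size_def)
    finally show "s q = (\<Sum>l<card (multisets_of_size J m).
        g (h l) q *\<^sub>C sym_prod (image_mset (\<lambda>j. e (ks (h l) ! j) q) (mset_set {..<m})))" by simp
  qed
  then show "s \<in> sections (sym_bundle m E) V"
    unfolding sym_sections using V by blast
next
  fix V s p
  assume V: "zariski_open V" "V \<subseteq> U" and s: "s \<in> sections (sym_bundle m E) V" and p: "p \<in> V"
  obtain W where W: "zariski_open W" "p \<in> W" "W \<subseteq> V" "sym_local m E W s"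
    using s p unfolding sym_sections by blast
  then have WU: "W \<subseteq> U" using V by blast
  obtain r :: nat and g a where a: "\<And>i. i < r \<Longrightarrow> regular_on W (g i)"
    "\<And>i j. i < r \<Longrightarrow> j < m \<Longrightarrow> a i j \<in> sections E W"
    "\<And>q. q \<in> W \<Longrightarrow> s q = (\<Sum>i<r. g i q *\<^sub>C sym_prod (image_mset (\<lambda>j. a i j q) (mset_set {..<m})))"
    using W(4) unfolding sym_local_def by blast
  have "reg_comb W J e (a i j)" if "i < r" "j < m" for i j
    using a(2)[OF that] frame_sections[OF fE W(1) WU] by blast
  then have "reg_comb W (multisets_of_size J m) (\<lambda>K q. sym_prod (image_mset (\<lambda>j. e j q) K))
      (\<lambda>q. \<Sum>i<r. g i q *\<^sub>C sym_prod (image_mset (\<lambda>j. a i j q) (mset_set {..<m})))"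
    by (intro reg_comb_sum reg_comb_scale reg_comb_sym_prod W(1) frame_finite[OF fE] a(1)) auto
  then have "reg_comb W (multisets_of_size J m) (\<lambda>K q. sym_prod (image_mset (\<lambda>j. e j q) K)) s"
    by (rule reg_comb_cong) (rule a(3))
  with W show "\<exists>W. zariski_open W \<and> p \<in> W \<and> W \<subseteq> V \<and>
      reg_comb W (multisets_of_size J m) (\<lambda>K q. sym_prod (image_mset (\<lambda>j. e j q) K)) s" by blast
qed

section \<open>The cotangent bundle\<close>

subsection \<open>Derivations of the local ring\<close>

lemma regular_atI: "zariski_open U \<Longrightarrow> p \<in> U \<Longrightarrow> regular_on U f \<Longrightarrow> regular_at p f"
  unfolding regular_at_def by blast

lemma regular_at_add:
  assumes "regular_at p f" "regular_at p g" shows "regular_at p (\<lambda>q. f q + g q)"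
proof -
  obtain U V where "zariski_open U" "p \<in> U" "regular_on U f" "zariski_open V" "p \<in> V" "regular_on V g"
    using assms unfolding regular_at_def by blast
  then show ?thesis
    by (intro regular_atI[of "U \<inter> V"] regular_on_add zariski_open_Int)
      (auto intro: regular_on_subset zariski_open_Int)
qed

lemma regular_at_mult:
  assumes "regular_at p f" "regular_at p g" shows "regular_at p (\<lambda>q. f q * g q)"
proof -
  obtain U V where "zariski_open U" "p \<in> U" "regular_on U f" "zariski_open V" "p \<in> V" "regular_on V g"
    using assms unfolding regular_at_def by blast
  then show ?thesis
    by (intro regular_atI[of "U \<inter> V"] regular_on_mult zariski_open_Int)
      (auto intro: regular_on_subset zariski_open_Int)
qed

lemma regular_at_const: "regular_at p (\<lambda>q. c)"
proof -
  obtain i where "p \<in> chart i" using chart_cover by blast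
  then show ?thesis by (rule regular_atI[OF zariski_open_chart _ regular_on_const[OF zariski_open_chart]])
qed

lemma
  assumes "D \<in> tangent_space p"
  shows tangent_non_regular: "\<not> regular_at p f \<Longrightarrow> D f = 0"
    and tangent_germ: "zariski_open U \<Longrightarrow> p \<in> U \<Longrightarrow> regular_at p f \<Longrightarrow> regular_at p g \<Longrightarrow>
      (\<And>q. q \<in> U \<Longrightarrow> f q = g q) \<Longrightarrow> D f = D g"
    and tangent_add: "regular_at p f \<Longrightarrow> regular_at p g \<Longrightarrow> D (\<lambda>q. f q + g q) = D f + D g"
    and tangent_scale: "regular_at p f \<Longrightarrow> D (\<lambda>q. c * f q) = c * D f"
    and tangent_mult: "regular_at p f \<Longrightarrow> regular_at p g \<Longrightarrow> D (\<lambda>q. f q * g q) = f p * D g + g p * D f"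
proof -
  note D = assms[unfolded tangent_space_def mem_Collect_eq]
  show "\<not> regular_at p f \<Longrightarrow> D f = 0"
    by (rule D[THEN conjunct1, rule_format])
  show "zariski_open U \<Longrightarrow> p \<in> U \<Longrightarrow> regular_at p f \<Longrightarrow> regular_at p g \<Longrightarrow>
      (\<And>q. q \<in> U \<Longrightarrow> f q = g q) \<Longrightarrow> D f = D g"
    by (rule D[THEN conjunct2, THEN conjunct1, rule_format])
  show "regular_at p f \<Longrightarrow> regular_at p g \<Longrightarrow> D (\<lambda>q. f q + g q) = D f + D g"
    by (rule D[THEN conjunct2, THEN conjunct2, THEN conjunct1, rule_format])
  show "regular_at p f \<Longrightarrow> D (\<lambda>q. c * f q) = c * D f"
    by (rule D[THEN conjunct2, THEN conjunct2, THEN conjunct2, THEN conjunct1, rule_format])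
  show "regular_at p f \<Longrightarrow> regular_at p g \<Longrightarrow> D (\<lambda>q. f q * g q) = f p * D g + g p * D f"
    by (rule D[THEN conjunct2, THEN conjunct2, THEN conjunct2, THEN conjunct2, rule_format])
qed

lemma tangentI:
  assumes "\<And>f. \<not> regular_at p f \<Longrightarrow> D f = 0"
    and "\<And>U f g. zariski_open U \<Longrightarrow> p \<in> U \<Longrightarrow> regular_at p f \<Longrightarrow> regular_at p g \<Longrightarrow>
      (\<And>q. q \<in> U \<Longrightarrow> f q = g q) \<Longrightarrow> D f = D g"
    and "\<And>f g. regular_at p f \<Longrightarrow> regular_at p g \<Longrightarrow> D (\<lambda>q. f q + g q) = D f + D g"
    and "\<And>c f. regular_at p f \<Longrightarrow> D (\<lambda>q. c * f q) = c * D f"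
    and "\<And>f g. regular_at p f \<Longrightarrow> regular_at p g \<Longrightarrow> D (\<lambda>q. f q * g q) = f p * D g + g p * D f"
  shows "D \<in> tangent_space p"
  unfolding tangent_space_def
proof (intro CollectI conjI allI impI)
  fix U f g
  assume "zariski_open U" "p \<in> U" "regular_at p f" "regular_at p g" "\<forall>q\<in>U. f q = g q"
  then show "D f = D g" by (intro assms(2)) auto
qed (rule assms; assumption)+

lemma tangent_subspace: "complex_vector.subspace (tangent_space p)"
proof (rule complex_vector.subspaceI)
  show "0 \<in> tangent_space p" by (rule tangentI) simp_all
next
  fix D D'
  assume D: "D \<in> tangent_space p" and D': "D' \<in> tangent_space p"
  show "D + D' \<in> tangent_space p"
  proof (rule tangentI)
    fix U f g
    assume "zariski_open U" "p \<in> U" "regular_at p f" "regular_at p g" "\<And>q. q \<in> U \<Longrightarrow> f q = g q"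
    then show "(D + D') f = (D + D') g"
      using tangent_germ[OF D] tangent_germ[OF D'] by (metis plus_fun_apply)
  qed (simp_all add: tangent_non_regular[OF D] tangent_non_regular[OF D'] tangent_add[OF D]
      tangent_add[OF D'] tangent_scale[OF D] tangent_scale[OF D'] tangent_mult[OF D] tangent_mult[OF D']
      algebra_simps)
next
  fix c D
  assume D: "D \<in> tangent_space p"
  show "c *\<^sub>C D \<in> tangent_space p"
  proof (rule tangentI)
    fix U f g
    assume "zariski_open U" "p \<in> U" "regular_at p f" "regular_at p g" "\<And>q. q \<in> U \<Longrightarrow> f q = g q"
    then show "(c *\<^sub>C D) f = (c *\<^sub>C D) g"
      using tangent_germ[OF D] by (metis scaleC_fun_apply)
  qed (simp_all add: tangent_non_regular[OF D] tangent_add[OF D] tangent_scale[OF D]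
      tangent_mult[OF D] algebra_simps)
qed

lemma tangent_const:
  assumes D: "D \<in> tangent_space p" shows "D (\<lambda>q. c) = 0"
proof -
  have "D (\<lambda>q. 1 * 1) = 1 * D (\<lambda>q. 1) + 1 * D (\<lambda>q. 1)"
    by (rule tangent_mult[OF D regular_at_const regular_at_const])
  then have "D (\<lambda>q. 1) = 0" by simp
  then show ?thesis using tangent_scale[OF D regular_at_const[of p 1], of c] by simp
qed

text \<open>
  The representative with \<open>x\<^sub>i = 1\<close> of a point of the chart \<open>X\<^sub>i \<noteq> 0\<close>.
\<close>

definition aff :: "'n \<Rightarrow> 'n::finite proj \<Rightarrow> complex ^ 'n" where
  "aff i q = (\<chi> j. affine_coord i j q)"

lemma aff_eq: "x \<in> hcoords q \<Longrightarrow> aff i q = inverse (x $ i) *s x"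
  by (simp add: aff_def vec_eq_iff affine_coord_eq divide_inverse mult.commute)

lemma aff_hcoords: "q \<in> chart i \<Longrightarrow> aff i q \<in> hcoords q"
  using hcoords_nonempty[of q] by (metis aff_eq chart_iff hcoords_scaleI nonzero_imp_inverse_nonzero)

lemma aff_self: "q \<in> chart i \<Longrightarrow> aff i q $ i = 1"
  using hcoords_nonempty[of q] by (auto simp: aff_eq chart_iff)

lemma aff_scale: "x \<in> hcoords q \<Longrightarrow> q \<in> chart i \<Longrightarrow> x = x $ i *s aff i q"
  by (simp add: aff_eq chart_iff)

text \<open>
  A derivation that kills the affine coordinates kills every polynomial in them.  A regular function is
  locally a quotient \<open>F/G\<close> of two such polynomials, and applying the derivation to \<open>f G = F\<close> gives
  \<open>G(p) D(f) = 0\<close> with \<open>G(p) \<noteq> 0\<close>.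
\<close>

lemma tangent_zeroI:
  assumes D: "D \<in> tangent_space p" and p: "p \<in> chart i"
    and coords: "\<And>j. j \<noteq> i \<Longrightarrow> D (affine_coord i j) = 0"
  shows "D f = 0"
proof (cases "regular_at p f")
  case False
  then show ?thesis by (rule tangent_non_regular[OF D])
next
  case f: True
  note atI = regular_atI[OF zariski_open_chart p]
  have D_coord: "D (affine_coord i j) = 0" for j
  proof (cases "j = i")
    case True
    have "D (affine_coord i i) = D (\<lambda>q. 1)"
    proof (rule tangent_germ[OF D zariski_open_chart p])
      show "affine_coord i i q = 1" if "q \<in> chart i" for q
        using aff_self[OF that] by (simp add: aff_def)
    qed (rule atI[OF affine_coord_regular] regular_at_const)+
    then show ?thesis using True by (simp add: tangent_const[OF D])
  qed (rule coords)
  have poly: "regular_on (chart i) (\<lambda>q. peval F (aff i q)) \<and> D (\<lambda>q. peval F (aff i q)) = 0" for F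
  proof (induction F rule: mpoly_induct)
    case (const c)
    show ?case by (simp add: tangent_const[OF D] regular_on_const zariski_open_chart)
  next
    case (var j)
    show ?case
      by (simp add: aff_def D_coord affine_coord_regular del: One_nat_def)
  next
    case (add F G)
    then show ?case
      by (simp add: peval_add regular_on_add tangent_add[OF D atI atI])
  next
    case (mult F G)
    then show ?case
      by (simp add: peval_mult regular_on_mult tangent_mult[OF D atI atI])
  qed
  obtain U where U: "p \<in> U" "regular_on U f" using f unfolding regular_at_def by blast
  obtain V d F G where V: "zariski_open V" "p \<in> V" "F \<in> homogeneous d" "G \<in> homogeneous d"
    "\<And>q x. q \<in> V \<Longrightarrow> x \<in> hcoords q \<Longrightarrow> peval G x \<noteq> 0"
    "\<And>q x. q \<in> V \<Longrightarrow> x \<in> hcoords q \<Longrightarrow> f q = peval F x / peval G x"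
    by (rule regular_onE[OF U(2,1)]) (rule that)
  have G: "regular_at p (\<lambda>q. peval G (aff i q))" and F: "regular_at p (\<lambda>q. peval F (aff i q))"
    using poly by (auto intro: atI)
  have "D (\<lambda>q. f q * peval G (aff i q)) = D (\<lambda>q. peval F (aff i q))"
  proof (rule tangent_germ[OF D zariski_open_Int[OF V(1) zariski_open_chart] _ regular_at_mult[OF f G] F])
    show "p \<in> V \<inter> chart i" using V p by blast
    fix q
    assume "q \<in> V \<inter> chart i"
    then show "f q * peval G (aff i q) = peval F (aff i q)"
      using V(5,6) aff_hcoords[of q i] by auto
  qed
  then have "f p * D (\<lambda>q. peval G (aff i q)) + peval G (aff i p) * D f = 0"
    using poly tangent_mult[OF D f G] by simp
  then show ?thesis using poly[of G] V(5)[OF V(2) aff_hcoords[OF p]] by simp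
qed

subsection \<open>Coordinate derivations\<close>

lemma DERIV_peval:
  "((\<lambda>t. peval F (x + t *s axis k 1)) has_field_derivative peval (partial_deriv k F) x) (at 0)"
proof (induction F rule: mpoly_induct)
  case (const c)
  show ?case by simp
next
  case (var i)
  have "((\<lambda>t. x $ i + t * (if i = k then 1 else 0)) has_field_derivative (if i = k then 1 else 0)) (at 0)"
    by (auto intro!: derivative_eq_intros)
  then show ?case by (auto simp: pderiv_Var axis_def simp del: One_nat_def cong: if_cong)
next
  case (add F G)
  then show ?case by (simp add: peval_add pderiv_add DERIV_add)
next
  case (mult F G)
  then show ?case using DERIV_mult[OF mult] by (simp add: peval_mult pderiv_mult peval_add algebra_simps)
qed

text \<open>
  Polynomials are continuous, so a Zariski neighbourhood of \<open>p\<close> contains the points of a line through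
  \<open>x\<close> for small values of the parameter.  Hence complex derivatives at \<open>0\<close> depend only on germs.
\<close>

lemma eventually_line_in:
  assumes U: "zariski_open U" "p \<in> U" and x: "x \<in> hcoords p"
  shows "\<forall>\<^sub>F t in nhds 0. x + t *s axis k 1 \<in> hcoords (proj_of (x + t *s axis k 1)) \<and>
    proj_of (x + t *s axis k 1) \<in> U"
proof -
  obtain d H where H: "H \<in> homogeneous d" "p \<in> basic_open H" "basic_open H \<subseteq> U"
    using zariski_open_basis[OF U] by blast
  \<comment> \<open>The extra factor \<open>X\<^sub>i\<close> keeps the points of the line away from the origin.\<close>
  obtain i where i: "x $ i \<noteq> 0" using hcoords_nz[OF x] by (auto simp: vec_eq_iff)
  let ?f = "\<lambda>t. peval (H * Var i) (x + t *s axis k 1)"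
  have f0: "?f 0 \<noteq> 0" using i H(2) basic_open_iff[OF H(1) x] by (simp add: peval_mult del: One_nat_def)
  have "isCont ?f 0" using DERIV_peval by (rule DERIV_isCont)
  then have "\<forall>\<^sub>F t in at 0. ?f t \<noteq> 0"
    unfolding isCont_def by (rule tendsto_imp_eventually_ne) (rule f0)
  then have "\<forall>\<^sub>F t in nhds 0. ?f t \<noteq> 0"
    unfolding eventually_nhds_conv_at using f0 by blast
  then show ?thesis
  proof (rule eventually_mono)
    fix t
    let ?y = "x + t *s axis k 1"
    assume "?f t \<noteq> 0"
    then have y: "peval H ?y \<noteq> 0" "?y $ i \<noteq> 0" by (auto simp: peval_mult simp del: One_nat_def)
    then have "?y \<noteq> 0" by (metis zero_index)
    then have hc: "?y \<in> hcoords (proj_of ?y)" by (rule hcoords_proj_of)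
    then show "?y \<in> hcoords (proj_of ?y) \<and> proj_of ?y \<in> U"
      using y(1) H(3) basic_open_iff[OF H(1) hc] by blast
  qed
qed

text \<open>
  The partial derivative \<open>\<partial>/\<partial>X\<^sub>k\<close> at the vector \<open>x\<close> of a function on projective space, pulled back to affine
  space.  Defining it as an analytic derivative makes its independence of the presentation of \<open>f\<close> as a
  quotient, and the rules for sums and products, immediate.  The value \<open>0\<close> at functions that are not
  regular is the one that \<^const>\<open>tangent_space\<close> prescribes.
\<close>

definition coord_deriv :: "complex ^ 'n \<Rightarrow> 'n \<Rightarrow> ('n::finite proj \<Rightarrow> complex) \<Rightarrow> complex" where
  "coord_deriv x k f =
     (if regular_at (proj_of x) f then deriv (\<lambda>t. f (proj_of (x + t *s axis k 1))) 0 else 0)"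

lemma
  assumes x: "x \<in> hcoords p" and V: "zariski_open V" "p \<in> V" "F \<in> homogeneous d" "G \<in> homogeneous d"
    "\<And>q x. q \<in> V \<Longrightarrow> x \<in> hcoords q \<Longrightarrow> peval G x \<noteq> 0"
    "\<And>q x. q \<in> V \<Longrightarrow> x \<in> hcoords q \<Longrightarrow> f q = peval F x / peval G x"
  shows DERIV_coord_quotient: "((\<lambda>t. f (proj_of (x + t *s axis k 1))) has_field_derivative
      (peval (partial_deriv k F) x * peval G x - peval F x * peval (partial_deriv k G) x) / (peval G x)\<^sup>2) (at 0)"
    and coord_deriv_quotient: "coord_deriv x k f =
      (peval (partial_deriv k F) x * peval G x - peval F x * peval (partial_deriv k G) x) / (peval G x)\<^sup>2"
proof -
  let ?y = "\<lambda>t. x + t *s axis k 1"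
  have "((\<lambda>t. peval F (?y t) / peval G (?y t)) has_field_derivative
      (peval (partial_deriv k F) x * peval G x - peval F x * peval (partial_deriv k G) x) / (peval G x)\<^sup>2) (at 0)"
    using DERIV_divide[OF DERIV_peval[of F x k] DERIV_peval[of G x k]] V(5)[OF V(2) x]
    by (simp add: power2_eq_square)
  moreover have "\<forall>\<^sub>F t in nhds 0. f (proj_of (?y t)) = peval F (?y t) / peval G (?y t)"
    by (rule eventually_mono[OF eventually_line_in[OF V(1,2) x, of k]]) (use V(6) in blast)
  ultimately show D: "((\<lambda>t. f (proj_of (?y t))) has_field_derivative
      (peval (partial_deriv k F) x * peval G x - peval F x * peval (partial_deriv k G) x) / (peval G x)\<^sup>2) (at 0)"
    by (subst DERIV_cong_ev) auto
  have "regular_on V f" by (rule regular_onI[OF V(1,3,4)]) (use V(5,6) in blast)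
  then have "regular_at p f" using V(1,2) by (rule regular_atI[rotated 2])
  then show "coord_deriv x k f =
      (peval (partial_deriv k F) x * peval G x - peval F x * peval (partial_deriv k G) x) / (peval G x)\<^sup>2"
    by (simp add: coord_deriv_def proj_of_hcoords[OF x] DERIV_imp_deriv[OF D])
qed

lemma DERIV_coord_deriv:
  assumes x: "x \<in> hcoords p" and f: "regular_at p f"
  shows "((\<lambda>t. f (proj_of (x + t *s axis k 1))) has_field_derivative coord_deriv x k f) (at 0)"
proof -
  obtain U where U: "p \<in> U" "regular_on U f" using f unfolding regular_at_def by blast
  obtain V d F G where V: "zariski_open V" "p \<in> V" "F \<in> homogeneous d" "G \<in> homogeneous d"
    "\<And>q x. q \<in> V \<Longrightarrow> x \<in> hcoords q \<Longrightarrow> peval G x \<noteq> 0"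
    "\<And>q x. q \<in> V \<Longrightarrow> x \<in> hcoords q \<Longrightarrow> f q = peval F x / peval G x"
    by (rule regular_onE[OF U(2,1)]) (rule that)
  have "coord_deriv x k f = (peval (partial_deriv k F) x * peval G x
      - peval F x * peval (partial_deriv k G) x) / (peval G x)\<^sup>2"
    by (rule coord_deriv_quotient[OF x V])
  moreover have "((\<lambda>t. f (proj_of (x + t *s axis k 1))) has_field_derivative
      (peval (partial_deriv k F) x * peval G x - peval F x * peval (partial_deriv k G) x) / (peval G x)\<^sup>2) (at 0)"
    by (rule DERIV_coord_quotient[OF x V])
  ultimately show ?thesis by (simp only:)
qed

lemma coord_deriv_tangent:
  assumes x: "x \<in> hcoords p"
  shows "coord_deriv x k \<in> tangent_space p"
proof (rule tangentI)
  have unique: "coord_deriv x k f = d"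
    if "regular_at p f" "((\<lambda>t. f (proj_of (x + t *s axis k 1))) has_field_derivative d) (at 0)" for f d
    using DERIV_coord_deriv[OF x that(1)] that(2) by (rule DERIV_unique)
  show "coord_deriv x k f = 0" if "\<not> regular_at p f" for f
    using that by (simp add: coord_deriv_def proj_of_hcoords[OF x])
  show "coord_deriv x k f = coord_deriv x k g"
    if "zariski_open U" "p \<in> U" "regular_at p f" "regular_at p g" "\<And>q. q \<in> U \<Longrightarrow> f q = g q" for U f g
  proof (rule unique[OF that(3)])
    have "\<forall>\<^sub>F t in nhds 0. f (proj_of (x + t *s axis k 1)) = g (proj_of (x + t *s axis k 1))"
      by (rule eventually_mono[OF eventually_line_in[OF that(1,2) x, of k]]) (use that(5) in blast)
    then show "((\<lambda>t. f (proj_of (x + t *s axis k 1))) has_field_derivative coord_deriv x k g) (at 0)"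
      using DERIV_coord_deriv[OF x that(4), of k] by (subst DERIV_cong_ev) auto
  qed
  show "coord_deriv x k (\<lambda>q. f q + g q) = coord_deriv x k f + coord_deriv x k g"
    if "regular_at p f" "regular_at p g" for f g
    by (intro unique regular_at_add that DERIV_add DERIV_coord_deriv[OF x])
  show "coord_deriv x k (\<lambda>q. c * f q) = c * coord_deriv x k f" if "regular_at p f" for c f
    by (intro unique regular_at_mult regular_at_const that DERIV_cmult DERIV_coord_deriv[OF x])
  show "coord_deriv x k (\<lambda>q. f q * g q) = f p * coord_deriv x k g + g p * coord_deriv x k f"
    if "regular_at p f" "regular_at p g" for f g
  proof (rule unique[OF regular_at_mult[OF that]])
    show "((\<lambda>t. f (proj_of (x + t *s axis k 1)) * g (proj_of (x + t *s axis k 1))) has_field_derivative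
        f p * coord_deriv x k g + g p * coord_deriv x k f) (at 0)"
      using DERIV_mult[OF DERIV_coord_deriv[OF x that(1)] DERIV_coord_deriv[OF x that(2)], of k k]
      by (simp add: proj_of_hcoords[OF x] algebra_simps)
  qed
qed

lemma coord_deriv_affine:
  assumes x: "x \<in> hcoords q" and q: "q \<in> chart i"
  shows "coord_deriv x k (affine_coord i j) =
    ((if k = j then 1 else 0) * x $ i - x $ j * (if k = i then 1 else 0)) / (x $ i)\<^sup>2"
  by (subst coord_deriv_quotient[OF x zariski_open_chart q Var_homogeneous[of j] Var_homogeneous[of i]])
    (auto simp: affine_coord_eq chart_iff pderiv_Var simp del: One_nat_def)

text \<open>
  The difference of the two sides kills the affine coordinates, because \<open>\<partial>/\<partial>X\<^sub>j\<close> at the normalized vector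
  is dual to the coordinate \<open>X\<^sub>k/X\<^sub>i\<close>.  So the tangent space has dimension \<open>N\<close>, with the partial derivatives
  for \<open>j \<noteq> i\<close> as a basis.
\<close>

lemma tangent_expand:
  assumes D: "D \<in> tangent_space q" and q: "q \<in> chart i"
  shows "D = (\<Sum>j\<in>-{i}. D (affine_coord i j) *\<^sub>C coord_deriv (aff i q) j)" (is "D = ?S")
proof
  fix f
  note x = aff_hcoords[OF q]
  have S: "?S \<in> tangent_space q"
    by (intro complex_vector.subspace_sum complex_vector.subspace_scale tangent_subspace
        coord_deriv_tangent[OF x])
  have "(D - ?S) f = 0"
  proof (rule tangent_zeroI[OF complex_vector.subspace_diff[OF tangent_subspace D S] q])
    fix j
    assume j: "j \<noteq> i"
    have "?S (affine_coord i j) = (\<Sum>k\<in>-{i}. if k = j then D (affine_coord i k) else 0)"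
      unfolding sum_fun_apply
      by (intro sum.cong) (auto simp: coord_deriv_affine[OF x q] aff_self[OF q])
    with j show "(D - ?S) (affine_coord i j) = 0" by simp
  qed
  then show "D f = ?S f" by simp
qed

subsection \<open>The frame of differentials of affine coordinates\<close>

lemma
  assumes "\<omega> \<in> cotangent_space p"
  shows cotangent_outside: "D \<notin> tangent_space p \<Longrightarrow> \<omega> D = 0"
    and cotangent_add: "D \<in> tangent_space p \<Longrightarrow> D' \<in> tangent_space p \<Longrightarrow> \<omega> (D + D') = \<omega> D + \<omega> D'"
    and cotangent_scale: "D \<in> tangent_space p \<Longrightarrow> \<omega> (c *\<^sub>C D) = c * \<omega> D"
proof -
  note \<omega> = assms[unfolded cotangent_space_def mem_Collect_eq]
  show "D \<notin> tangent_space p \<Longrightarrow> \<omega> D = 0"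
    by (rule \<omega>[THEN conjunct1, rule_format])
  show "D \<in> tangent_space p \<Longrightarrow> D' \<in> tangent_space p \<Longrightarrow> \<omega> (D + D') = \<omega> D + \<omega> D'"
    by (rule \<omega>[THEN conjunct2, THEN conjunct1, rule_format])
  show "D \<in> tangent_space p \<Longrightarrow> \<omega> (c *\<^sub>C D) = c * \<omega> D"
    by (rule \<omega>[THEN conjunct2, THEN conjunct2, rule_format])
qed

lemma cotangent_comb:
  assumes \<omega>: "\<omega> \<in> cotangent_space p" and "\<And>j. j \<in> J \<Longrightarrow> D j \<in> tangent_space p"
  shows "\<omega> (\<Sum>j\<in>J. c j *\<^sub>C D j) = (\<Sum>j\<in>J. c j * \<omega> (D j))"
  using assms(2)
proof (induction J rule: infinite_finite_induct)
  case (insert j J)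
  have "(\<Sum>j\<in>J. c j *\<^sub>C D j) \<in> tangent_space p" "c j *\<^sub>C D j \<in> tangent_space p"
    using insert.prems
    by (auto intro!: complex_vector.subspace_sum complex_vector.subspace_scale tangent_subspace)
  then have "\<omega> (c j *\<^sub>C D j + (\<Sum>j\<in>J. c j *\<^sub>C D j)) = \<omega> (c j *\<^sub>C D j) + \<omega> (\<Sum>j\<in>J. c j *\<^sub>C D j)"
    by (intro cotangent_add[OF \<omega>])
  also have "\<omega> (c j *\<^sub>C D j) = c j * \<omega> (D j)"
    using insert.prems by (intro cotangent_scale[OF \<omega>]) simp
  also have "\<omega> (\<Sum>j\<in>J. c j *\<^sub>C D j) = (\<Sum>j\<in>J. c j * \<omega> (D j))"
    using insert.prems by (intro insert.IH) simp
  finally show ?case by (simp only: sum.insert[OF insert.hyps])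
qed (use cotangent_scale[OF \<omega> complex_vector.subspace_0[OF tangent_subspace], of 0] in simp_all)

lemma cotangent_subspace: "complex_vector.subspace (cotangent_space p)"
  by (rule complex_vector.subspaceI) (auto simp: cotangent_space_def algebra_simps)

lemma differential_cotangent: "differential f p \<in> cotangent_space p"
  by (simp add: cotangent_space_def differential_def complex_vector.subspace_add[OF tangent_subspace]
      complex_vector.subspace_scale[OF tangent_subspace])

lemma differential_coord:
  assumes "q \<in> chart i" "j \<noteq> i" "k \<noteq> i"
  shows "differential (affine_coord i k) q (coord_deriv (aff i q) j) = (if j = k then 1 else 0)"
  using assms coord_deriv_tangent[OF aff_hcoords[OF assms(1)]]
  by (auto simp: differential_def coord_deriv_affine[OF aff_hcoords] aff_self)

lemma cotangent_expand:
  assumes \<omega>: "\<omega> \<in> cotangent_space q" and q: "q \<in> chart i"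
  shows "\<omega> = (\<Sum>j\<in>-{i}. \<omega> (coord_deriv (aff i q) j) *\<^sub>C differential (affine_coord i j) q)"
proof
  fix D
  show "\<omega> D = (\<Sum>j\<in>-{i}. \<omega> (coord_deriv (aff i q) j) *\<^sub>C differential (affine_coord i j) q) D"
  proof (cases "D \<in> tangent_space q")
    case True
    have "\<omega> D = \<omega> (\<Sum>j\<in>-{i}. D (affine_coord i j) *\<^sub>C coord_deriv (aff i q) j)"
      using tangent_expand[OF True q] by (rule arg_cong)
    also have "\<dots> = (\<Sum>j\<in>-{i}. D (affine_coord i j) * \<omega> (coord_deriv (aff i q) j))"
      by (rule cotangent_comb[OF \<omega> coord_deriv_tangent[OF aff_hcoords[OF q]]])
    finally show ?thesis using True by (simp add: sum_fun_apply differential_def mult.commute)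
  next
    case False
    then show ?thesis using cotangent_outside[OF \<omega>] by (simp add: sum_fun_apply differential_def)
  qed
qed

text \<open>
  For \<open>f = F/G\<close> the quotient rule gives \<open>(\<partial>F G - F \<partial>G)/G\<^sup>2\<close>, evaluated at the vector with \<open>x\<^sub>i = 1\<close>.  The
  numerator has degree one less than the denominator; multiplying it by \<open>X\<^sub>i\<close> gives a quotient of forms of
  equal degree, with the same value at that vector.
\<close>

lemma coord_deriv_regular:
  assumes f: "regular_on V f" and V: "zariski_open V" "V \<subseteq> chart i"
  shows "regular_on V (\<lambda>q. coord_deriv (aff i q) k f)"
proof (rule regular_on_local)
  fix p
  assume p: "p \<in> V"
  obtain W d F G where W: "zariski_open W" "p \<in> W" "W \<subseteq> V" "F \<in> homogeneous d" "G \<in> homogeneous d"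
    "\<And>q x. q \<in> W \<Longrightarrow> x \<in> hcoords q \<Longrightarrow> peval G x \<noteq> 0"
    "\<And>q x. q \<in> W \<Longrightarrow> x \<in> hcoords q \<Longrightarrow> f q = peval F x / peval G x"
    by (rule regular_onE[OF f p]) (rule that)
  let ?N = "Var i * partial_deriv k F * G - F * (Var i * partial_deriv k G)"
  have hom: "?N \<in> homogeneous (d + d)" "G * G \<in> homogeneous (d + d)"
    by (intro complex_vector.subspace_diff homogeneous_subspace homogeneous_mult Var_pderiv_homogeneous W)+
  have "regular_on W (\<lambda>q. coord_deriv (aff i q) k f)"
  proof (rule regular_onI[OF W(1) hom])
    fix q x
    assume q: "q \<in> W" and x: "x \<in> hcoords q"
    have qi: "q \<in> chart i" using q W(3) V(2) by blast
    have xi: "x $ i \<noteq> 0" using qi x chart_iff by blast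
    note a = aff_hcoords[OF qi]
    have "coord_deriv (aff i q) k f = peval ?N (aff i q) / peval (G * G) (aff i q)"
      by (subst coord_deriv_quotient[OF a W(1) q W(4-7)])
        (auto simp: peval_diff peval_mult aff_self[OF qi] power2_eq_square simp del: One_nat_def)
    also have "\<dots> = peval ?N x / peval (G * G) x"
    proof -
      have "peval ?N x = (x $ i) ^ (d + d) * peval ?N (aff i q)"
        "peval (G * G) x = (x $ i) ^ (d + d) * peval (G * G) (aff i q)"
        using aff_scale[OF x qi] peval_homogeneous[OF hom(1), of "x $ i" "aff i q"]
          peval_homogeneous[OF hom(2), of "x $ i" "aff i q"] by metis+
      then show ?thesis using xi by (simp del: One_nat_def)
    qed
    finally show "peval (G * G) x \<noteq> 0 \<and> coord_deriv (aff i q) k f = peval ?N x / peval (G * G) x"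
      using W(6)[OF q x] by (simp add: peval_mult)
  qed
  with W(1-3) show "\<exists>W. zariski_open W \<and> p \<in> W \<and> W \<subseteq> V \<and> regular_on W (\<lambda>q. coord_deriv (aff i q) k f)"
    by blast
qed

definition cotangent_local where
  "cotangent_local V s \<longleftrightarrow> (\<exists>(r::nat) g f. (\<forall>i<r. regular_on V (g i) \<and> regular_on V (f i)) \<and>
        (\<forall>q\<in>V. s q = (\<Sum>i<r. g i q *\<^sub>C differential (f i) q)))"

lemma cotangent_sections:
  "sections cotangent_bundle U =
     {s. \<forall>p\<in>U. \<exists>V. zariski_open V \<and> p \<in> V \<and> V \<subseteq> U \<and> cotangent_local V s}"
  unfolding cotangent_bundle_def cotangent_local_def by (simp; blast)

lemma cotangent_restricts: "restricts cotangent_bundle"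
proof (rule restrictsI[OF cotangent_sections])
  fix V W :: "'a proj set" and s
  assume W: "zariski_open W" "W \<subseteq> V" and "cotangent_local V s"
  then obtain r :: nat and g f where g: "\<And>i. i < r \<Longrightarrow> regular_on V (g i)" "\<And>i. i < r \<Longrightarrow> regular_on V (f i)"
    "\<And>q. q \<in> V \<Longrightarrow> s q = (\<Sum>i<r. g i q *\<^sub>C differential (f i) q)" unfolding cotangent_local_def by blast
  show "cotangent_local W s"
    unfolding cotangent_local_def
  proof (intro exI conjI allI ballI impI)
    show "regular_on W (g i)" "regular_on W (f i)" if "i < r" for i
      using regular_on_subset[OF g(1) W] regular_on_subset[OF g(2) W] that by blast+
    show "s q = (\<Sum>i<r. g i q *\<^sub>C differential (f i) q)" if "q \<in> W" for q using g(3) that W by auto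
  qed
qed

text \<open>
  The differentials of the affine coordinates are dual to the partial derivatives, which span the
  tangent space.  The coefficients of \<open>df\<close> are partial derivatives of \<open>f\<close>, which are regular.
\<close>

lemma cotangent_frame:
  "frame cotangent_bundle (chart i) (- {i}) (\<lambda>j. differential (affine_coord i j))"
proof (rule frameI)
  fix q
  assume q: "q \<in> chart i"
  let ?e = "\<lambda>j. differential (affine_coord i j) q"
  show "indep_family (- {i}) ?e"
    unfolding indep_family_def
  proof (intro allI impI ballI)
    fix c j
    assume 0: "(\<Sum>j\<in>-{i}. c j *\<^sub>C ?e j) = 0" and j: "j \<in> - {i}"
    have "(\<Sum>k\<in>-{i}. c k *\<^sub>C ?e k) (coord_deriv (aff i q) j) = (\<Sum>k\<in>-{i}. if k = j then c k else 0)"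
      unfolding sum_fun_apply
      by (intro sum.cong) (use j in \<open>auto simp: differential_coord[OF q]\<close>)
    with j show "c j = 0" by (simp add: 0)
  qed
  show "fibre cotangent_bundle q = {\<Sum>j\<in>-{i}. c j *\<^sub>C ?e j | c. True}"
    unfolding cotangent_bundle_def vbundle.simps
  proof (intro set_eqI iffI)
    fix \<omega>
    assume "\<omega> \<in> cotangent_space q"
    from cotangent_expand[OF this q] show "\<omega> \<in> {\<Sum>j\<in>-{i}. c j *\<^sub>C ?e j | c. True}"
      by (intro CollectI exI[of _ "\<lambda>j. \<omega> (coord_deriv (aff i q) j)"]) simp
  next
    fix \<omega>
    assume "\<omega> \<in> {\<Sum>j\<in>-{i}. c j *\<^sub>C ?e j | c. True}"
    then obtain c where "\<omega> = (\<Sum>j\<in>-{i}. c j *\<^sub>C ?e j)" by blast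
    then show "\<omega> \<in> cotangent_space q"
      by (auto intro!: complex_vector.subspace_sum complex_vector.subspace_scale cotangent_subspace
          differential_cotangent)
  qed
next
  fix V s
  assume V: "zariski_open V" "V \<subseteq> chart i"
    and s: "reg_comb V (- {i}) (\<lambda>j. differential (affine_coord i j)) s"
  obtain g where g: "\<And>j. j \<in> - {i} \<Longrightarrow> regular_on V (g j)"
    "\<And>q. q \<in> V \<Longrightarrow> s q = (\<Sum>j\<in>-{i}. g j q *\<^sub>C differential (affine_coord i j) q)"
    by (rule reg_combE[OF s]) (rule that)
  obtain h where h: "\<And>l. l < card (- {i}) \<Longrightarrow> h l \<in> - {i}"
    "\<And>f :: _ \<Rightarrow> (('a proj \<Rightarrow> complex) \<Rightarrow> complex) \<Rightarrow> complex. (\<Sum>l<card (- {i}). f (h l)) = (\<Sum>j\<in>-{i}. f j)"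
    by (rule sum_enumerate[of "- {i}"]) (simp, rule that)
  have "cotangent_local V s"
    unfolding cotangent_local_def
  proof (intro exI conjI allI ballI impI)
    fix l
    assume l: "l < card (- {i})"
    show "regular_on V (g (h l))" by (rule g(1)[OF h(1)[OF l]])
    show "regular_on V (affine_coord i (h l))" by (rule regular_on_subset[OF affine_coord_regular V])
  next
    fix q
    assume "q \<in> V"
    then show "s q = (\<Sum>l<card (- {i}). g (h l) q *\<^sub>C differential (affine_coord i (h l)) q)"
      by (simp only: g(2) h(2)[of "\<lambda>j. g j q *\<^sub>C differential (affine_coord i j) q"])
  qed
  then show "s \<in> sections cotangent_bundle V"
    unfolding cotangent_sections using V by blast
next
  fix V s p
  assume V: "zariski_open V" "V \<subseteq> chart i" and s: "s \<in> sections cotangent_bundle V" and p: "p \<in> V"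
  obtain W where W: "zariski_open W" "p \<in> W" "W \<subseteq> V" "cotangent_local W s"
    using s p unfolding cotangent_sections by blast
  then have Wi: "W \<subseteq> chart i" using V by blast
  obtain r :: nat and g f where g: "\<And>l. l < r \<Longrightarrow> regular_on W (g l)" "\<And>l. l < r \<Longrightarrow> regular_on W (f l)"
    "\<And>q. q \<in> W \<Longrightarrow> s q = (\<Sum>l<r. g l q *\<^sub>C differential (f l) q)"
    using W(4) unfolding cotangent_local_def by blast
  have "reg_comb W (- {i}) (\<lambda>j. differential (affine_coord i j)) (differential (f l))" if l: "l < r" for l
    unfolding reg_comb_def
  proof (intro exI conjI ballI)
    show "regular_on W (\<lambda>q. coord_deriv (aff i q) j (f l))" for j
      by (rule coord_deriv_regular[OF g(2)[OF l] W(1) Wi])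
    fix q
    assume "q \<in> W"
    then have q: "q \<in> chart i" using Wi by blast
    have "differential (f l) q (coord_deriv (aff i q) j) = coord_deriv (aff i q) j (f l)" for j
      using coord_deriv_tangent[OF aff_hcoords[OF q]] by (simp add: differential_def)
    then show "differential (f l) q =
        (\<Sum>j\<in>-{i}. coord_deriv (aff i q) j (f l) *\<^sub>C differential (affine_coord i j) q)"
      using cotangent_expand[OF differential_cotangent q, of "f l"] by simp
  qed
  then have "reg_comb W (- {i}) (\<lambda>j. differential (affine_coord i j))
      (\<lambda>q. \<Sum>l<r. g l q *\<^sub>C differential (f l) q)"
    by (intro reg_comb_sum reg_comb_scale W(1) g(1)) auto
  then have "reg_comb W (- {i}) (\<lambda>j. differential (affine_coord i j)) s"
    by (rule reg_comb_cong) (rule g(3))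
  with W show "\<exists>W. zariski_open W \<and> p \<in> W \<and> W \<subseteq> V \<and>
      reg_comb W (- {i}) (\<lambda>j. differential (affine_coord i j)) s" by blast
qed (simp_all add: zariski_open_chart)

lemma cotangent_dual:
  assumes "q \<in> chart i"
  shows "\<exists>f. (\<forall>j\<in>-{i}. clinear (f j)) \<and>
    (\<forall>j\<in>-{i}. \<forall>k\<in>-{i}. f j (differential (affine_coord i k) q) = (if j = k then 1 else 0 :: complex))"
  by (rule exI[of _ "\<lambda>j \<omega>. \<omega> (coord_deriv (aff i q) j)"])
    (auto intro!: clinearI simp: differential_coord[OF assms])

lemma sym_cotangent_frame:
  "frame (sym_bundle m cotangent_bundle) (chart i) (multisets_of_size (- {i}) m)
     (\<lambda>K q. sym_prod (image_mset (\<lambda>j. differential (affine_coord i j) q) K))"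
  by (rule sym_frame[OF cotangent_frame cotangent_dual])

section \<open>The inclusion of the symmetric power of the cotangent bundle\<close>

text \<open>
  The Euler sequence: a covector at \<open>p\<close>, pulled back to affine space at a vector \<open>x\<close> on the line \<open>p\<close>,
  becomes the linear form \<open>\<Sum>\<^sub>k \<omega>(\<partial>/\<partial>X\<^sub>k) Y\<^sub>k\<close>.
\<close>

definition cotangent_form ::
    "complex ^ 'n \<Rightarrow> ((('n::finite proj \<Rightarrow> complex) \<Rightarrow> complex) \<Rightarrow> complex) \<Rightarrow> 'n mpoly" where
  "cotangent_form x \<omega> = (\<Sum>k\<in>UNIV. \<omega> (coord_deriv x k) *\<^sub>C Var k)"

lemma clinear_cotangent_form: "clinear (cotangent_form x)"
  unfolding cotangent_form_def
  by (rule clinearI)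
    (simp_all add: scaleC_add_left sum.distrib complex_vector.scale_sum_right scaleC_scaleC)

text \<open>
  The quotient rule for \<open>X\<^sub>j/X\<^sub>i\<close>: the differential of this coordinate corresponds to \<open>Z\<^sub>j/x\<^sub>i\<close>.  This holds for any chart
  \<open>i\<close> containing the point and any choice of \<open>x\<close>, so that the inclusion below can be defined with
  arbitrary choices and computed in every chart.
\<close>

lemma cotangent_form_differential:
  assumes x: "x \<in> hcoords q" and q: "q \<in> chart i" and j: "j \<noteq> i"
  shows "cotangent_form x (differential (affine_coord i j) q) = inverse (x $ i) *\<^sub>C shear i (aff i q) j"
proof -
  have xi: "x $ i \<noteq> 0" using x q chart_iff by blast
  let ?a = "inverse (x $ i)" and ?b = "- (inverse (x $ i) * aff i q $ j)"
  have "differential (affine_coord i j) q (coord_deriv x k) = (if k = j then ?a else 0) + (if k = i then ?b else 0)" for k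
    using coord_deriv_tangent[OF x, of k] xi j
    by (auto simp: differential_def coord_deriv_affine[OF x q] aff_eq[OF x] power2_eq_square field_simps)
  then have "cotangent_form x (differential (affine_coord i j) q) =
      (\<Sum>k\<in>UNIV. (if k = j then ?a *\<^sub>C Var k else 0) + (if k = i then ?b *\<^sub>C Var k else 0))"
    unfolding cotangent_form_def
    by (intro sum.cong) (auto simp: scaleC_add_left simp del: One_nat_def)
  also have "\<dots> = ?a *\<^sub>C Var j + ?b *\<^sub>C Var i"
    by (simp add: sum.distrib del: One_nat_def)
  also have "\<dots> = inverse (x $ i) *\<^sub>C shear i (aff i q) j"
    using j by (simp add: shear_def complex_vector.scale_right_diff_distrib
        complex_vector.scale_minus_left scaleC_scaleC del: One_nat_def)
  finally show ?thesis .
qed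

definition coords :: "'n::finite proj \<Rightarrow> complex ^ 'n" where
  "coords p = (SOME x. x \<in> hcoords p)"

definition pivot :: "'n::finite proj \<Rightarrow> 'n" where
  "pivot p = (SOME k. p \<in> chart k)"

lemma coords_hcoords: "coords p \<in> hcoords p"
  unfolding coords_def using hcoords_nonempty by (rule someI_ex)

lemma pivot_chart: "p \<in> chart (pivot p)"
  unfolding pivot_def using chart_cover by (rule someI_ex)

text \<open>
  The inclusion multiplies the linear forms of \<open>m\<close> covectors.  Replacing the vector \<open>x\<close> by \<open>c x\<close> divides this
  product by \<open>c\<^sup>m\<close>, which is why the twist drops from \<open>m + n\<close> to \<open>n\<close>: with \<open>x\<close> fixed to be the chosen vector
  \<^term>\<open>coords p\<close>, a vector \<open>y = c x\<close> on the line satisfies \<open>x\<^sub>k/y\<^sub>k = 1/c\<close> for any \<open>k\<close> with \<open>x\<^sub>k \<noteq> 0\<close>, and the factor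
  \<open>(x\<^sub>k/y\<^sub>k)\<^sup>m\<close> accounts for the change of vector.
\<close>

definition sym_inclusion ::
    "nat \<Rightarrow> 'n::finite proj \<Rightarrow>
     (((('n proj \<Rightarrow> complex) \<Rightarrow> complex) \<Rightarrow> complex) sym, complex ^ 'n \<Rightarrow> complex) tensor \<Rightarrow>
     ('n mpoly, complex ^ 'n \<Rightarrow> complex) tensor" where
  "sym_inclusion m p = tensor_map (sym_lift (cotangent_form (coords p)))
     (\<lambda>s y. s y * (coords p $ pivot p / y $ pivot p) ^ m)"

lemma clinear_rescale: "clinear (\<lambda>(s :: complex ^ 'n \<Rightarrow> complex) y. s y * r y)"
  by (rule clinearI) (simp_all add: fun_eq_iff algebra_simps)

lemma clinear_sym_inclusion: "clinear (sym_inclusion m p)"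
  unfolding sym_inclusion_def
  by (intro tensor_map_linear clinear_sym_lift clinear_cotangent_form clinear_rescale)

lemma prod_mset_scaleC:
  "(\<Prod>j\<in>#K. c *\<^sub>C f j) = c ^ size K *\<^sub>C (\<Prod>j\<in>#K. f j)" for f :: "'i \<Rightarrow> 'n mpoly"
  by (induction K)
    (simp_all add: scaleC_one scaleC_mult_left scaleC_mult_right scaleC_scaleC mult.commute)

text \<open>
  The factor \<open>x\<^sub>i\<^sup>-\<^sup>m\<close> from the \<open>m\<close> linear forms cancels the factor \<open>x\<^sub>i\<^sup>m\<close> by which the rescaled function
  \<open>X\<^sub>i\<^bsup>m+n\<^esup>\<close> differs from \<open>X\<^sub>i\<^sup>n\<close>.  The result no longer depends on the choices of a vector and a pivot.
\<close>

lemma sym_inclusion_frame: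
  assumes q: "q \<in> chart i" and K: "K \<in> multisets_of_size (- {i}) m"
  shows "sym_inclusion m q (sym_prod (image_mset (\<lambda>j. differential (affine_coord i j) q) K) \<otimes>\<^sub>C O_gen (int m + n) i q)
    = (\<Prod>j\<in>#K. shear i (aff i q) j) \<otimes>\<^sub>C O_gen n i q"
proof -
  define x where "x = coords q"
  define k where "k = pivot q"
  have x: "x \<in> hcoords q" and k: "x $ k \<noteq> 0" and xi: "x $ i \<noteq> 0"
    using coords_hcoords pivot_chart[of q] q chart_iff unfolding x_def k_def by blast+
  have "sym_lift (cotangent_form x) (sym_prod (image_mset (\<lambda>j. differential (affine_coord i j) q) K))
      = (\<Prod>j\<in>#K. cotangent_form x (differential (affine_coord i j) q))"
    by (simp add: sym_lift_prod[OF clinear_cotangent_form] multiset.map_comp comp_def)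
  also have "\<dots> = (\<Prod>j\<in>#K. inverse (x $ i) *\<^sub>C shear i (aff i q) j)"
    using K by (intro arg_cong[where f = prod_mset] image_mset_cong cotangent_form_differential[OF x q])
      (auto simp: multisets_of_size_def)
  also have "\<dots> = inverse (x $ i) ^ m *\<^sub>C (\<Prod>j\<in>#K. shear i (aff i q) j)"
    using K by (simp add: prod_mset_scaleC multisets_of_size_def)
  finally have 1: "sym_lift (cotangent_form x) (sym_prod (image_mset (\<lambda>j. differential (affine_coord i j) q) K))
      = inverse (x $ i) ^ m *\<^sub>C (\<Prod>j\<in>#K. shear i (aff i q) j)" .
  have 2: "(\<lambda>y. O_gen (int m + n) i q y * (x $ k / y $ k) ^ m) = x $ i ^ m *\<^sub>C O_gen n i q"
  proof
    fix y
    show "O_gen (int m + n) i q y * (x $ k / y $ k) ^ m = (x $ i ^ m *\<^sub>C O_gen n i q) y"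
    proof (cases "y \<in> hcoords q")
      case True
      then obtain c where c: "c \<noteq> 0" "y = c *s x" using hcoords_scale[OF x] by blast
      have "(c * x $ i) powi (int m + n) = (c * x $ i) ^ m * (c * x $ i) powi n"
        using c xi by (simp add: power_int_add)
      then show ?thesis using True c k
        by (simp add: O_gen_def power_mult_distrib power_divide)
    qed (simp add: O_gen_def)
  qed
  show ?thesis
    unfolding sym_inclusion_def x_def[symmetric] k_def[symmetric]
      tensor_map_pure[OF clinear_sym_lift[OF clinear_cotangent_form] clinear_rescale] 1 2
    using xi by (simp add: pure_tensor_scaleC_left pure_tensor_scaleC_right scaleC_scaleC scaleC_one
        flip: power_mult_distrib)
qed

section \<open>The map \<open>\<delta>\<close> in a chart\<close>

lemma clinear_delta: "clinear delta"
proof -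
  have "clinear (\<lambda>(s :: complex ^ 'a \<Rightarrow> complex) x. x $ i * s x)" for i
    by (rule clinearI) (simp_all add: fun_eq_iff algebra_simps)
  then show ?thesis
    unfolding delta_def[abs_def]
    by (intro clinear_sum_fun tensor_map_linear partial_deriv_linear)
qed

text \<open>
  On the line \<open>q\<close> the function \<open>X\<^sub>k\<close> is the multiple \<open>u\<^sub>k X\<^sub>i\<close> of \<open>X\<^sub>i\<close>, where \<open>u\<close> is the normalized vector.
\<close>

lemma delta_frame:
  assumes q: "q \<in> chart i"
  shows "delta (F \<otimes>\<^sub>C O_gen n i q) = dir_deriv (aff i q) F \<otimes>\<^sub>C O_gen (n + 1) i q"
proof -
  have "(\<lambda>x. x $ k * O_gen n i q x) = aff i q $ k *\<^sub>C O_gen (n + 1) i q" for k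
  proof
    fix x
    show "x $ k * O_gen n i q x = (aff i q $ k *\<^sub>C O_gen (n + 1) i q) x"
    proof (cases "x \<in> hcoords q")
      case True
      then have "x $ i \<noteq> 0" using q chart_iff by blast
      with True show ?thesis by (simp add: O_gen_def aff_eq power_int_add)
    qed (simp add: O_gen_def)
  qed
  then show ?thesis
    by (simp add: delta_pure dir_deriv_def clinear_sum[OF clinear_pure_left]
        pure_tensor_scaleC_left pure_tensor_scaleC_right)
qed

lemma reg_comb_form:
  fixes F :: "'n::finite mpoly"
  assumes "zariski_open V" "F \<in> homogeneous d"
  shows "reg_comb V (multisets_of_size UNIV d) (\<lambda>K q. mon K) (\<lambda>q. F)"
  unfolding reg_comb_def
proof (intro exI conjI ballI)
  show "F = (\<Sum>K\<in>multisets_of_size UNIV d. Poly_Mapping.lookup F (expo K) *\<^sub>C mon K)"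
    by (rule homogeneous_expand[OF assms(2)])
qed (rule regular_on_const[OF assms(1)])

lemma reg_comb_dir_deriv:
  assumes "F \<in> homogeneous (Suc d)"
  shows "reg_comb (chart i) (multisets_of_size UNIV d) (\<lambda>K q. mon K) (\<lambda>q. dir_deriv (aff i q) F)"
  unfolding dir_deriv_def aff_def vec_lambda_beta
  by (intro reg_comb_sum reg_comb_scale reg_comb_form zariski_open_chart affine_coord_regular
      pderiv_homogeneous assms)

lemma reg_comb_form_mult:
  fixes s t :: "'n::finite proj \<Rightarrow> 'n mpoly"
  assumes V: "zariski_open V"
    and "reg_comb V (multisets_of_size UNIV d) (\<lambda>K q. mon K) s"
    and "reg_comb V (multisets_of_size UNIV e) (\<lambda>K q. mon K) t"
  shows "reg_comb V (multisets_of_size UNIV (d + e)) (\<lambda>K q. mon K) (\<lambda>q. s q * t q)"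
proof -
  obtain g where g: "\<And>K. K \<in> multisets_of_size UNIV d \<Longrightarrow> regular_on V (g K)"
    "\<And>q. q \<in> V \<Longrightarrow> s q = (\<Sum>K\<in>multisets_of_size UNIV d. g K q *\<^sub>C mon K)"
    by (rule reg_combE[OF assms(2)]) (rule that)
  obtain h where h: "\<And>K. K \<in> multisets_of_size UNIV e \<Longrightarrow> regular_on V (h K)"
    "\<And>q. q \<in> V \<Longrightarrow> t q = (\<Sum>K\<in>multisets_of_size UNIV e. h K q *\<^sub>C mon K)"
    by (rule reg_combE[OF assms(3)]) (rule that)
  have "reg_comb V (multisets_of_size UNIV (d + e)) (\<lambda>K q. mon K)
    (\<lambda>q. \<Sum>K\<in>multisets_of_size UNIV d. \<Sum>L\<in>multisets_of_size UNIV e.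
      g K q *\<^sub>C h L q *\<^sub>C (mon K * mon L :: 'n mpoly))"
    by (intro reg_comb_sum reg_comb_scale V g h reg_comb_form homogeneous_mult)
      (auto simp: mon_homogeneous multisets_of_size_def)
  then show ?thesis
    by (rule reg_comb_cong)
      (simp add: g(2) h(2) sum_product scaleC_mult_left scaleC_mult_right scaleC_scaleC mult.commute)
qed

text \<open>
  The coefficients of \<open>Z\<^sub>j = Y\<^sub>j - (X\<^sub>j/X\<^sub>i) Y\<^sub>i\<close> are regular on the chart, hence so are those of products.
\<close>

lemma reg_comb_shear_prod:
  "reg_comb (chart i) (multisets_of_size UNIV (size K)) (\<lambda>K q. mon K)
     (\<lambda>q. \<Prod>j\<in>#K. shear i (aff i q) j)"
proof (induction K)
  case empty
  show ?case
    using reg_comb_form[OF zariski_open_chart one_homogeneous, of i] by simp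
next
  case (add j K)
  have "reg_comb (chart i) (multisets_of_size UNIV 1) (\<lambda>K q. mon K) (\<lambda>q. shear i (aff i q) j)"
  proof (cases "j = i")
    case True
    then show ?thesis
      using reg_comb_form[OF zariski_open_chart Var_homogeneous, of i i]
      by (simp add: shear_def del: One_nat_def)
  next
    case False
    have "reg_comb (chart i) (multisets_of_size UNIV 1) (\<lambda>K q. mon K)
        (\<lambda>q. Var j + (- 1 * affine_coord i j q) *\<^sub>C Var i)"
      by (intro reg_comb_add reg_comb_scale reg_comb_form zariski_open_chart Var_homogeneous
          regular_on_mult regular_on_const affine_coord_regular)
    then show ?thesis
      by (rule reg_comb_cong)
        (use False in \<open>simp add: shear_def aff_def complex_vector.scale_minus_left del: One_nat_def\<close>)
  qed
  from reg_comb_form_mult[OF zariski_open_chart this add.IH] show ?case by simp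
qed

section \<open>Exactness\<close>

lemma sym_cotangent_twist_frame:
  "frame (twist (sym_bundle m cotangent_bundle) k) (chart i) (multisets_of_size (- {i}) m)
     (\<lambda>K q. sym_prod (image_mset (\<lambda>j. differential (affine_coord i j) q) K) \<otimes>\<^sub>C O_gen k i q)"
  unfolding twist_def by (rule tensor_O_frame[OF sym_cotangent_frame])

lemma form_bundle_frame:
  "frame (tensor_bundle (trivial_bundle (homogeneous d :: 'n::finite mpoly set)) (O_bundle k :: ('n, _) vbundle))
     (chart i) (multisets_of_size UNIV d) (\<lambda>K q. mon K \<otimes>\<^sub>C O_gen k i q)"
  by (rule tensor_O_frame[OF trivial_frame[OF zariski_open_chart]])

lemma form_bundle_fibre:
  assumes q: "q \<in> chart i"
  shows "fibre (tensor_bundle (trivial_bundle (homogeneous d :: 'n::finite mpoly set)) (O_bundle k :: ('n, _) vbundle)) q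
    = (\<lambda>F. F \<otimes>\<^sub>C O_gen k i q) ` homogeneous d"
  unfolding frame_fibre[OF form_bundle_frame q]
proof (intro set_eqI iffI)
  fix t
  assume "t \<in> {\<Sum>K\<in>multisets_of_size UNIV d. c K *\<^sub>C ((mon K :: 'n mpoly) \<otimes>\<^sub>C O_gen k i q) | c. True}"
  then obtain c where "t = (\<Sum>K\<in>multisets_of_size UNIV d. c K *\<^sub>C ((mon K :: 'n mpoly) \<otimes>\<^sub>C O_gen k i q))"
    by blast
  then have "t = (\<Sum>K\<in>multisets_of_size UNIV d. c K *\<^sub>C mon K) \<otimes>\<^sub>C O_gen k i q"
    by (simp only: clinear_comb[OF clinear_pure_left])
  moreover have "(\<Sum>K\<in>multisets_of_size UNIV d. c K *\<^sub>C mon K) \<in> (homogeneous d :: 'n mpoly set)"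
    by (intro complex_vector.subspace_sum complex_vector.subspace_scale homogeneous_subspace)
      (simp add: mon_homogeneous multisets_of_size_def)
  ultimately show "t \<in> (\<lambda>F. F \<otimes>\<^sub>C O_gen k i q) ` homogeneous d" by (rule image_eqI)
next
  fix t
  assume "t \<in> (\<lambda>F :: 'n mpoly. F \<otimes>\<^sub>C O_gen k i q) ` homogeneous d"
  then obtain F :: "'n mpoly" where F: "F \<in> homogeneous d" "t = F \<otimes>\<^sub>C O_gen k i q" by blast
  have "t = (\<Sum>K\<in>multisets_of_size UNIV d. Poly_Mapping.lookup F (expo K) *\<^sub>C mon K) \<otimes>\<^sub>C O_gen k i q"
    using F homogeneous_expand[OF F(1)] by simp
  then show "t \<in> {\<Sum>K\<in>multisets_of_size UNIV d. c K *\<^sub>C ((mon K :: 'n mpoly) \<otimes>\<^sub>C O_gen k i q) | c. True}"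
    unfolding clinear_comb[OF clinear_pure_left]
    by (intro CollectI exI[of _ "\<lambda>K. Poly_Mapping.lookup F (expo K)"]) simp
qed

lemma pure_O_eq_0_iff:
  assumes "q \<in> chart i"
  shows "F \<otimes>\<^sub>C O_gen k i q = 0 \<longleftrightarrow> F = 0"
proof -
  obtain f where "clinear f" "f (O_gen k i q) = (1::complex)" using O_functional[OF assms] by blast
  then show ?thesis using pure_tensor_eq_0D clinear_zero[OF clinear_pure_left] by metis
qed

lemma form_bundle_vector_bundle:
  "vector_bundle (tensor_bundle (trivial_bundle (homogeneous d :: 'n::finite mpoly set)) (O_bundle k :: ('n, _) vbundle))"
  by (rule vector_bundleI[OF tensor_sections form_bundle_frame])

lemma sym_inclusion_hom:
  "bundle_hom (twist (sym_bundle m (cotangent_bundle :: ('n::finite, _) vbundle)) (int m + n))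
     (tensor_bundle (trivial_bundle (homogeneous m :: 'n mpoly set)) (O_bundle n :: ('n, _) vbundle)) (sym_inclusion m)"
proof (rule bundle_homI[OF form_bundle_vector_bundle _ sym_cotangent_twist_frame form_bundle_frame
      clinear_sym_inclusion])
  show "restricts (twist (sym_bundle m (cotangent_bundle :: ('n, _) vbundle)) (int m + n))"
    unfolding twist_def
    by (intro tensor_restricts sym_restricts cotangent_restricts O_restricts)
next
  fix i :: 'n and K
  assume K: "K \<in> multisets_of_size (- {i}) m"
  then have "size K = m" by (simp add: multisets_of_size_def)
  then have "reg_comb (chart i) (multisets_of_size UNIV m) (\<lambda>K q. mon K)
      (\<lambda>q. \<Prod>j\<in>#K. shear i (aff i q) j)"
    using reg_comb_shear_prod[of i K] by simp
  from reg_comb_pure[OF this]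
  show "reg_comb (chart i) (multisets_of_size UNIV m) (\<lambda>K q. mon K \<otimes>\<^sub>C O_gen n i q)
      (\<lambda>q. sym_inclusion m q (sym_prod (image_mset (\<lambda>j. differential (affine_coord i j) q) K)
        \<otimes>\<^sub>C O_gen (int m + n) i q))"
    by (rule reg_comb_cong) (rule sym_inclusion_frame[OF _ K])
qed

lemma delta_hom:
  "bundle_hom
     (tensor_bundle (trivial_bundle (homogeneous (Suc d) :: 'n::finite mpoly set)) (O_bundle n :: ('n, _) vbundle))
     (tensor_bundle (trivial_bundle (homogeneous d :: 'n mpoly set)) (O_bundle (n + 1) :: ('n, _) vbundle)) (\<lambda>p. delta)"
proof (rule bundle_homI[OF form_bundle_vector_bundle _ form_bundle_frame form_bundle_frame clinear_delta])
  show "restricts (tensor_bundle (trivial_bundle (homogeneous (Suc d) :: 'n mpoly set)) (O_bundle n :: ('n, _) vbundle))"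
    by (intro tensor_restricts trivial_restricts O_restricts)
next
  fix i :: 'n and K :: "'n multiset"
  assume "K \<in> multisets_of_size UNIV (Suc d)"
  then have "mon K \<in> homogeneous (Suc d)" by (simp add: mon_homogeneous multisets_of_size_def)
  from reg_comb_pure[OF reg_comb_dir_deriv[OF this]]
  show "reg_comb (chart i) (multisets_of_size UNIV d) (\<lambda>K q. mon K \<otimes>\<^sub>C O_gen (n + 1) i q)
      (\<lambda>q. delta (mon K \<otimes>\<^sub>C O_gen n i q))"
    by (rule reg_comb_cong) (rule delta_frame)
qed

lemma sym_inclusion_comb:
  assumes "p \<in> chart i"
  shows "sym_inclusion m p (\<Sum>K\<in>multisets_of_size (- {i}) m. c K *\<^sub>C
      (sym_prod (image_mset (\<lambda>j. differential (affine_coord i j) p) K) \<otimes>\<^sub>C O_gen (int m + n) i p))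
    = (\<Sum>K\<in>multisets_of_size (- {i}) m. c K *\<^sub>C (\<Prod>j\<in>#K. shear i (aff i p) j)) \<otimes>\<^sub>C O_gen n i p"
  unfolding clinear_comb[OF clinear_sym_inclusion] clinear_comb[OF clinear_pure_left]
  by (rule sum.cong) (simp_all add: sym_inclusion_frame[OF assms])

text \<open>
  The products of the \<open>Z\<^sub>j\<close> are linearly independent.
\<close>

lemma sym_inclusion_inj:
  "inj_on (sym_inclusion m p) (fibre (twist (sym_bundle m cotangent_bundle) (int m + n)) p)"
proof -
  obtain i where p: "p \<in> chart i" using chart_cover by blast
  let ?I = "multisets_of_size (- {i}) m"
  let ?e = "\<lambda>K. sym_prod (image_mset (\<lambda>j. differential (affine_coord i j) p) K) \<otimes>\<^sub>C O_gen (int m + n) i p"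
  show ?thesis
    unfolding frame_fibre[OF sym_cotangent_twist_frame p]
  proof (rule inj_onI)
    fix v w
    assume "v \<in> {\<Sum>K\<in>?I. c K *\<^sub>C ?e K | c. True}" "w \<in> {\<Sum>K\<in>?I. c K *\<^sub>C ?e K | c. True}"
    then obtain a b where v: "v = (\<Sum>K\<in>?I. a K *\<^sub>C ?e K)" and w: "w = (\<Sum>K\<in>?I. b K *\<^sub>C ?e K)"
      by blast
    assume "sym_inclusion m p v = sym_inclusion m p w"
    then have "sym_inclusion m p (v - w) = 0"
      by (simp add: clinear_diff[OF clinear_sym_inclusion])
    moreover have "v - w = (\<Sum>K\<in>?I. (a K - b K) *\<^sub>C ?e K)"
      by (simp add: v w complex_vector.scale_left_diff_distrib sum_subtractf)
    ultimately have "(\<Sum>K\<in>?I. (a K - b K) *\<^sub>C (\<Prod>j\<in>#K. shear i (aff i p) j)) \<otimes>\<^sub>C O_gen n i p = 0"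
      using sym_inclusion_comb[OF p, of m "\<lambda>K. a K - b K" n] by simp
    then have 0: "(\<Sum>K\<in>?I. (a K - b K) *\<^sub>C (\<Prod>j\<in>#K. shear i (aff i p) j)) = 0"
      by (simp only: pure_O_eq_0_iff[OF p])
    have "a K - b K = 0" if "K \<in> ?I" for K
      by (rule shear_prod_independent[OF _ 0 that]) (simp add: finite_multisets_of_size)
    then show "v = w" unfolding v w by (intro sum.cong) simp_all
  qed
qed

text \<open>
  In the chart both sides are spanned by the products of \<open>Suc d\<close> of the forms \<open>Z\<^sub>j\<close>: the left side by the
  formula for the inclusion, the right side because these products span the kernel of \<open>\<partial>\<^sub>u\<close>.
\<close>

lemma sym_inclusion_image:
  "sym_inclusion (Suc d) p ` fibre (twist (sym_bundle (Suc d) cotangent_bundle) (int (Suc d) + n)) p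
    = {v \<in> fibre (tensor_bundle (trivial_bundle (homogeneous (Suc d) :: 'n::finite mpoly set)) (O_bundle n :: ('n, _) vbundle)) p.
        delta v = 0}"
proof -
  obtain i where p: "p \<in> chart i" using chart_cover by blast
  let ?I = "multisets_of_size (- {i}) (Suc d)"
  let ?Z = "\<lambda>K. \<Prod>j\<in>#K. shear i (aff i p) j"
  have "sym_inclusion (Suc d) p ` fibre (twist (sym_bundle (Suc d) cotangent_bundle) (int (Suc d) + n)) p
      = {(\<Sum>K\<in>?I. c K *\<^sub>C ?Z K) \<otimes>\<^sub>C O_gen n i p | c. True}"
    unfolding frame_fibre[OF sym_cotangent_twist_frame p] sym_inclusion_comb[OF p, symmetric]
    by (simp only: setcompr_eq_image image_image)
  also have "\<dots> = {F \<otimes>\<^sub>C O_gen n i p | F. F \<in> homogeneous (Suc d) \<and> dir_deriv (aff i p) F = 0}"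
  proof (intro set_eqI iffI)
    fix t
    assume "t \<in> {(\<Sum>K\<in>?I. c K *\<^sub>C ?Z K) \<otimes>\<^sub>C O_gen n i p | c. True}"
    then obtain c where t: "t = (\<Sum>K\<in>?I. c K *\<^sub>C ?Z K) \<otimes>\<^sub>C O_gen n i p" by blast
    have "?Z K \<in> homogeneous (Suc d)" if "K \<in> ?I" for K
      using homogeneous_prod_mset[of K "shear i (aff i p)", OF shear_homogeneous] that
      by (simp add: multisets_of_size_def)
    then have "(\<Sum>K\<in>?I. c K *\<^sub>C ?Z K) \<in> homogeneous (Suc d)"
      by (intro complex_vector.subspace_sum complex_vector.subspace_scale homogeneous_subspace)
    moreover have "dir_deriv (aff i p) (\<Sum>K\<in>?I. c K *\<^sub>C ?Z K) = 0"
      unfolding clinear_comb[OF clinear_dir_deriv]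
      by (rule sum.neutral) (auto simp: dir_deriv_shear_prod aff_self[OF p] multisets_of_size_def)
    ultimately show "t \<in> {F \<otimes>\<^sub>C O_gen n i p | F. F \<in> homogeneous (Suc d) \<and> dir_deriv (aff i p) F = 0}"
      using t by blast
  next
    fix t
    assume "t \<in> {F \<otimes>\<^sub>C O_gen n i p | F. F \<in> homogeneous (Suc d) \<and> dir_deriv (aff i p) F = 0}"
    then obtain F where F: "t = F \<otimes>\<^sub>C O_gen n i p" "F \<in> homogeneous (Suc d)" "dir_deriv (aff i p) F = 0" by blast
    obtain c where "F = (\<Sum>K\<in>?I. c K *\<^sub>C ?Z K)"
      using dir_deriv_kernel[OF aff_self[OF p] F(2,3)] by blast
    then show "t \<in> {(\<Sum>K\<in>?I. c K *\<^sub>C ?Z K) \<otimes>\<^sub>C O_gen n i p | c. True}"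
      unfolding F(1) by blast
  qed
  also have "\<dots> = {v \<in> fibre (tensor_bundle (trivial_bundle (homogeneous (Suc d) :: 'n mpoly set)) (O_bundle n :: ('n, _) vbundle)) p.
        delta v = 0}"
    unfolding form_bundle_fibre[OF p]
    by (auto simp: delta_frame[OF p] pure_O_eq_0_iff[OF p])
  finally show ?thesis .
qed

lemma delta_image:
  "delta ` fibre (tensor_bundle (trivial_bundle (homogeneous (Suc d) :: 'n::finite mpoly set)) (O_bundle n :: ('n, _) vbundle)) p
    = fibre (tensor_bundle (trivial_bundle (homogeneous d :: 'n mpoly set)) (O_bundle (n + 1) :: ('n, _) vbundle)) p"
proof -
  obtain i where p: "p \<in> chart i" using chart_cover by blast
  have "dir_deriv (aff i p) ` homogeneous (Suc d) = homogeneous d"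
  proof
    show "dir_deriv (aff i p) ` homogeneous (Suc d) \<subseteq> homogeneous d"
      using dir_deriv_homogeneous by blast
    show "homogeneous d \<subseteq> dir_deriv (aff i p) ` homogeneous (Suc d)"
      using dir_deriv_surj[OF aff_self[OF p]] by fast
  qed
  then show ?thesis
    unfolding form_bundle_fibre[OF p] image_image delta_frame[OF p]
    by (simp flip: image_image[of "\<lambda>F. F \<otimes>\<^sub>C O_gen (n + 1) i p" "dir_deriv (aff i p)"])
qed

theorem theorem0p0p1:
  fixes N m :: nat and n :: int
  assumes "N \<ge> 1" and "CARD('n::finite) = N + 1" and "m \<ge> 1"
  shows "\<exists>\<iota>. short_exact_sequence
           (twist (sym_bundle m (cotangent_bundle :: ('n, _) vbundle)) (int m + n))
           \<iota>
           (tensor_bundle (trivial_bundle (homogeneous m :: 'n mpoly set)) (O_bundle n))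
           (\<lambda>p. delta)
           (tensor_bundle (trivial_bundle (homogeneous (m - 1) :: 'n mpoly set)) (O_bundle (n + 1)))"
proof -
  obtain d where m: "m = Suc d" using assms(3) by (cases m) auto
  have "vector_bundle (twist (sym_bundle m (cotangent_bundle :: ('n, _) vbundle)) (int m + n))"
    by (rule vector_bundleI[OF _ sym_cotangent_twist_frame]) (simp only: twist_def tensor_sections)
  then show ?thesis
    unfolding short_exact_sequence_def m diff_Suc_1
    by (intro exI[of _ "sym_inclusion (Suc d)"] conjI allI form_bundle_vector_bundle
        sym_inclusion_hom delta_hom sym_inclusion_inj sym_inclusion_image delta_image)
qed

end
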